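(* Let $n\ge1$, let $q_{0}\colon\mathbb{R}^{n}\to\mathbb{R}$ be a positive-definite quadratic form with associated Euclidean norm $\Vert\cdot\Vert=\sqrt{q_{0}}$, and let $\lambda_{1}=\min\{\Vert\lambda\Vert\mid\lambda\in\mathbb{Z}^{n}\setminus\{0\}\}$. Let $q(x)={}^{\mathrm{t}}xA(q)x$ be a quadratic form on $\mathbb{R}^{n}$ with $A(q)$ symmetric, let $b(x,y)={}^{\mathrm{t}}xA(q)y$, and let $\alpha\in\mathbb{R}^{n}$ with $q(\alpha)=1$. Define \[\mathcal{T}_{0}=n^{n/2}\left(2\max{(1,\Vert q\Vert_{\infty})}\right)^{(n-i(q))/2}\Vert\alpha\Vert\sqrt{\det q_{0}}\] and $\mathcal{T}=\max{\Big(\mathcal{T}_{0}^{1/(i(q)+1)},(\sqrt{2}/\lambda_{1})^{i(q)}\mathcal{T}_{0}\Big)}$. Assume that $A(q)\in\mathrm{M}_{n}(\mathbb{Z})$ and that $i(Q)>i(q)$, where $Q(x,y)=q(x)-y^{2}$. Then, for every real number $T\ge\mathcal{T}$, there exists $(\upsilon,\phi)\in\mathbb{Z}^{n}\times\mathbb{Z}$ satisfying $q(\upsilon)=\phi^{2}\ne 0$, \[\Vert\upsilon\Vert^{2}+(\phi\Vert\alpha\Vert)^{2}\le\left(\Vert\alpha\Vert\,\Vert b(\cdot,\alpha)\Vert_{\mathrm{op},\infty}T\right)^{2}\quad\text{and}\quad\vert q(\alpha\phi-\upsilon)\vert\le\frac{2\sqrt{2}\mathcal{T}^{2}\phi}{T}\times\Vert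 b(\cdot,\alpha)\Vert_{\mathrm{op},\infty}.\]
   Context: $\det q_{0}$ is the determinant of the symmetric matrix of $q_{0}$ in the canonical basis. $\Vert q\Vert_{\infty}=\max\{{}^{\mathrm{t}}xA(q)y\mid x,y\in\mathbb{R}^{n},\ \Vert x\Vert=\Vert y\Vert=1\}$. $\Vert b(\cdot,\alpha)\Vert_{\mathrm{op},\infty}$ is the operator norm of the linear form $x\mapsto b(x,\alpha)$ on $(\mathbb{R}^{n},\Vert\cdot\Vert)$. For a quadratic form over a field, the isotropy index $i(\cdot)$ is the maximal dimension of a totally isotropic subspace; here $i(q)$ is the isotropy index of $q$ viewed as a quadratic form on $\mathbb{Q}^{n}$ (it has rational coefficients) and $i(Q)$ that of $Q(x,y)=q(x)-y^{2}$ on $\mathbb{Q}^{n}\times\mathbb{Q}$. *)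

theory Defs
  imports "HOL-Analysis.Analysis"
begin

text \<open>
  A quadratic form on \<open>R\<^sup>n\<close> is given by its symmetric matrix \<open>A\<close> in the canonical basis, and
  \<open>n = CARD('n)\<close>. The forms below are generic in the coefficient ring because the same integral
  matrix is used over the integers, the rationals and the reals.
\<close>

definition bform :: "'a::comm_ring_1 ^ 'n ^ 'n \<Rightarrow> 'a ^ 'n \<Rightarrow> 'a ^ 'n \<Rightarrow> 'a" where
  "bform A x y = (\<Sum>i\<in>UNIV. x $ i * (A *v y) $ i)"

definition qform :: "'a::comm_ring_1 ^ 'n ^ 'n \<Rightarrow> 'a ^ 'n \<Rightarrow> 'a" where
  "qform A x = bform A x x"

definition int_vec :: "int ^ 'n \<Rightarrow> 'a::ring_1 ^ 'n" where
  "int_vec v = (\<chi> i. of_int (v $ i))"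

definition int_mat :: "int ^ 'n ^ 'm \<Rightarrow> 'a::ring_1 ^ 'n ^ 'm" where
  "int_mat A = map_matrix of_int A"

text \<open>
  The maximum below is over a nonempty set (the zero subspace is isotropic) which is finite as soon
  as the ambient space is finite-dimensional.
\<close>

definition isotropy_index ::
    "('k::field \<Rightarrow> 'v::ab_group_add \<Rightarrow> 'v) \<Rightarrow> ('v \<Rightarrow> 'k) \<Rightarrow> nat" where
  "isotropy_index smul f =
     Max {vector_space.dim smul W | W. module.subspace smul W \<and> (\<forall>w\<in>W. f w = 0)}"

definition iso_q :: "int ^ 'n ^ 'n \<Rightarrow> nat" where
  "iso_q A = isotropy_index (*s) (qform (int_mat A :: rat ^ 'n ^ 'n))"

definition iso_Q :: "int ^ 'n ^ 'n \<Rightarrow> nat" where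
  "iso_Q A = isotropy_index (module_prod.scale (*s) (*))
     (\<lambda>(x, y). qform (int_mat A :: rat ^ 'n ^ 'n) x - y\<^sup>2)"

definition qnorm :: "real ^ 'n ^ 'n \<Rightarrow> real ^ 'n \<Rightarrow> real" where
  "qnorm A0 x = sqrt (qform A0 x)"

text \<open>
  For positive definite \<open>A0\<close>, the extrema in the following three definitions are attained:
  over the nonzero lattice points by discreteness, over the unit sphere by compactness.
\<close>

definition lambda1 :: "real ^ 'n ^ 'n \<Rightarrow> real" where
  "lambda1 A0 = Inf {qnorm A0 (int_vec l) | l :: int ^ 'n. l \<noteq> 0}"

definition qsup :: "real ^ 'n ^ 'n \<Rightarrow> real ^ 'n ^ 'n \<Rightarrow> real" where
  "qsup A0 B = Sup {bform B x y | x y. qnorm A0 x = 1 \<and> qnorm A0 y = 1}"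

definition opnorm :: "real ^ 'n ^ 'n \<Rightarrow> (real ^ 'n \<Rightarrow> real) \<Rightarrow> real" where
  "opnorm A0 f = Sup {\<bar>f x\<bar> | x. qnorm A0 x = 1}"

definition T_zero :: "real ^ 'n ^ 'n \<Rightarrow> int ^ 'n ^ 'n \<Rightarrow> real ^ 'n \<Rightarrow> real" where
  "T_zero A0 A \<alpha> =
     real CARD('n) powr (real CARD('n) / 2)
     * (2 * max 1 (qsup A0 (int_mat A))) powr ((real CARD('n) - real (iso_q A)) / 2)
     * qnorm A0 \<alpha> * sqrt (det A0)"

definition T_bound :: "real ^ 'n ^ 'n \<Rightarrow> int ^ 'n ^ 'n \<Rightarrow> real ^ 'n \<Rightarrow> real" where
  "T_bound A0 A \<alpha> =
     max (T_zero A0 A \<alpha> powr (1 / (real (iso_q A) + 1)))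
         ((sqrt 2 / lambda1 A0) ^ iso_q A * T_zero A0 A \<alpha>)"

end

theory Submission
  imports Defs
begin

text \<open>
  Put \<open>Q(x, y) = q(x) - y\<^sup>2\<close> and \<open>T' = T_bound A0 A \<alpha>\<close>. The vectors \<open>(\<alpha>, 1)\<close> and \<open>(\<alpha>, -1)\<close> span a
  hyperbolic plane for \<open>Q\<close>; let \<open>g\<close> be the isometry of \<open>Q\<close> that multiplies them by \<open>T' / T\<close> and
  \<open>T / T'\<close> and fixes their orthogonal complement. An integer isotropic vector \<open>(\<upsilon>, \<phi>)\<close> with
  \<open>\<phi> \<noteq> 0\<close> and \<open>\<parallel>g (\<upsilon>, \<phi>)\<parallel> \<le> T'\<close> has the required properties, since
  \<open>q(\<phi> \<alpha> - \<upsilon>) = 2 \<phi> (\<phi> - b(\<upsilon>, \<alpha>))\<close>.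

  Such a vector is found in the lattice \<open>g (\<int>\<^sup>n \<times> \<int>)\<close>, on which \<open>Q\<close> is integral and bounded by
  \<open>\<sigma> = max 1 \<parallel>q\<parallel>\<close>. Let \<open>F\<close> be a maximal isotropic rational subspace whose lattice has (almost)
  minimal covolume. If a lattice vector \<open>z\<close> outside \<open>F\<close> is not orthogonal to \<open>F\<close>, then \<open>F + \<real>z\<close>
  contains a second maximal isotropic subspace, and comparing covolumes shows that \<open>z\<close> has distance
  at least \<open>1 / sqrt (2 \<sigma>)\<close> from \<open>F\<close>; if \<open>z\<close> is orthogonal to \<open>F\<close>, then \<open>Q(z)\<close> is a nonzero integer
  and the same bound holds. Hence a box adapted to \<open>F\<close>, to its hyperplane \<open>\<phi> = 0\<close> and to the length
  of the shortest isotropic vector with \<open>\<phi> \<noteq> 0\<close> contains no nonzero lattice point, and Minkowski's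
  theorem on linear forms bounds that length.
\<close>

section \<open>Minkowski's theorem on linear forms\<close>

text \<open>The dimension d = i(q) + 1 is forced: the hyperplane \<phi> = 0 carries the form q, so
  no totally isotropic rational space of dimension d fits into it, and none can be enlarged, since a
  larger one would meet the hyperplane in dimension d. Put e = n + 1 - d = n - i(q). Up to
  \<epsilon>, the box loses a factor sqrt d in d directions and has side 1 / sqrt (2 \<sigma> e) in
  the other e; convexity of x ln x turns d^(d/2) e^(e/2) into n^(n/2). The lattice has covolume
  ||\<alpha>|| sqrt (det q0), since isometries of Q preserve volume. The factor sqrt 2 / \<lambda>1
  arises because g shortens vectors with \<phi> = 0 by a factor of at most sqrt 2, and the two terms
  of the maximum in T' belong to the cases where the shortest isotropic vector with \<phi> nonzero
  is shorter or longer than \<lambda>1 / sqrt 2. Covolumes of sublattices are handled as suprema of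
  completed determinants; only their ratios matter, so the normalization cancels. A family within 1
  + \<epsilon> of the infimal covolume replaces a minimal one, and \<epsilon> tends to 0 at the
  end.\<close>

lemma int_vec_simps [simp]:
  "int_vec 0 = 0"
  "int_vec (x + y) = int_vec x + int_vec y"
  "int_vec (x - y) = int_vec x - int_vec y"
  "int_vec (c *s x) = of_int c *s int_vec x"
  "int_vec x $ i = of_int (x $ i)"
  by (simp_all add: int_vec_def vec_eq_iff)

lemma card_int_vec_box:
  "card {z :: int ^ 'n. \<forall>i. 0 \<le> z $ i \<and> z $ i < int R} = R ^ CARD('n)"
  "finite {z :: int ^ 'n. \<forall>i. 0 \<le> z $ i \<and> z $ i < int R}"
proof -
  have *: "bij_betw vec_lambda (UNIV \<rightarrow>\<^sub>E {0..<int R}) {z :: int ^ 'n. \<forall>i. 0 \<le> z $ i \<and> z $ i < int R}"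
    by (rule bij_betw_byWitness[where f' = vec_nth]) (auto simp: PiE_def)
  show "card {z :: int ^ 'n. \<forall>i. 0 \<le> z $ i \<and> z $ i < int R} = R ^ CARD('n)"
    using bij_betw_same_card[OF *] by (simp add: card_PiE)
  show "finite {z :: int ^ 'n. \<forall>i. 0 \<le> z $ i \<and> z $ i < int R}"
    using bij_betw_finite[OF *] by (simp add: finite_PiE)
qed

text \<open>A packing argument: the translates by the integer points of a cube of side
  \<open>Suc R\<close> are disjoint and lie in a cube of side \<open>Suc R + 2 * b\<close>, where
  \<open>b\<close> bounds the coordinates on \<open>S\<close>. Dividing the volumes and letting
  \<open>R\<close> tend to infinity leaves 1.\<close>

lemma measure_le_one_of_disjoint_translates:
  fixes S :: "(real ^ 'n) set"
  assumes meas: "S \<in> lmeasurable" and bdd: "bounded S"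
    and disj: "\<And>z :: int ^ 'n. z \<noteq> 0 \<Longrightarrow> S \<inter> (+) (int_vec z) ` S = {}"
  shows "measure lebesgue S \<le> 1"
proof -
  obtain B :: real where B: "\<And>x. x \<in> S \<Longrightarrow> norm x \<le> B"
    using bdd unfolding bounded_iff by blast
  define b where "b = nat \<lceil>B\<rceil>"
  have b: "\<bar>x $ i\<bar> \<le> real b" if "x \<in> S" for x i
    using component_le_norm_cart[of x i] B[OF that] unfolding b_def by linarith
  have main: "real (Suc R) ^ CARD('n) * measure lebesgue S \<le> (real (Suc R) + 2 * real b) ^ CARD('n)" for R
  proof -
    define Z where "Z = {z :: int ^ 'n. \<forall>i. 0 \<le> z $ i \<and> z $ i < int (Suc R)}"
    have Z: "finite Z" "card Z = Suc R ^ CARD('n)"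
      unfolding Z_def using card_int_vec_box[where ?'n = 'n, of "Suc R"] by auto
    let ?t = "\<lambda>z :: int ^ 'n. (+) (int_vec z) ` S"
    have "pairwise (\<lambda>z w. negligible (?t z \<inter> ?t w)) Z"
    proof (rule pairwiseI)
      fix z w :: "int ^ 'n" assume "z \<noteq> w"
      have "?t z \<inter> ?t w = {}"
      proof (rule ccontr)
        assume "?t z \<inter> ?t w \<noteq> {}"
        then obtain x y where xy: "x \<in> S" "y \<in> S" "int_vec z + x = int_vec w + y" by auto
        then have "x = int_vec (w - z) + y" by (simp add: algebra_simps)
        then have "x \<in> S \<inter> (+) (int_vec (w - z)) ` S" using xy by blast
        then show False using disj[of "w - z"] \<open>z \<noteq> w\<close> by auto
      qed
      then show "negligible (?t z \<inter> ?t w)" by simp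
    qed
    then have "measure lebesgue (\<Union>(?t ` Z)) = (\<Sum>z\<in>Z. measure lebesgue (?t z))"
      by (intro measure_negligible_finite_Union_image) (auto simp: Z measurable_translation meas)
    also have "\<dots> = real (Suc R) ^ CARD('n) * measure lebesgue S"
      by (simp add: measure_translation Z)
    finally have eq: "real (Suc R) ^ CARD('n) * measure lebesgue S = measure lebesgue (\<Union>(?t ` Z))" ..
    let ?l = "(\<chi> i. - real b) :: real ^ 'n" and ?u = "(\<chi> i. real (Suc R) + real b) :: real ^ 'n"
    have "\<Union>(?t ` Z) \<subseteq> cbox ?l ?u"
    proof
      fix x assume "x \<in> \<Union>(?t ` Z)"
      then obtain z y where zy: "z \<in> Z" "y \<in> S" "x = int_vec z + y" by auto
      have "- real b \<le> x $ i \<and> x $ i \<le> real (Suc R) + real b" for i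
      proof -
        have "0 \<le> z $ i" "z $ i < int (Suc R)" using zy by (auto simp: Z_def)
        then have "0 \<le> real_of_int (z $ i)" "real_of_int (z $ i) \<le> real (Suc R)" by linarith+
        then show ?thesis using b[OF zy(2), of i] zy(3) by auto
      qed
      then show "x \<in> cbox ?l ?u" by (simp add: mem_box_cart)
    qed
    then have "measure lebesgue (\<Union>(?t ` Z)) \<le> measure lebesgue (cbox ?l ?u)"
      by (intro measure_mono_fmeasurable)
         (auto intro!: fmeasurableD sets.finite_UN simp: Z measurable_translation meas)
    also have "\<dots> = (real (Suc R) + 2 * real b) ^ CARD('n)"
      by (simp add: content_cbox_cart interval_eq_empty_cart not_less add.commute)
    finally show ?thesis using eq by simp
  qed
  have main': "measure lebesgue S \<le> (1 + 2 * real b * inverse (real (Suc R))) ^ CARD('n)" for R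
  proof -
    have "measure lebesgue S \<le> (real (Suc R) + 2 * real b) ^ CARD('n) / real (Suc R) ^ CARD('n)"
      using main[of R] by (subst pos_le_divide_eq) (auto simp: mult.commute)
    also have "\<dots> = ((real (Suc R) + 2 * real b) / real (Suc R)) ^ CARD('n)"
      by (simp add: power_divide)
    also have "(real (Suc R) + 2 * real b) / real (Suc R) = 1 + 2 * real b * inverse (real (Suc R))"
      by (simp add: divide_simps)
    finally show ?thesis .
  qed
  have "(\<lambda>R. (1 + 2 * real b * inverse (real (Suc R))) ^ CARD('n)) \<longlonglongrightarrow> (1 + 2 * real b * 0) ^ CARD('n)"
    by (intro tendsto_intros LIMSEQ_inverse_real_of_nat)
  then show ?thesis
    using LIMSEQ_le_const[where a = "measure lebesgue S"] main' by auto
qed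

lemma measure_linear_image_of_cbox:
  fixes f :: "real ^ 'n \<Rightarrow> real ^ 'n"
  assumes "linear f"
    and cbox: "\<And>a b. cbox a b \<noteq> {} \<Longrightarrow> measure lebesgue (f ` cbox a b) = m * measure lebesgue (cbox a b)"
    and "S \<in> lmeasurable"
  shows "f ` S \<in> lmeasurable" "measure lebesgue (f ` S) = m * measure lebesgue S"
proof -
  have "measure lebesgue (f ` cbox a b) = m * measure lebesgue (cbox a b)" for a b
    using cbox[of a b] by (cases "cbox a b = {}") auto
  then show "f ` S \<in> lmeasurable" "measure lebesgue (f ` S) = m * measure lebesgue S"
    using measure_linear_sufficient[OF assms(1,3), of m] by auto
qed

text \<open>The distribution states the next fact only for well-ordered index types.\<close>

lemma measure_linear_image_finite:
  fixes f :: "real ^ 'n \<Rightarrow> real ^ 'n"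
  assumes "linear f" "S \<in> lmeasurable"
  shows "f ` S \<in> lmeasurable \<and> measure lebesgue (f ` S) = \<bar>det (matrix f)\<bar> * measure lebesgue S"
proof -
  define Q where "Q f \<longleftrightarrow> (\<forall>S \<in> lmeasurable. f ` S \<in> lmeasurable \<and>
    measure lebesgue (f ` S) = \<bar>det (matrix f)\<bar> * measure lebesgue S)" for f :: "real ^ 'n \<Rightarrow> real ^ 'n"
  have "Q f"
    using assms(1)
  proof (rule induct_linear_elementary[where P = Q])
    fix f g :: "real ^ 'n \<Rightarrow> real ^ 'n" assume 1: "linear f" "linear g" "Q f" "Q g"
    show "Q (f \<circ> g)" unfolding Q_def
    proof
      fix S :: "(real ^ 'n) set" assume S: "S \<in> lmeasurable"
      have "(f \<circ> g) ` S = f ` (g ` S)" by (rule image_comp[symmetric])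
      moreover have "g ` S \<in> lmeasurable" using 1(4) S by (simp add: Q_def)
      ultimately show "(f \<circ> g) ` S \<in> lmeasurable \<and>
        measure lebesgue ((f \<circ> g) ` S) = \<bar>det (matrix (f \<circ> g))\<bar> * measure lebesgue S"
        using 1 S matrix_compose[of g f] by (simp add: Q_def abs_mult det_mul)
    qed
  next
    fix f :: "real ^ 'n \<Rightarrow> real ^ 'n" and i assume 2: "linear f" "\<And>x. f x $ i = 0"
    then have "\<not> inj f"
      by (metis linear_injective_imp_surjective one_neq_zero surjE vec_component)
    then have "negligible (f ` S)" "det (matrix f) = 0" for S
      using 2(1) negligible_linear_singular_image det_nz_iff_inj by blast+
    then show "Q f"
      by (simp add: Q_def negligible_iff_measure)
  next
    fix c :: "'n \<Rightarrow> real"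
    have "matrix (\<lambda>x. \<chi> i. c i * x $ i) = (\<chi> i j. if i = j then c i else 0)"
      by (auto simp: matrix_def axis_def vec_eq_iff)
    then have "det (matrix (\<lambda>x. \<chi> i. c i * x $ i)) = prod c UNIV"
      by (simp add: det_diagonal)
    then show "Q (\<lambda>x. \<chi> i. c i * x $ i)" by (simp add: Q_def measurable_stretch measure_stretch)
  next
    fix m n :: 'n assume 4: "m \<noteq> n"
    let ?p = "Transposition.transpose m n"
    let ?h = "\<lambda>x :: real ^ 'n. \<chi> i. x $ ?p i"
    have p: "?p permutes UNIV" by (simp add: permutes_swap_id)
    have lin: "linear ?h" by (rule linearI) (simp_all add: vec_eq_iff)
    have "?h ` cbox a b = cbox (?h a) (?h b)" for a b
    proof (intro equalityI subsetI)
      fix x assume "x \<in> cbox (?h a) (?h b)"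
      then have "?h x \<in> cbox a b" by (auto simp: mem_box_cart) (metis transpose_involutory)+
      then show "x \<in> ?h ` cbox a b" by (intro image_eqI[of _ _ "?h x"]) (simp_all add: vec_eq_iff)
    qed (auto simp: mem_box_cart)
    moreover have "(\<Prod>i\<in>UNIV. ?h b $ i - ?h a $ i) = (\<Prod>i\<in>UNIV. b $ i - a $ i)" for a b
      using prod.permute[OF p, of "\<lambda>i. b $ i - a $ i"] by (simp add: o_def)
    ultimately have cbox: "measure lebesgue (?h ` cbox a b) = 1 * measure lebesgue (cbox a b)" if "cbox a b \<noteq> {}" for a b
    proof -
      have "cbox (?h a) (?h b) \<noteq> {}" using that \<open>?h ` cbox a b = cbox (?h a) (?h b)\<close> by (metis image_is_empty)
      then have "measure lebesgue (cbox (?h a) (?h b)) = measure lebesgue (cbox a b)"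
        using content_cbox_cart[OF that] content_cbox_cart[of "?h a" "?h b"]
          \<open>(\<Prod>i\<in>UNIV. ?h b $ i - ?h a $ i) = (\<Prod>i\<in>UNIV. b $ i - a $ i)\<close>
        by (simp add: measure_completion)
      then show ?thesis using \<open>?h ` cbox a b = cbox (?h a) (?h b)\<close> by simp
    qed
    have "matrix ?h = (\<chi> i. mat 1 $ ?p i)"
      by (auto simp: matrix_def axis_def mat_def vec_eq_iff)
    then have "\<bar>det (matrix ?h)\<bar> = 1"
      using det_permute_rows[OF p, of "mat 1 :: real ^ 'n ^ 'n"] by (simp add: sign_swap_id 4)
    then show "Q ?h" using measure_linear_image_of_cbox[OF lin cbox] by (simp add: Q_def)
  next
    fix m n :: 'n assume 5: "m \<noteq> n"
    let ?h = "\<lambda>x :: real ^ 'n. \<chi> i. if i = m then x $ m + x $ n else x $ i"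
    have lin: "linear ?h" by (rule linearI) (simp_all add: vec_eq_iff algebra_simps)
    have cbox: "measure lebesgue (?h ` cbox a b) = 1 * measure lebesgue (cbox a b)" if "cbox a b \<noteq> {}" for a b
    proof -
      \<comment> \<open>The volume formula for sheared boxes asks for a nonnegative coordinate of
        the lower corner; this translation moves that corner to the origin.\<close>
      let ?v = "(\<chi> i. - a $ i) :: real ^ 'n"
      have "(+) (?h ?v) ` ?h ` cbox a b = ?h ` (+) ?v ` cbox a b"
        using linear_add[OF lin] by (simp add: image_image)
      then have "measure lebesgue (?h ` cbox a b) = measure lebesgue (?h ` (+) ?v ` cbox a b)"
        using measure_translation[of "?h ?v" "?h ` cbox a b"] by (simp only:)
      also have "(+) ?v ` cbox a b = cbox (?v + a) (?v + b)"
        by (rule cbox_translation[symmetric])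
      also have "measure lebesgue (?h ` cbox (?v + a) (?v + b)) = measure lebesgue (cbox (?v + a) (?v + b))"
      proof (rule measure_shear_interval[OF 5])
        show "cbox (?v + a) (?v + b) \<noteq> {}" using that by (simp add: cbox_translation)
      qed simp
      also have "\<dots> = measure lebesgue (cbox a b)"
        by (simp only: cbox_translation measure_translation)
      finally show ?thesis by simp
    qed
    have "matrix ?h = (\<chi> k. if k = m then row m (mat 1) + 1 *s row n (mat 1) else row k (mat 1))"
      by (auto simp: matrix_def axis_def mat_def vec_eq_iff row_def)
    then have "det (matrix ?h) = 1"
      using det_row_operation[OF 5, of "mat 1" 1] by simp
    then show "Q ?h" using measure_linear_image_of_cbox[OF lin cbox] by (simp add: Q_def)
  qed
  then show ?thesis using assms(2) by (simp add: Q_def)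
qed

text \<open>The box \<open>K\<close> has half-widths \<open>c i / 2\<close>, so two overlapping
  integer translates of its preimage would differ by an integer point whose forms are all strictly
  below \<open>c i\<close>. Without such a point the preimage packs and has volume at most
  1.\<close>

theorem minkowski_linear_forms:
  fixes M :: "real ^ 'n ^ 'n" and c :: "'n \<Rightarrow> real"
  assumes M: "det M \<noteq> 0" and c: "\<And>i. c i > 0"
    and no_pt: "\<And>z :: int ^ 'n. z \<noteq> 0 \<Longrightarrow> \<exists>i. c i \<le> \<bar>(M *v int_vec z) $ i\<bar>"
  shows "(\<Prod>i\<in>UNIV. c i) \<le> \<bar>det M\<bar>"
proof -
  obtain N where N: "M ** N = mat 1" "N ** M = mat 1"
    using M invertible_det_nz[of M] unfolding invertible_def by auto
  define K where "K = box (\<chi> i. - c i / 2) ((\<chi> i. c i / 2) :: real ^ 'n)"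
  define S where "S = (*v) N ` K"
  have K: "K \<in> lmeasurable" "bounded K" unfolding K_def by (auto simp: bounded_box)
  have "measure lebesgue K = (\<Prod>i\<in>UNIV. c i)"
  proof -
    have ne: "cbox (\<chi> i. - c i / 2) ((\<chi> i. c i / 2) :: real ^ 'n) \<noteq> {}"
      using c by (auto simp: interval_ne_empty_cart less_imp_le)
    have "measure lebesgue K = measure lebesgue (cbox (\<chi> i. - c i / 2) ((\<chi> i. c i / 2) :: real ^ 'n))"
      unfolding K_def by (simp add: measure_completion measure_lborel_box_eq measure_lborel_cbox_eq)
    also have "\<dots> = (\<Prod>i\<in>UNIV. c i)"
      using content_cbox_cart[OF ne] by (simp add: measure_completion)
    finally show ?thesis .
  qed
  then have measS: "measure lebesgue S = \<bar>det N\<bar> * (\<Prod>i\<in>UNIV. c i)"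
    unfolding S_def using measure_linear_image_finite[of "(*v) N" K] K by simp
  have "measure lebesgue S \<le> 1"
  proof (rule measure_le_one_of_disjoint_translates)
    show "S \<in> lmeasurable" unfolding S_def using K measure_linear_image_finite[of "(*v) N" K] by simp
    show "bounded S" unfolding S_def using K
      by (intro bounded_linear_image) (auto simp: linear_linear)
  next
    fix z :: "int ^ 'n" assume "z \<noteq> 0"
    show "S \<inter> (+) (int_vec z) ` S = {}"
    proof (rule ccontr)
      assume "S \<inter> (+) (int_vec z) ` S \<noteq> {}"
      then obtain x y where xy: "x \<in> K" "y \<in> K" "N *v x = int_vec z + N *v y"
        by (auto simp: S_def)
      then have "int_vec z = N *v (x - y)" by (simp add: matrix_vector_mult_diff_distrib)
      then have "M *v int_vec z = x - y" by (simp add: matrix_vector_mul_assoc N)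
      moreover have "\<bar>(x - y) $ i\<bar> < c i" for i
      proof -
        have "- c i / 2 < x $ i" "x $ i < c i / 2" "- c i / 2 < y $ i" "y $ i < c i / 2"
          using xy unfolding K_def mem_box_cart by auto
        then show ?thesis by simp
      qed
      ultimately show False using no_pt[OF \<open>z \<noteq> 0\<close>] by (metis not_less)
    qed
  qed
  moreover have "\<bar>det M\<bar> * \<bar>det N\<bar> = 1"
    using arg_cong[OF N(1), of det] by (simp add: det_mul flip: abs_mult)
  moreover have "\<bar>det M\<bar> * measure lebesgue S = (\<bar>det M\<bar> * \<bar>det N\<bar>) * (\<Prod>i\<in>UNIV. c i)"
    by (simp only: measS mult.assoc)
  ultimately show ?thesis
    using mult_left_mono[of "measure lebesgue S" 1 "\<bar>det M\<bar>"] by simp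
qed

section \<open>Covolume of a family of vectors\<close>

lemma det_int_mat: "det (int_mat M :: 'a::comm_ring_1 ^ 'n ^ 'n) = of_int (det M)"
  by (simp add: det_def int_mat_def map_matrix_def of_int_sum of_int_prod)

text \<open>A family rather than a set: a repeated vector makes it dependent, and its members keep
  fixed indices, which lets them serve as rows of a square matrix.\<close>

definition indep_family :: "'i set \<Rightarrow> ('i \<Rightarrow> 'a::real_vector) \<Rightarrow> bool" where
  "indep_family I w \<longleftrightarrow> inj_on w I \<and> independent (w ` I)"

lemma indep_family_iff:
  assumes "finite I"
  shows "indep_family I w \<longleftrightarrow> (\<forall>c. (\<Sum>i\<in>I. c i *\<^sub>R w i) = 0 \<longrightarrow> (\<forall>i\<in>I. c i = 0))"
proof
  assume *: "indep_family I w"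
  then have inj: "inj_on w I" and ind: "independent (w ` I)" by (auto simp: indep_family_def)
  show "\<forall>c. (\<Sum>i\<in>I. c i *\<^sub>R w i) = 0 \<longrightarrow> (\<forall>i\<in>I. c i = 0)"
  proof (intro allI impI ballI)
    fix c i assume c: "(\<Sum>i\<in>I. c i *\<^sub>R w i) = 0" and i: "i \<in> I"
    have "(\<Sum>x\<in>w ` I. c (the_inv_into I w x) *\<^sub>R x) = 0"
      using c by (simp add: sum.reindex[OF inj] the_inv_into_f_f[OF inj])
    then have "c (the_inv_into I w (w i)) = 0"
      using independentD[OF ind finite_imageI[OF assms] subset_refl, of "\<lambda>x. c (the_inv_into I w x)"] i by blast
    then show "c i = 0" by (simp add: the_inv_into_f_f[OF inj i])
  qed
next
  assume *: "\<forall>c. (\<Sum>i\<in>I. c i *\<^sub>R w i) = 0 \<longrightarrow> (\<forall>i\<in>I. c i = 0)"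
  have inj: "inj_on w I"
  proof (rule inj_onI, rule ccontr)
    fix i j assume ij: "i \<in> I" "j \<in> I" "w i = w j" "i \<noteq> j"
    have "(\<Sum>l\<in>I. (of_bool (l = i) - of_bool (l = j)) *\<^sub>R w l) = w i - w j"
      using ij assms by (simp add: scaleR_diff_left sum_subtractf of_bool_def if_distrib[of "\<lambda>c. c *\<^sub>R _"] cong: if_cong)
    then have "(of_bool (i = i) - of_bool (i = j) :: real) = 0"
      using *[rule_format, of "\<lambda>l. of_bool (l = i) - of_bool (l = j)" i] ij(1,3) by simp
    then show False using ij by simp
  qed
  moreover have "independent (w ` I)"
  proof (rule independent_if_scalars_zero)
    show "finite (w ` I)" using assms by simp
    fix f x assume "(\<Sum>x\<in>w ` I. f x *\<^sub>R x) = 0" "x \<in> w ` I"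
    then show "f x = 0" using * by (auto simp: sum.reindex[OF inj])
  qed
  ultimately show "indep_family I w" by (simp add: indep_family_def)
qed

lemma indep_family_not_in_span:
  assumes "indep_family I w" "k \<in> I"
  shows "w k \<notin> span (w ` (I - {k}))"
proof -
  have "w ` (I - {k}) = w ` I - {w k}"
    using assms by (auto simp: indep_family_def inj_on_def)
  then show ?thesis using assms by (auto simp: indep_family_def dependent_def)
qed

lemma indep_family_exchange:
  assumes w: "indep_family I w" and k: "k \<in> I" and x: "x \<notin> span (w ` (I - {k}))"
  shows "indep_family I (w(k := x))"
proof -
  have im: "(w(k := x)) ` I = insert x (w ` (I - {k}))" using k by auto
  have "independent (w ` (I - {k}))"
    using w by (meson indep_family_def independent_mono image_mono Diff_subset)
  moreover have "inj_on (w(k := x)) I"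
    using w x span_base[of _ "w ` (I - {k})"] unfolding indep_family_def inj_on_def by auto
  ultimately show ?thesis using x unfolding indep_family_def im by (simp add: independent_insert)
qed

lemma indep_family_linear_image_iff:
  assumes "linear f" "inj f" "finite I"
  shows "indep_family I (\<lambda>i. f (w i)) \<longleftrightarrow> indep_family I w"
proof -
  have "(\<Sum>i\<in>I. c i *\<^sub>R f (w i)) = f (\<Sum>i\<in>I. c i *\<^sub>R w i)" for c
    using assms(1) by (simp add: linear_sum linear_scale)
  moreover have "f x = 0 \<longleftrightarrow> x = 0" for x
    using assms(1,2) by (metis injD linear_0)
  ultimately show ?thesis by (simp add: indep_family_iff[OF assms(3)])
qed

lemma det_nz_of_independent_rows:
  fixes r :: "'n \<Rightarrow> 'a::field ^ 'n"
  assumes inj: "inj r" and ind: "vec.independent (range r)"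
  shows "det (\<chi> i. r i) \<noteq> 0"
proof -
  have "\<forall>c. (\<Sum>i\<in>UNIV. c i *s row i (\<chi> i. r i)) = 0 \<longrightarrow> (\<forall>i. c i = 0)"
  proof (intro allI impI)
    fix c i assume "(\<Sum>i\<in>UNIV. c i *s row i (\<chi> i. r i)) = 0"
    then have "(\<Sum>x\<in>range r. c (inv r x) *s x) = 0"
      by (simp add: sum.reindex[OF inj] inv_f_f[OF inj] row_def vec_nth_inverse)
    then have "c (inv r (r i)) = 0"
      by (intro vec.independentD[OF ind, where u = "\<lambda>x. c (inv r x)" and t = "range r"]) auto
    then show "c i = 0" by (simp add: inv_f_f[OF inj])
  qed
  from iffD2[OF matrix_right_invertible_independent_rows this]
  obtain B where "(\<chi> i. r i) ** B = mat 1" by blast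
  then have "det (\<chi> i. r i) * det B = 1" by (metis det_mul det_I)
  then show ?thesis by auto
qed

text \<open>Extend \<open>w\<close> to a basis by standard basis vectors and distribute the added
  ones over the indices outside \<open>I\<close>. For integral \<open>w\<close> the completed matrix
  is integral, so its determinant is a nonzero integer; this is applied over both the reals and the
  rationals.\<close>

lemma det_completion_by_axes:
  fixes w :: "'n \<Rightarrow> 'a::field ^ 'n"
  assumes inj: "inj_on w I" and ind: "vec.independent (w ` I)"
  obtains f :: "'n \<Rightarrow> 'n" where "det (\<chi> i. if i \<in> I then w i else axis (f i) 1) \<noteq> 0"
proof -
  let ?S = "w ` I"
  obtain B where B: "?S \<subseteq> B" "B \<subseteq> ?S \<union> cart_basis" "vec.independent B" "?S \<union> cart_basis \<subseteq> vec.span B"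
    by (rule vec.maximal_independent_subset_extend[OF Un_upper1 ind])
  have "vec.span cart_basis \<subseteq> vec.span B" using B(4) by (intro vec.span_minimal) auto
  then have "vec.span B = UNIV" by auto
  then have "vec.dim B = CARD('n)"
    by (metis vec.dim_span vec_dim_card)
  then have cB: "card B = CARD('n)" using B(3) by (simp add: vec.dim_eq_card_independent)
  have fB: "finite B" using B(3) by (rule vec.finiteI_independent)
  have "card (B - ?S) = card (UNIV - I)"
    using B(1) fB cB by (simp add: card_Diff_subset card_image[OF inj])
  then obtain g where g: "bij_betw g (UNIV - I) (B - ?S)"
    using fB by (metis finite_Diff finite_class.finite_UNIV finite_same_card_bij)
  have "\<forall>i. \<exists>j. i \<notin> I \<longrightarrow> g i = axis j 1"
  proof
    fix i show "\<exists>j. i \<notin> I \<longrightarrow> g i = axis j 1"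
    proof (cases "i \<in> I")
      case False
      then have "g i \<in> B - ?S" using g by (auto simp: bij_betw_def)
      then show ?thesis using B(2) by (auto simp: cart_basis_def)
    qed auto
  qed
  then obtain f where f: "\<And>i. i \<notin> I \<Longrightarrow> g i = axis (f i) 1" by metis
  let ?r = "\<lambda>i. if i \<in> I then w i else axis (f i) 1"
  have r: "?r = (\<lambda>i. if i \<in> I then w i else g i)" by (auto simp: f fun_eq_iff)
  have "inj ?r" unfolding r
  proof (rule injI)
    have g': "inj_on g (UNIV - I)" "g ` (UNIV - I) = B - ?S" using g by (auto simp: bij_betw_def)
    have gS: "g i \<notin> ?S" if "i \<notin> I" for i using g'(2) that by blast
    fix i j assume eq: "(if i \<in> I then w i else g i) = (if j \<in> I then w j else g j)"
    show "i = j"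
    proof (cases "i \<in> I"; cases "j \<in> I")
      assume "i \<in> I" "j \<in> I" then show ?thesis using eq inj by (auto simp: inj_on_def)
    next
      assume "i \<in> I" "j \<notin> I" then show ?thesis using eq gS[of j] by (metis image_eqI)
    next
      assume "i \<notin> I" "j \<in> I" then show ?thesis using eq gS[of i] by (metis image_eqI)
    next
      assume "i \<notin> I" "j \<notin> I" then show ?thesis using eq g'(1) by (auto simp: inj_on_def)
    qed
  qed
  moreover have "range ?r \<subseteq> B" unfolding r
  proof
    fix x assume "x \<in> range (\<lambda>i. if i \<in> I then w i else g i)"
    then obtain i where "x = (if i \<in> I then w i else g i)" by blast
    moreover have "g i \<in> B" if "i \<notin> I" using g that unfolding bij_betw_def by blast
    ultimately show "x \<in> B" using B(1) by auto
  qed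
  ultimately have r: "inj ?r" "range ?r \<subseteq> B" by blast+
  show ?thesis
    by (rule that, rule det_nz_of_independent_rows[OF r(1) vec.independent_mono[OF B(3) r(2)]])
qed

text \<open>The \<open>d\<close>-dimensional covolume of the lattice spanned by \<open>w i\<close>, \<open>i \<in> I\<close>, up to a constant
  depending only on the dimension: by Hadamard's inequality the supremum is attained at
  orthonormal bases of the orthogonal complement.\<close>

definition covol :: "'n set \<Rightarrow> ('n \<Rightarrow> real ^ 'n) \<Rightarrow> real" where
  "covol I w = (SUP u \<in> {u. \<forall>i. norm (u i) \<le> 1}. \<bar>det (\<chi> i. if i \<in> I then w i else u i)\<bar>)"

text \<open>The Leibniz expansion. The crude factorial suffices, as only finiteness of the supremum
  in \<open>covol\<close> is at stake.\<close>

lemma abs_det_le: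
  fixes r :: "'n \<Rightarrow> real ^ 'n"
  shows "\<bar>det (\<chi> i. r i)\<bar> \<le> fact CARD('n) * (\<Prod>i\<in>UNIV. norm (r i))"
proof -
  have "\<bar>det (\<chi> i. r i)\<bar> \<le> (\<Sum>p | p permutes (UNIV :: 'n set). \<bar>of_int (sign p) * (\<Prod>i\<in>UNIV. r i $ p i)\<bar>)"
    unfolding det_def vec_lambda_beta by (rule sum_abs)
  also have "\<dots> \<le> (\<Sum>p | p permutes (UNIV :: 'n set). (\<Prod>i\<in>UNIV. norm (r i)))"
    by (intro sum_mono)
       (auto simp: abs_mult abs_prod sign_def intro!: prod_mono component_le_norm_cart)
  also have "\<dots> = fact CARD('n) * (\<Prod>i\<in>UNIV. norm (r i))"
    by (simp add: card_permutations)
  finally show ?thesis .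
qed

lemma covol_ge:
  assumes "\<And>i. norm (u i) \<le> 1"
  shows "\<bar>det (\<chi> i. if i \<in> I then w i else u i)\<bar> \<le> covol I w"
  unfolding covol_def
proof (rule cSUP_upper)
  show "u \<in> {u. \<forall>i. norm (u i) \<le> 1}" using assms by simp
  show "bdd_above ((\<lambda>u. \<bar>det (\<chi> i. if i \<in> I then w i else u i)\<bar>) ` {u. \<forall>i. norm (u i) \<le> 1})"
  proof (rule bdd_aboveI2)
    fix u :: "'a \<Rightarrow> real ^ 'a" assume "u \<in> {u. \<forall>i. norm (u i) \<le> 1}"
    then have u: "norm (u i) \<le> 1" for i by simp
    have "(\<Prod>i\<in>UNIV. norm (if i \<in> I then w i else u i)) \<le> (\<Prod>i\<in>UNIV. if i \<in> I then norm (w i) else 1)"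
      by (rule prod_mono) (use u in auto)
    then have "fact CARD('a) * (\<Prod>i\<in>UNIV. norm (if i \<in> I then w i else u i))
        \<le> fact CARD('a) * (\<Prod>i\<in>UNIV. if i \<in> I then norm (w i) else 1)"
      by (rule mult_left_mono) simp
    then show "\<bar>det (\<chi> i. if i \<in> I then w i else u i)\<bar>
        \<le> fact CARD('a) * (\<Prod>i\<in>UNIV. if i \<in> I then norm (w i) else 1)"
      by (rule order_trans[OF abs_det_le])
  qed
qed

lemma covol_le:
  assumes "\<And>u. (\<And>i. norm (u i) \<le> 1) \<Longrightarrow> \<bar>det (\<chi> i. if i \<in> I then w i else u i)\<bar> \<le> c"
  shows "covol I w \<le> c"
  unfolding covol_def
proof (rule cSUP_least)
  have "(\<lambda>_. 0) \<in> {u :: 'a \<Rightarrow> real ^ 'a. \<forall>i. norm (u i) \<le> 1}" by simp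
  then show "{u :: 'a \<Rightarrow> real ^ 'a. \<forall>i. norm (u i) \<le> 1} \<noteq> {}" by (metis empty_iff)
qed (use assms in simp)

lemma covol_eqI:
  assumes "\<And>u. \<bar>det (\<chi> i. if i \<in> I then w i else u i)\<bar> = \<bar>det (\<chi> i. if i \<in> I then w' i else u i)\<bar>"
  shows "covol I w = covol I w'"
proof -
  have "(\<lambda>u. \<bar>det (\<chi> i. if i \<in> I then w i else u i)\<bar>) = (\<lambda>u. \<bar>det (\<chi> i. if i \<in> I then w' i else u i)\<bar>)"
    by (rule ext) (rule assms)
  then show ?thesis unfolding covol_def by (rule arg_cong)
qed

lemma covol_add_span:
  assumes k: "k \<in> I" and s: "s \<in> span (w ` (I - {k}))"
  shows "covol I (w(k := x + s)) = covol I (w(k := x))"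
proof (rule covol_eqI)
  fix u
  let ?A = "\<chi> i. if i \<in> I then (w(k := x)) i else u i"
  have "w ` (I - {k}) \<subseteq> {row j ?A |j. j \<noteq> k}"
    by (auto simp: row_def)
  then have "s \<in> span {row j ?A |j. j \<noteq> k}"
    using s span_mono by blast
  then have "s \<in> vec.span {row j ?A |j. j \<noteq> k}"
    by (simp add: span_vec_eq)
  from det_row_span[OF this]
  have "det (\<chi> i. if i = k then row k ?A + s else row i ?A) = det ?A" .
  also have "(\<chi> i. if i = k then row k ?A + s else row i ?A) = (\<chi> i. if i \<in> I then (w(k := x + s)) i else u i)"
    using k by (auto simp: vec_eq_iff row_def)
  finally show "\<bar>det (\<chi> i. if i \<in> I then (w(k := x + s)) i else u i)\<bar> = \<bar>det ?A\<bar>" by simp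
qed

lemma covol_scale_le:
  assumes k: "k \<in> I"
  shows "covol I (w(k := c *\<^sub>R x)) \<le> \<bar>c\<bar> * covol I (w(k := x))"
proof (rule covol_le)
  fix u :: "'a \<Rightarrow> real ^ 'a" assume u: "\<And>i. norm (u i) \<le> 1"
  have "(\<chi> i. if i \<in> I then (w(k := c *\<^sub>R x)) i else u i)
      = (\<chi> i. if i = k then c *s x else (if i \<in> I then w i else u i))"
    using k by (auto simp: vec_eq_iff)
  then have "det (\<chi> i. if i \<in> I then (w(k := c *\<^sub>R x)) i else u i)
      = c * det (\<chi> i. if i = k then x else (if i \<in> I then w i else u i))"
    using det_row_mul[of k c "\<lambda>_. x"  "\<lambda>i. if i \<in> I then w i else u i"] by (simp only:)
  also have "(\<chi> i. if i = k then x else (if i \<in> I then w i else u i)) = (\<chi> i. if i \<in> I then (w(k := x)) i else u i)"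
    using k by (auto simp: vec_eq_iff)
  finally show "\<bar>det (\<chi> i. if i \<in> I then (w(k := c *\<^sub>R x)) i else u i)\<bar> \<le> \<bar>c\<bar> * covol I (w(k := x))"
    using covol_ge[of u I "w(k := x)"] u by (simp add: abs_mult mult_left_mono)
qed

text \<open>The reflection in the hyperplane orthogonal to \<open>x - y\<close>. It serves to
  exchange two vectors of equal length while fixing every vector orthogonal to both.\<close>

lemma reflection_exists:
  fixes x y :: "'a::euclidean_space"
  assumes "norm x = norm y"
  obtains R where "orthogonal_transformation R" "R x = y" "\<And>v. R (R v) = v"
    "\<And>v. v \<bullet> x = v \<bullet> y \<Longrightarrow> R v = v"
proof (cases "x = y")
  case True
  then show ?thesis using that[of "\<lambda>v. v"] by (auto simp: orthogonal_transformation_def linear_id[unfolded id_def])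
next
  case False
  define a where "a = x - y"
  have a: "a \<bullet> a \<noteq> 0" using False by (simp add: a_def)
  define R where "R = (\<lambda>v. v - (2 * (v \<bullet> a) / (a \<bullet> a)) *\<^sub>R a)"
  have lin: "linear R"
    by (rule linearI) (auto simp: R_def inner_add_left algebra_simps add_divide_distrib)
  have "R v \<bullet> R w = v \<bullet> w" for v w
    using a by (simp add: R_def inner_diff_left inner_diff_right field_simps inner_commute)
  moreover have "R (R v) = v" for v
    using a by (simp add: R_def inner_diff_left field_simps)
  moreover have "R x = y"
  proof -
    have "x \<bullet> x = y \<bullet> y" using assms by (simp add: norm_eq_sqrt_inner)
    then have "2 * (x \<bullet> a) = a \<bullet> a"
      by (simp add: a_def inner_diff_left inner_diff_right inner_commute)
    then show ?thesis using a by (simp add: R_def) (simp add: a_def)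
  qed
  moreover have "R v = v" if "v \<bullet> x = v \<bullet> y" for v
    using that by (simp add: R_def a_def inner_diff_right)
  ultimately show ?thesis using that[of R] lin by (simp add: orthogonal_transformation_def)
qed

lemma det_linear_image_rows:
  fixes r :: "'n \<Rightarrow> real ^ 'n"
  shows "det (\<chi> i. M *v r i) = det M * det (\<chi> i. r i)"
proof -
  have "(\<chi> i. M *v r i) = (\<chi> i. r i) ** transpose M"
    by (simp add: vec_eq_iff matrix_matrix_mult_def matrix_vector_mult_def transpose_def mult.commute)
  then show ?thesis by (simp add: det_mul)
qed

text \<open>The reflection taking \<open>x\<close> to \<open>y\<close> fixes the other members and
  maps the completing vectors into the unit ball again, so it only permutes the determinants under
  the supremum, up to sign.\<close>

lemma covol_rotate_le:
  assumes k: "k \<in> I" and n: "norm x = norm y"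
    and x: "\<And>i. i \<in> I - {k} \<Longrightarrow> w i \<bullet> x = 0" and y: "\<And>i. i \<in> I - {k} \<Longrightarrow> w i \<bullet> y = 0"
  shows "covol I (w(k := y)) \<le> covol I (w(k := x))"
proof -
  obtain R where R: "orthogonal_transformation R" "R x = y" "\<And>v. R (R v) = v"
    "\<And>v. v \<bullet> x = v \<bullet> y \<Longrightarrow> R v = v"
    using reflection_exists[OF n] by blast
  have mat: "matrix R *v v = R v" for v
    using R(1) by (simp add: orthogonal_transformation_def)
  show ?thesis
  proof (rule covol_le)
    fix u :: "'a \<Rightarrow> real ^ 'a" assume u: "\<And>i. norm (u i) \<le> 1"
    let ?r = "\<lambda>i. if i \<in> I then (w(k := x)) i else R (u i)"
    have "(\<chi> i. if i \<in> I then (w(k := y)) i else u i) = (\<chi> i. matrix R *v ?r i)"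
    proof (rule Cart_lambda_cong)
      fix i show "(if i \<in> I then (w(k := y)) i else u i) = matrix R *v ?r i"
        using R(2,3) R(4)[of "w i"] x[of i] y[of i] by (auto simp: mat)
    qed
    then have "\<bar>det (\<chi> i. if i \<in> I then (w(k := y)) i else u i)\<bar> = \<bar>det (matrix R)\<bar> * \<bar>det (\<chi> i. ?r i)\<bar>"
      by (simp only: det_linear_image_rows abs_mult)
    also have "\<dots> = \<bar>det (\<chi> i. ?r i)\<bar>" using R(1) by simp
    also have "\<dots> \<le> covol I (w(k := x))"
      by (rule covol_ge) (use R(1) u in \<open>simp add: orthogonal_transformation_norm\<close>)
    finally show "\<bar>det (\<chi> i. if i \<in> I then (w(k := y)) i else u i)\<bar> \<le> covol I (w(k := x))" .
  qed
qed

text \<open>Covolume is base times height: two families that differ only at \<open>k\<close> have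
  the same base, so their covolumes compare as the heights \<open>x\<close> and \<open>y\<close>
  over it. This is how two isotropic spaces sharing a hyperplane are compared.\<close>

lemma covol_orthogonal_ratio_le:
  assumes k: "k \<in> I"
    and x: "\<And>i. i \<in> I - {k} \<Longrightarrow> w i \<bullet> x = 0" and y: "\<And>i. i \<in> I - {k} \<Longrightarrow> w i \<bullet> y = 0"
    and s: "s \<in> span (w ` (I - {k}))" and t: "t \<in> span (w ` (I - {k}))"
    and y0: "y \<noteq> 0"
  shows "covol I (w(k := x + s)) \<le> norm x / norm y * covol I (w(k := y + t))"
proof -
  have "covol I (w(k := x + s)) = covol I (w(k := x))" by (rule covol_add_span[OF k s])
  also have "\<dots> \<le> covol I (w(k := (norm x / norm y) *\<^sub>R y))"
    by (rule covol_rotate_le[OF k]) (use x y y0 in auto)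
  also have "\<dots> \<le> \<bar>norm x / norm y\<bar> * covol I (w(k := y))" by (rule covol_scale_le[OF k])
  also have "covol I (w(k := y)) = covol I (w(k := y + t))" by (rule covol_add_span[OF k t, symmetric])
  finally show ?thesis by (simp only: abs_divide abs_norm_cancel)
qed

text \<open>Completing the family by standard axes gives an integer determinant of modulus at least
  1. After applying \<open>P\<close>, the images of the axes are divided by the operator bound
  \<open>C\<close> to bring them into the unit ball, so \<open>\<delta>\<close> depends on
  \<open>P\<close> and \<open>I\<close> only.\<close>

lemma covol_lattice_lower_bound:
  fixes P :: "real ^ 'n ^ 'n"
  assumes P: "det P \<noteq> 0"
  obtains \<delta> where "\<delta> > 0" "\<And>v. indep_family I (\<lambda>i. P *v int_vec (v i)) \<Longrightarrow> \<delta> \<le> covol I (\<lambda>i. P *v int_vec (v i))"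
proof -
  have inj: "inj ((*v) P)"
    using P by (metis inj_matrix_vector_mult invertible_det_nz)
  obtain C where C: "C > 0" "\<And>x. norm (P *v x) \<le> C * norm x"
    using linear_bounded_pos[OF matrix_vector_mul_linear[of P]] by blast
  define c where "c = (\<lambda>i. if i \<in> I then 1 else 1 / C)"
  have cpos: "(\<Prod>i\<in>UNIV. c i) > 0" using C by (intro prod_pos) (auto simp: c_def)
  show ?thesis
  proof (rule that)
    show "(\<Prod>i\<in>UNIV. c i) * \<bar>det P\<bar> > 0" using cpos P by simp
    fix v :: "'n \<Rightarrow> int ^ 'n"
    assume "indep_family I (\<lambda>i. P *v int_vec (v i))"
    then have "indep_family I (\<lambda>i. int_vec (v i) :: real ^ 'n)"
      using indep_family_linear_image_iff[OF matrix_vector_mul_linear inj finite, of I "\<lambda>i. int_vec (v i)"] by simp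
    then have "inj_on (\<lambda>i. int_vec (v i) :: real ^ 'n) I"
      "vec.independent ((\<lambda>i. int_vec (v i) :: real ^ 'n) ` I)"
      by (simp_all add: indep_family_def dependent_vec_eq)
    then obtain f where D: "det (\<chi> i. if i \<in> I then int_vec (v i) else (axis (f i) 1 :: real ^ 'n)) \<noteq> 0" (is "det ?D \<noteq> 0")
      by (rule det_completion_by_axes)
    have "?D = int_mat (\<chi> i. if i \<in> I then v i else axis (f i) 1)"
      by (auto simp: vec_eq_iff int_mat_def map_matrix_def axis_def)
    then obtain z :: int where z: "det ?D = of_int z" by (metis det_int_mat)
    with D have "z \<noteq> 0" by auto
    then have "1 \<le> \<bar>z\<bar>" by linarith
    then have D1: "1 \<le> \<bar>det ?D\<bar>" unfolding z by (metis of_int_1_le_iff of_int_abs)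
    let ?u = "\<lambda>i. (1 / C) *s (P *v axis (f i) 1)"
    have eq: "(\<chi> i. if i \<in> I then P *v int_vec (v i) else ?u i)
       = (\<chi> i. c i *s (P *v (if i \<in> I then int_vec (v i) else axis (f i) 1)))"
      by (rule Cart_lambda_cong) (auto simp: c_def)
    have "det (\<chi> i. if i \<in> I then P *v int_vec (v i) else ?u i) = (\<Prod>i\<in>UNIV. c i) * (det P * det ?D)"
      unfolding eq by (simp only: det_rows_mul det_linear_image_rows)
    then have "\<bar>det (\<chi> i. if i \<in> I then P *v int_vec (v i) else ?u i)\<bar> = (\<Prod>i\<in>UNIV. c i) * \<bar>det P\<bar> * \<bar>det ?D\<bar>"
      using cpos by (simp add: abs_mult)
    moreover have "\<bar>det (\<chi> i. if i \<in> I then P *v int_vec (v i) else ?u i)\<bar> \<le> covol I (\<lambda>i. P *v int_vec (v i))"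
    proof (rule covol_ge)
      fix i
      have "norm (P *v (axis (f i) 1 :: real ^ 'n)) \<le> C" using C(2)[of "axis (f i) 1"] by simp
      then show "norm (?u i) \<le> 1" using C(1) by (simp add: scalar_mult_eq_scaleR)
    qed
    moreover have "(\<Prod>i\<in>UNIV. c i) * \<bar>det P\<bar> * 1 \<le> (\<Prod>i\<in>UNIV. c i) * \<bar>det P\<bar> * \<bar>det ?D\<bar>"
      by (rule mult_left_mono[OF D1]) (use cpos in auto)
    ultimately show "(\<Prod>i\<in>UNIV. c i) * \<bar>det P\<bar> \<le> covol I (\<lambda>i. P *v int_vec (v i))" by simp
  qed
qed

section \<open>Isotropic lattices of small covolume\<close>

lemma bform_simps [simp]:
  "bform A (x + y) z = bform A x z + bform A y z"
  "bform A z (x + y) = bform A z x + bform A z y"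
  "bform A (x - y) z = bform A x z - bform A y z"
  "bform A z (x - y) = bform A z x - bform A z y"
  "bform A (c *s x) z = c * bform A x z"
  "bform A z (c *s x) = c * bform A z x"
  by (simp_all add: bform_def matrix_vector_mult_def sum.distrib sum_subtractf sum_distrib_left algebra_simps)

lemma bform_scaleR [simp]:
  "bform A (c *\<^sub>R x) z = c * bform A x z" "bform A z (c *\<^sub>R x) = c * bform A z x"
  for A :: "real ^ 'n ^ 'n"
  by (simp_all flip: scalar_mult_eq_scaleR)

lemma bform_commute:
  assumes "transpose A = A"
  shows "bform A x y = bform A y x"
proof -
  have A: "A $ i $ j = A $ j $ i" for i j using assms by (metis transpose_def vec_lambda_beta)
  have "bform A x y = (\<Sum>i\<in>UNIV. \<Sum>j\<in>UNIV. x $ i * A $ i $ j * y $ j)"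
    by (simp add: bform_def matrix_vector_mult_def sum_distrib_left mult.assoc)
  also have "\<dots> = (\<Sum>j\<in>UNIV. \<Sum>i\<in>UNIV. x $ i * A $ i $ j * y $ j)" by (rule sum.swap)
  also have "\<dots> = bform A y x"
    by (simp add: bform_def matrix_vector_mult_def sum_distrib_left A ac_simps)
  finally show ?thesis .
qed

lemma bform_int_vec: "bform (int_mat A) (int_vec x) (int_vec y) = of_int (bform A x y)"
  by (simp add: bform_def int_mat_def map_matrix_def matrix_vector_mult_def)

lemma transpose_int_mat: "transpose A = A \<Longrightarrow> transpose (int_mat A) = int_mat A"
  by (simp add: int_mat_def map_matrix_def transpose_def vec_eq_iff)

text \<open>\<open>P\<close> carries the integer points to the lattice being measured, so that
  lengths are Euclidean norms while the form remains an integer matrix. \<open>f\<close> holds the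
  coefficients of an integral linear functional, later the coordinate \<phi>.\<close>

locale lattice_form =
  fixes P :: "real ^ 'm ^ 'm" and Q :: "int ^ 'm ^ 'm" and \<sigma> :: real and f :: "int ^ 'm"
  assumes det_P: "det P \<noteq> 0"
    and Q_sym: "transpose Q = Q"
    and \<sigma>_pos: "\<sigma> > 0"
    and Q_bound: "\<And>x y. \<bar>bform (int_mat Q) x y\<bar> \<le> \<sigma> * norm (P *v x) * norm (P *v y)"
begin

definition pt :: "int ^ 'm \<Rightarrow> real ^ 'm" where
  "pt z = P *v int_vec z"

definition L :: "int ^ 'm \<Rightarrow> int" where
  "L z = (\<Sum>i\<in>UNIV. f $ i * z $ i)"

text \<open>\<open>H\<close> and \<open>\<psi>\<close> are \<open>Q\<close> and \<open>L\<close> in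
  the Euclidean coordinates of the lattice. They are defined at all real points, hence also at
  orthogonal components of lattice points.\<close>

definition H :: "real ^ 'm \<Rightarrow> real ^ 'm \<Rightarrow> real" where
  "H x y = bform (int_mat Q) (matrix_inv P *v x) (matrix_inv P *v y)"

definition \<psi> :: "real ^ 'm \<Rightarrow> real" where
  "\<psi> x = (\<Sum>i\<in>UNIV. of_int (f $ i) * (matrix_inv P *v x) $ i)"

lemma P_inverse [simp]:
  "matrix_inv P *v (P *v x) = x" "P *v (matrix_inv P *v x) = x"
proof -
  have "\<exists>R. P ** R = mat 1 \<and> R ** P = mat 1" using det_P by (simp add: invertible_def flip: invertible_det_nz)
  then have "P ** matrix_inv P = mat 1 \<and> matrix_inv P ** P = mat 1"
    unfolding matrix_inv_def by (rule someI_ex)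
  then show "matrix_inv P *v (P *v x) = x" "P *v (matrix_inv P *v x) = x"
    by (simp_all add: matrix_vector_mul_assoc)
qed

lemma pt_simps [simp]:
  "pt 0 = 0" "pt (x + y) = pt x + pt y" "pt (x - y) = pt x - pt y"
  "pt (c *s x) = of_int c *\<^sub>R pt x"
  by (simp_all add: pt_def matrix_vector_right_distrib matrix_vector_mult_diff_distrib matrix_vector_mult_scaleR
      scalar_mult_eq_scaleR)

lemma pt_eq_0_iff [simp]: "pt x = 0 \<longleftrightarrow> x = 0"
proof
  assume "pt x = 0"
  then have "(int_vec x :: real ^ 'm) = 0" using P_inverse(1)[of "int_vec x"] unfolding pt_def by simp
  then show "x = 0" by (simp add: vec_eq_iff)
qed simp

lemma L_simps [simp]:
  "L (x + y) = L x + L y" "L (x - y) = L x - L y" "L (c *s x) = c * L x"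
  by (simp_all add: L_def sum.distrib sum_subtractf sum_distrib_left algebra_simps)

lemma H_simps [simp]:
  "H (x + y) z = H x z + H y z" "H z (x + y) = H z x + H z y"
  "H (x - y) z = H x z - H y z" "H z (x - y) = H z x - H z y"
  "H (c *\<^sub>R x) z = c * H x z" "H z (c *\<^sub>R x) = c * H z x"
  by (simp_all add: H_def matrix_vector_right_distrib matrix_vector_mult_diff_distrib
      matrix_vector_mult_scaleR)

lemma H_zero [simp]: "H 0 z = 0" "H z 0 = 0"
  using H_simps(5)[of 0 0 z] H_simps(6)[of z 0 0] by simp_all

lemma H_commute: "H x y = H y x"
  unfolding H_def by (rule bform_commute) (rule transpose_int_mat[OF Q_sym])

lemma H_bound: "\<bar>H x y\<bar> \<le> \<sigma> * norm x * norm y"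
  using Q_bound[of "matrix_inv P *v x" "matrix_inv P *v y"] by (simp add: H_def)

lemma H_pt: "H (pt x) (pt y) = of_int (bform Q x y)"
  by (simp add: H_def pt_def bform_int_vec)

lemma linear_\<psi>: "linear \<psi>"
  by (rule linearI)
     (simp_all add: \<psi>_def matrix_vector_right_distrib matrix_vector_mult_scaleR algebra_simps
       sum.distrib sum_distrib_left)

lemma \<psi>_pt: "\<psi> (pt x) = of_int (L x)"
  by (simp add: \<psi>_def pt_def L_def)

definition isotropic_family :: "'m set \<Rightarrow> ('m \<Rightarrow> int ^ 'm) \<Rightarrow> bool" where
  "isotropic_family I v \<longleftrightarrow> indep_family I (\<lambda>i. pt (v i)) \<and> (\<forall>i\<in>I. \<forall>j\<in>I. bform Q (v i) (v j) = 0)"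

lemma H_span_eq_0:
  assumes "\<And>s. s \<in> S \<Longrightarrow> H x s = 0" "y \<in> span S"
  shows "H x y = 0"
  using assms(2) by (induction rule: span_induct_alt) (auto simp: assms(1))

lemma H_isotropic_span:
  assumes v: "isotropic_family I v" and x: "x \<in> span ((\<lambda>i. pt (v i)) ` I)" and y: "y \<in> span ((\<lambda>i. pt (v i)) ` I)"
  shows "H x y = 0"
proof (rule H_span_eq_0[OF _ y])
  fix s assume s: "s \<in> (\<lambda>i. pt (v i)) ` I"
  have "H s x = 0"
    by (rule H_span_eq_0[OF _ x]) (use s v in \<open>auto simp: isotropic_family_def H_pt\<close>)
  then show "H x s = 0" by (simp add: H_commute)
qed

lemma isotropic_family_exchange:
  assumes v: "isotropic_family I v" and k: "k \<in> I"
    and x: "pt x \<notin> span ((\<lambda>i. pt (v i)) ` (I - {k}))"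
    and Qx: "bform Q x x = 0" and Qxv: "\<And>i. i \<in> I - {k} \<Longrightarrow> bform Q x (v i) = 0"
  shows "isotropic_family I (v(k := x))"
proof -
  have "indep_family I ((\<lambda>i. pt (v i))(k := pt x))"
    using v by (intro indep_family_exchange[OF _ k x]) (simp add: isotropic_family_def)
  moreover have "(\<lambda>i. pt (v i))(k := pt x) = (\<lambda>i. pt ((v(k := x)) i))" by auto
  ultimately show ?thesis
    using v Qx Qxv bform_commute[OF Q_sym] by (auto simp: isotropic_family_def)
qed

lemma isotropic_family_row_op:
  fixes c :: int
  assumes v: "isotropic_family I v" and ij: "i \<in> I" "j \<in> I" "i \<noteq> j"
  defines "v' \<equiv> v(i := v i + c *s v j)"
  shows "isotropic_family I v'"
    and "covol I (\<lambda>i. pt (v' i)) = covol I (\<lambda>i. pt (v i))"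
    and "span ((\<lambda>i. pt (v' i)) ` I) = span ((\<lambda>i. pt (v i)) ` I)"
proof -
  let ?w = "\<lambda>i. pt (v i)"
  let ?S = "?w ` (I - {i})"
  have wi: "?w(i := ?w i) = ?w" by auto
  have ind: "indep_family I ?w" using v by (simp add: isotropic_family_def)
  have s: "of_int c *\<^sub>R ?w j \<in> span ?S" using ij by (intro span_scale span_base) auto
  have w': "(\<lambda>i. pt (v' i)) = ?w(i := ?w i + of_int c *\<^sub>R ?w j)" by (auto simp: v'_def)
  have "?w i \<notin> span ?S" by (rule indep_family_not_in_span[OF ind ij(1)])
  then have "pt (v i + c *s v j) \<notin> span ?S" using s by (simp add: span_add_eq2)
  then show "isotropic_family I v'"
    unfolding v'_def using v ij by (intro isotropic_family_exchange) (auto simp: isotropic_family_def)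
  show "covol I (\<lambda>i. pt (v' i)) = covol I ?w"
    unfolding w' using covol_add_span[OF ij(1) s, of "?w i"] by (simp only: wi)
  have "(\<lambda>i. pt (v' i)) ` I = insert (?w i + of_int c *\<^sub>R ?w j) ?S" unfolding w' using ij by auto
  moreover have "?w ` I = insert (?w i) ?S" using ij by auto
  ultimately show "span ((\<lambda>i. pt (v' i)) ` I) = span (?w ` I)"
    using eq_span_insert_eq[of "?w i + of_int c *\<^sub>R ?w j" "?w i" ?S] s by simp
qed

text \<open>Euclid's algorithm on the values \<open>h (v i)\<close>.\<close>

lemma isotropic_family_reduce:
  fixes h :: "int ^ 'm \<Rightarrow> int"
  assumes v: "isotropic_family I v" and add: "\<And>x y. h (x + y) = h x + h y"
    and scale: "\<And>c x. h (c *s x) = c * h x" and nz: "\<exists>i\<in>I. h (v i) \<noteq> 0"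
  obtains v' k where "isotropic_family I v'" "covol I (\<lambda>i. pt (v' i)) = covol I (\<lambda>i. pt (v i))"
    "span ((\<lambda>i. pt (v' i)) ` I) = span ((\<lambda>i. pt (v i)) ` I)"
    "k \<in> I" "h (v' k) \<noteq> 0" "\<And>i. i \<in> I - {k} \<Longrightarrow> h (v' i) = 0"
proof -
  define R where "R u \<longleftrightarrow> isotropic_family I u \<and> covol I (\<lambda>i. pt (u i)) = covol I (\<lambda>i. pt (v i)) \<and>
    span ((\<lambda>i. pt (u i)) ` I) = span ((\<lambda>i. pt (v i)) ` I) \<and> (\<exists>i\<in>I. h (u i) \<noteq> 0)" for u
  define m where "m u = (\<Sum>i\<in>I. nat \<bar>h (u i)\<bar>)" for u
  obtain u where u: "R u" "\<And>u'. R u' \<Longrightarrow> m u \<le> m u'"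
    using ex_has_least_nat[of R v m] v nz unfolding R_def by blast
  obtain k where k: "k \<in> I" "h (u k) \<noteq> 0" using u(1) by (auto simp: R_def)
  have step: False if ij: "i \<in> I" "j \<in> I" "i \<noteq> j" and hij: "\<bar>h (u j)\<bar> \<le> \<bar>h (u i)\<bar>" "h (u j) \<noteq> 0" for i j
  proof -
    \<comment> \<open>One subtraction of Euclid's algorithm: \<open>h (u i)\<close> moves towards 0
      by the modulus of \<open>h (u j)\<close>, which does not exceed its own. The total
      \<open>m\<close> drops, against minimality.\<close>
    define c where "c = - sgn (h (u i)) * sgn (h (u j))"
    define u' where "u' = u(i := u i + c *s u j)"
    have hi: "\<bar>h (u' i)\<bar> < \<bar>h (u i)\<bar>"
      using hij by (auto simp: u'_def add scale c_def sgn_if abs_if split: if_splits)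
    have "R u'"
      using u(1) isotropic_family_row_op[of I u i j c] ij hij(2) unfolding R_def u'_def by auto
    moreover have "m u' < m u"
      unfolding m_def by (rule sum_strict_mono_ex1) (use hi ij in \<open>auto simp: u'_def\<close>)
    ultimately show False using u(2) by fastforce
  qed
  have "h (u i) = 0" if "i \<in> I - {k}" for i
    using step[of i k] step[of k i] that k by force
  then show ?thesis using that u(1) k unfolding R_def by blast
qed

text \<open>If \<open>z\<close> is not orthogonal to the isotropic space \<open>F\<close> spanned by \<open>v\<close>, then \<open>F + \<real>z\<close> contains
  exactly one other maximal isotropic space; comparing its covolume with that of \<open>F\<close> bounds the
  distance from \<open>z\<close> to \<open>F\<close> from below.\<close>

lemma isotropic_family_gap:
  assumes v: "isotropic_family I v" and \<epsilon>: "\<epsilon> > 0"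
    and cov_pos: "covol I (\<lambda>i. pt (v i)) > 0"
    and near: "\<And>v'. isotropic_family I v' \<Longrightarrow> covol I (\<lambda>i. pt (v i)) \<le> (1 + \<epsilon>) * covol I (\<lambda>i. pt (v' i))"
    and max: "\<And>z. \<lbrakk>\<And>i. i \<in> I \<Longrightarrow> bform Q (v i) z = 0; bform Q z z = 0\<rbrakk> \<Longrightarrow> pt z \<in> span ((\<lambda>i. pt (v i)) ` I)"
    and z: "pt z = a + h" and a: "a \<in> span ((\<lambda>i. pt (v i)) ` I)"
    and h: "\<And>x. x \<in> span ((\<lambda>i. pt (v i)) ` I) \<Longrightarrow> x \<bullet> h = 0" and h0: "h \<noteq> 0"
  shows "1 \<le> 2 * \<sigma> * (1 + \<epsilon>) * (norm h)\<^sup>2"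
proof -
  let ?F = "span ((\<lambda>i. pt (v i)) ` I)"
  have Haa: "H a a = 0" by (rule H_isotropic_span[OF v a a])
  have zF: "pt z \<notin> ?F"
  proof
    assume "pt z \<in> ?F"
    then have "h \<in> ?F" using span_diff[OF _ a, of "pt z"] z by simp
    then show False using h[of h] h0 by simp
  qed
  show ?thesis
  proof (cases "\<forall>i\<in>I. bform Q (v i) z = 0")
    case True
    have "H (pt z) a = 0"
    proof (rule H_span_eq_0[OF _ a])
      fix s assume "s \<in> (\<lambda>i. pt (v i)) ` I"
      then show "H (pt z) s = 0" using True by (auto simp: H_pt bform_commute[OF Q_sym, of z])
    qed
    then have "H h a = 0" using Haa by (simp add: z)
    then have "H h h = H (pt z) (pt z)" using Haa by (simp add: z H_commute[of a h])
    then have "H h h = of_int (bform Q z z)" by (simp only: H_pt)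
    moreover have "bform Q z z \<noteq> 0" using max True zF by blast
    then have "1 \<le> \<bar>bform Q z z\<bar>" by linarith
    then have "1 \<le> \<bar>real_of_int (bform Q z z)\<bar>" by linarith
    ultimately have "1 \<le> \<sigma> * norm h * norm h" using H_bound[of h h] by simp
    moreover have "\<sigma> * norm h * norm h * 1 \<le> \<sigma> * norm h * norm h * (2 * (1 + \<epsilon>))"
      using \<sigma>_pos \<epsilon> by (intro mult_left_mono) auto
    ultimately show ?thesis by (simp add: power2_eq_square algebra_simps)
  next
    case False
    \<comment> \<open>In this basis the hyperplane of \<open>?F\<close> orthogonal to
      \<open>z\<close> is spanned by the members other than the \<open>k\<close>-th. The second
      isotropic space will share this hyperplane.\<close>
    obtain v' k where v': "isotropic_family I v'"
      and cov': "covol I (\<lambda>i. pt (v' i)) = covol I (\<lambda>i. pt (v i))"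
      and F': "span ((\<lambda>i. pt (v' i)) ` I) = ?F"
      and k: "k \<in> I" and \<kappa>0: "bform Q (v' k) z \<noteq> 0" and others: "\<And>i. i \<in> I - {k} \<Longrightarrow> bform Q (v' i) z = 0"
      by (rule isotropic_family_reduce[OF v, of "\<lambda>x. bform Q x z"]) (use False in auto)
    let ?w = "\<lambda>i. pt (v' i)"
    let ?S = "span (?w ` (I - {k}))"
    have SF: "?S \<subseteq> ?F" unfolding F'[symmetric] by (rule span_mono) auto
    have wI: "?w ` I = insert (?w k) (?w ` (I - {k}))" using k by auto
    have ind': "indep_family I ?w" using v' by (simp add: isotropic_family_def)
    \<comment> \<open>\<open>l\<close> is the height of \<open>?F\<close> over the common hyperplane
      \<open>?S\<close>.\<close>
    obtain l0 l where l0: "l0 \<in> ?S" and l: "\<And>x. x \<in> ?S \<Longrightarrow> orthogonal l x" and lk: "?w k = l0 + l"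
      using orthogonal_subspace_decomp_exists[of "?w ` (I - {k})" "?w k"] by blast
    have l_ne: "l \<noteq> 0"
      using indep_family_not_in_span[OF ind' k] l0 lk by auto
    have wkF: "?w k \<in> ?F" unfolding F'[symmetric] using k by (intro span_base) auto
    have lF: "l \<in> ?F" using span_diff[OF wkF, of l0] l0 SF lk by auto
    obtain c where c: "a - c *\<^sub>R ?w k \<in> ?S"
      using a unfolding F'[symmetric] wI span_breakdown_eq by blast
    define s where "s = a - c *\<^sub>R l"
    have "s = (a - c *\<^sub>R ?w k) + c *\<^sub>R l0" by (simp add: s_def lk algebra_simps)
    then have s: "s \<in> ?S" using c l0 by (simp add: span_add span_scale)
    have as: "a = c *\<^sub>R l + s" by (simp add: s_def)
    have HSz: "H x (pt z) = 0" if "x \<in> ?S" for x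
    proof -
      have "H (pt z) x = 0"
      proof (rule H_span_eq_0[OF _ that])
        fix y assume "y \<in> ?w ` (I - {k})"
        then obtain i where "i \<in> I - {k}" "y = ?w i" by blast
        then show "H (pt z) y = 0" using others[of i] by (simp add: H_pt bform_commute[OF Q_sym, of z])
      qed
      then show ?thesis by (simp add: H_commute)
    qed
    define \<kappa> where "\<kappa> = H l h"
    define \<gamma> where "\<gamma> = H h h"
    have \<kappa>: "of_int (bform Q (v' k) z) = \<kappa>"
    proof -
      have "of_int (bform Q (v' k) z) = H l (pt z)"
        using HSz[OF l0] by (simp add: lk flip: H_pt)
      also have "\<dots> = \<kappa>" using H_isotropic_span[OF v lF a] by (simp add: z \<kappa>_def)
      finally show ?thesis .
    qed
    have Hsh: "H s h = 0"
      using HSz[OF s] H_isotropic_span[OF v _ a, of s] s SF by (auto simp: z)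
    have Qz: "of_int (bform Q z z) = 2 * c * \<kappa> + \<gamma>"
    proof -
      have "of_int (bform Q z z) = 2 * H a h + H h h"
        using Haa by (simp add: z H_commute[of h a] flip: H_pt)
      also have "H a h = c * \<kappa>" using Hsh by (simp add: as \<kappa>_def)
      finally show ?thesis by (simp add: \<gamma>_def)
    qed
    \<comment> \<open>The image of \<open>v' k\<close> under the reflection in the orthogonal
      complement of \<open>z\<close>, multiplied by \<open>bform Q z z\<close> to stay integral. It
      is isotropic and orthogonal to the common hyperplane; if \<open>z\<close> is isotropic it is
      just a multiple of \<open>z\<close>.\<close>
    define y where "y = bform Q z z *s v' k - (2 * bform Q (v' k) z) *s z"
    \<comment> \<open>The height of the new space over \<open>?S\<close>: the terms with
      \<open>c\<close> cancel in the coefficient of \<open>l\<close>, and everything in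
      \<open>?S\<close> is collected in \<open>t\<close>.\<close>
    define x where "x = \<gamma> *\<^sub>R l - (2 * \<kappa>) *\<^sub>R h"
    define t where "t = (2 * c * \<kappa> + \<gamma>) *\<^sub>R l0 - (2 * \<kappa>) *\<^sub>R s"
    have pty: "pt y = x + t"
      by (simp add: y_def x_def t_def Qz \<kappa> z lk as algebra_simps)
    have tS: "t \<in> ?S" unfolding t_def using l0 s by (intro span_diff span_scale)
    have new: "isotropic_family I (v'(k := y))"
    proof (rule isotropic_family_exchange[OF v' k])
      show "pt y \<notin> ?S"
      proof
        assume "pt y \<in> ?S"
        then have "of_int (bform Q z z) *\<^sub>R ?w k - pt y \<in> ?F"
          using SF wkF by (intro span_diff span_scale) auto
        then have "(2 * \<kappa>) *\<^sub>R pt z \<in> ?F" by (simp add: y_def \<kappa>)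
        then have "inverse (2 * \<kappa>) *\<^sub>R (2 * \<kappa>) *\<^sub>R pt z \<in> ?F" by (rule span_scale)
        then show False using zF \<kappa>0 \<kappa> by auto
      qed
      have comm: "bform Q z (v' k) = bform Q (v' k) z" by (rule bform_commute[OF Q_sym])
      have kk: "bform Q (v' k) (v' k) = 0" using v' k by (simp add: isotropic_family_def)
      show "bform Q y y = 0" by (simp add: y_def comm kk)
      fix i assume i: "i \<in> I - {k}"
      have "bform Q z (v' i) = 0" using others[OF i] bform_commute[OF Q_sym] by metis
      moreover have "bform Q (v' k) (v' i) = 0" using v' k i by (auto simp: isotropic_family_def)
      ultimately show "bform Q y (v' i) = 0" by (simp add: y_def)
    qed
    have lS: "?w i \<bullet> l = 0" if "i \<in> I - {k}" for i
      using l[of "?w i"] that by (auto simp: orthogonal_def inner_commute intro: span_base)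
    have hS: "?w i \<bullet> h = 0" if "i \<in> I - {k}" for i
      using h[of "?w i"] that unfolding F'[symmetric] by (auto intro: span_base)
    have "covol I (?w(k := x + t)) \<le> norm x / norm l * covol I (?w(k := l + l0))"
      by (rule covol_orthogonal_ratio_le[OF k _ lS tS l0 l_ne]) (simp add: x_def inner_diff_right lS hS)
    moreover have "?w(k := l + l0) = ?w" by (simp add: fun_eq_iff lk add.commute)
    moreover have "?w(k := x + t) = (\<lambda>i. pt ((v'(k := y)) i))" by (auto simp: pty)
    ultimately have cov_new: "covol I (\<lambda>i. pt ((v'(k := y)) i)) \<le> norm x / norm l * covol I (\<lambda>i. pt (v i))"
      by (simp only: cov')
    have norm_x: "norm x \<le> 2 * \<sigma> * (norm h)\<^sup>2 * norm l"
    proof -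
      have lh: "l \<bullet> h = 0" using h lF by blast
      define N where "N = \<kappa>\<^sup>2 * (norm h)\<^sup>2 + \<gamma>\<^sup>2 * (norm l)\<^sup>2"
      \<comment> \<open>\<open>u\<close> is the gradient of \<open>H h\<close> on the plane of
        \<open>l\<close> and \<open>h\<close>, multiplied by both squared norms. Testing
        \<open>H_bound\<close> on it controls \<open>\<kappa>\<close> and \<open>\<gamma>\<close>
        jointly and gives the factor 2; bounding them separately would give sqrt 5.\<close>
      define u where "u = (\<kappa> * (norm h)\<^sup>2) *\<^sub>R l + (\<gamma> * (norm l)\<^sup>2) *\<^sub>R h"
      have Hu: "H h u = N"
        by (simp add: u_def N_def H_commute[of h l] power2_eq_square flip: \<kappa>_def \<gamma>_def)
      have nu: "(norm u)\<^sup>2 = (norm h)\<^sup>2 * (norm l)\<^sup>2 * N"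
        using lh by (simp add: u_def N_def power2_norm_eq_inner inner_add_left inner_add_right inner_commute[of h l])
          (simp add: algebra_simps power2_eq_square)
      have N0: "0 \<le> N" by (simp add: N_def)
      have "N\<^sup>2 \<le> (\<sigma> * norm h * norm u)\<^sup>2"
        by (rule power_mono) (use H_bound[of h u] N0 in \<open>auto simp: Hu\<close>)
      also have "\<dots> = \<sigma>\<^sup>2 * (norm h)\<^sup>2 * (norm u)\<^sup>2" by (simp add: power_mult_distrib)
      also have "\<dots> = (\<sigma>\<^sup>2 * ((norm h)\<^sup>2)\<^sup>2 * (norm l)\<^sup>2) * N"
        unfolding nu by (simp add: power2_eq_square)
      finally have "N * N \<le> (\<sigma>\<^sup>2 * ((norm h)\<^sup>2)\<^sup>2 * (norm l)\<^sup>2) * N" by (simp add: power2_eq_square)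
      then have N: "N \<le> \<sigma>\<^sup>2 * ((norm h)\<^sup>2)\<^sup>2 * (norm l)\<^sup>2"
      proof (cases "N = 0")
        case False
        then show ?thesis using N0 \<open>N * N \<le> _\<close> by (metis mult_right_le_imp_le order_le_less)
      qed simp
      have "(norm x)\<^sup>2 = \<gamma>\<^sup>2 * (norm l)\<^sup>2 + 4 * \<kappa>\<^sup>2 * (norm h)\<^sup>2"
        using lh by (simp add: x_def power2_norm_eq_inner inner_diff_left inner_diff_right inner_commute[of h l])
          (simp add: algebra_simps power2_eq_square)
      also have "\<dots> \<le> 4 * N" by (simp add: N_def)
      also have "\<dots> \<le> (2 * \<sigma> * (norm h)\<^sup>2 * norm l)\<^sup>2" using N by (simp add: power_mult_distrib)
      finally show ?thesis
        by (rule power2_le_imp_le) (use \<sigma>_pos in simp)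
    qed
    have "norm x / norm l \<le> 2 * \<sigma> * (norm h)\<^sup>2"
      using norm_x l_ne by (simp add: divide_le_eq)
    then have "norm x / norm l * covol I (\<lambda>i. pt (v i)) \<le> 2 * \<sigma> * (norm h)\<^sup>2 * covol I (\<lambda>i. pt (v i))"
      using cov_pos by (intro mult_right_mono) auto
    then have "covol I (\<lambda>i. pt (v i)) \<le> (1 + \<epsilon>) * (2 * \<sigma> * (norm h)\<^sup>2 * covol I (\<lambda>i. pt (v i)))"
      using near[OF new] cov_new \<epsilon> by (smt (verit) mult_left_mono)
    then have "1 * covol I (\<lambda>i. pt (v i)) \<le> (2 * \<sigma> * (1 + \<epsilon>) * (norm h)\<^sup>2) * covol I (\<lambda>i. pt (v i))"
      by (simp add: algebra_simps)
    then show ?thesis using cov_pos by (rule mult_right_le_imp_le)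
  qed
qed

end

text \<open>A frame adapted to a flag: the span without \<open>w k\<close> has a line as orthogonal
  complement inside the full span, which gives \<open>e k\<close>, and the indices outside
  \<open>I\<close> take the complement of the full span. Each step of the flag can then have its own
  side length in the box.\<close>

lemma orthonormal_frame:
  fixes w :: "'n \<Rightarrow> real ^ 'n"
  assumes w: "indep_family I w" and k: "k \<in> I"
  obtains e :: "'n \<Rightarrow> real ^ 'n" where
    "\<And>i j. e i \<bullet> e j = (if i = j then 1 else 0)"
    "\<And>i. i \<in> I \<Longrightarrow> e i \<in> span (w ` I)"
    "\<And>i x. i \<notin> I \<Longrightarrow> x \<in> span (w ` I) \<Longrightarrow> e i \<bullet> x = 0"
    "\<And>x. x \<in> span (w ` (I - {k})) \<Longrightarrow> e k \<bullet> x = 0"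
proof -
  define F where "F = span (w ` I)"
  define S where "S = span (w ` (I - {k}))"
  have SF: "S \<subseteq> F" unfolding F_def S_def by (rule span_mono) auto
  have subF: "subspace F" and subS: "subspace S" by (simp_all add: F_def S_def)
  have inj: "inj_on w I" and ind: "independent (w ` I)" using w by (auto simp: indep_family_def)
  have dimF: "dim F = card I" unfolding F_def
    using ind inj by (simp add: dim_eq_card_independent card_image)
  have "independent (w ` (I - {k}))" using ind by (rule independent_mono) auto
  then have dimS: "dim S = card (I - {k})" unfolding S_def
    using inj by (simp add: dim_eq_card_independent card_image inj_on_diff)
  define T1 where "T1 = {y \<in> F. \<forall>x\<in>S. orthogonal x y}"
  define T2 where "T2 = {y \<in> UNIV. \<forall>x\<in>F. orthogonal x y}"
  have sub1: "subspace T1" and sub2: "subspace T2"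
    unfolding T1_def T2_def using subF by (auto simp: subspace_def orthogonal_def inner_add_right)
  have "dim T1 + dim S = dim F" unfolding T1_def by (rule dim_subspace_orthogonal_to_vectors[OF subS subF SF])
  moreover have "card I = Suc (card (I - {k}))" by (rule card.remove[OF finite k])
  ultimately have dim1: "dim T1 = 1" using dimF dimS by simp
  have "dim T2 + dim F = dim (UNIV :: (real ^ 'n) set)" unfolding T2_def
    by (rule dim_subspace_orthogonal_to_vectors[OF subF]) auto
  then have dim2: "dim T2 = card (UNIV - I)" using dimF by (simp add: card_Diff_subset)
  obtain B0 where B0: "B0 \<subseteq> S" "pairwise orthogonal B0" "\<And>x. x \<in> B0 \<Longrightarrow> norm x = 1" "independent B0" "card B0 = dim S" "span B0 = S"
    by (rule orthonormal_basis_subspace[OF subS]) (rule that)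
  obtain B1 where B1: "B1 \<subseteq> T1" "pairwise orthogonal B1" "\<And>x. x \<in> B1 \<Longrightarrow> norm x = 1" "independent B1" "card B1 = dim T1" "span B1 = T1"
    by (rule orthonormal_basis_subspace[OF sub1]) (rule that)
  obtain B2 where B2: "B2 \<subseteq> T2" "pairwise orthogonal B2" "\<And>x. x \<in> B2 \<Longrightarrow> norm x = 1" "independent B2" "card B2 = dim T2" "span B2 = T2"
    by (rule orthonormal_basis_subspace[OF sub2]) (rule that)
  obtain b where b: "B1 = {b}" using B1(5) dim1 by (metis card_1_singletonE)
  have fin: "finite B0" "finite B2" using B0(4) B2(4) by (simp_all add: finiteI_independent)
  obtain g0 where g0: "bij_betw g0 (I - {k}) B0"
    using finite_same_card_bij[of "I - {k}" B0] fin B0(5) dimS by auto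
  obtain g2 where g2: "bij_betw g2 (UNIV - I) B2"
    using finite_same_card_bij[of "UNIV - I" B2] fin B2(5) dim2 by auto
  define e where "e i = (if i = k then b else if i \<in> I then g0 i else g2 i)" for i
  have e0: "e i \<in> B0" if "i \<in> I" "i \<noteq> k" for i
    using that bij_betw_apply[OF g0, of i] by (auto simp: e_def)
  have e2: "e i \<in> B2" if "i \<notin> I" for i
    using that k bij_betw_apply[OF g2, of i] by (auto simp: e_def)
  have ek: "e k = b" by (simp add: e_def)
  have bT1: "b \<in> T1" using B1(1) b by auto
  have eF: "e i \<in> F" if "i \<in> I" for i
    using e0[OF that] ek bT1 B0(1) SF by (cases "i = k") (auto simp: T1_def)
  have orth2: "e i \<bullet> x = 0" if "i \<notin> I" "x \<in> F" for i x
    using e2[OF that(1)] B2(1) that(2) by (auto simp: T2_def orthogonal_def inner_commute)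
  have orthk: "e k \<bullet> x = 0" if "x \<in> S" for x
    using bT1 that by (auto simp: T1_def orthogonal_def inner_commute ek)
  have unit: "norm (e i) = 1" for i
    using e0[of i] e2[of i] ek b B0(3) B1(3)[of b] B2(3) by (cases "i = k"; cases "i \<in> I") auto
  have eS: "e i \<in> S" if "i \<in> I" "i \<noteq> k" for i using e0[OF that] B0(1) by auto
  have ort: "e i \<bullet> e j = 0" if "i \<noteq> j" for i j
  proof (cases "i \<in> I"; cases "j \<in> I")
    assume ij: "i \<in> I" "j \<in> I"
    consider "i = k" | "j = k" | "i \<noteq> k" "j \<noteq> k" by blast
    then show ?thesis
    proof cases
      case 1 then show ?thesis using orthk[OF eS[OF ij(2)]] that by auto
    next
      case 2 then show ?thesis using orthk[OF eS[OF ij(1)]] that by (auto simp: inner_commute)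
    next
      case 3
      have "g0 i \<noteq> g0 j" using g0 ij 3 that by (auto simp: bij_betw_def inj_on_def)
      then have "e i \<noteq> e j" using ij 3 by (simp add: e_def)
      then show ?thesis
        using pairwiseD[OF B0(2) e0[OF ij(1) 3(1)] e0[OF ij(2) 3(2)]] by (simp add: orthogonal_def)
    qed
  next
    assume "i \<in> I" "j \<notin> I" then show ?thesis using orth2 eF by (metis inner_commute)
  next
    assume "i \<notin> I" "j \<in> I" then show ?thesis using orth2 eF by metis
  next
    assume ij: "i \<notin> I" "j \<notin> I"
    then have ne: "i \<noteq> k" "j \<noteq> k" using k by auto
    have "g2 i \<noteq> g2 j" using g2 ij that by (auto simp: bij_betw_def inj_on_def)
    then have "e i \<noteq> e j" using ij ne by (simp add: e_def)
    then show ?thesis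
      using pairwiseD[OF B2(2) e2[OF ij(1)] e2[OF ij(2)]] by (simp add: orthogonal_def)
  qed
  show ?thesis
  proof (rule that)
    show "e i \<bullet> e j = (if i = j then 1 else 0)" for i j
      using ort[of i j] unit[of i] by (auto simp: norm_eq_1)
  qed (use eF orth2 orthk in \<open>auto simp: F_def S_def\<close>)
qed

lemma orthonormal_matrix:
  fixes e :: "'n \<Rightarrow> real ^ 'n"
  assumes e: "\<And>i j. e i \<bullet> e j = (if i = j then 1 else 0)"
  shows "\<bar>det (\<chi> i. e i)\<bar> = 1" "(norm x)\<^sup>2 = (\<Sum>i\<in>UNIV. (e i \<bullet> x)\<^sup>2)"
proof -
  let ?E = "\<chi> i. e i"
  have "?E ** transpose ?E = mat 1"
    by (simp add: vec_eq_iff matrix_matrix_mult_def transpose_def mat_def inner_vec_def flip: e)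
  then have orth: "orthogonal_matrix ?E"
    by (simp add: orthogonal_matrix_def matrix_left_right_inverse)
  then show "\<bar>det ?E\<bar> = 1" using det_orthogonal_matrix[of ?E] by auto
  have "orthogonal_transformation ((*v) ?E)"
    using orth by (simp add: orthogonal_transformation_matrix)
  then have "(norm x)\<^sup>2 = (norm (?E *v x))\<^sup>2" by (simp add: orthogonal_transformation_norm)
  also have "\<dots> = (\<Sum>i\<in>UNIV. (e i \<bullet> x)\<^sup>2)"
    unfolding power2_norm_eq_inner by (simp add: inner_vec_def[of "?E *v x"] matrix_vector_mul_component power2_eq_square)
  finally show "(norm x)\<^sup>2 = (\<Sum>i\<in>UNIV. (e i \<bullet> x)\<^sup>2)" .
qed

section \<open>The box argument for an isotropic lattice of nearly minimal covolume\<close>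

context lattice_form
begin

text \<open>Otherwise the span could be enlarged by \<open>z\<close> to an isotropic space of
  dimension \<open>card I + 1\<close>, and its intersection with the kernel of \<open>L\<close>
  would still contain a family indexed by \<open>I\<close>, against \<open>nof\<close>.\<close>

lemma isotropic_family_maximal:
  assumes nof: "\<And>u. isotropic_family I u \<Longrightarrow> \<exists>i\<in>I. L (u i) \<noteq> 0"
    and v: "isotropic_family I v"
    and vz: "\<And>i. i \<in> I \<Longrightarrow> bform Q (v i) z = 0" and Qz: "bform Q z z = 0"
  shows "pt z \<in> span ((\<lambda>i. pt (v i)) ` I)"
proof (rule ccontr)
  let ?F = "span ((\<lambda>i. pt (v i)) ` I)"
  assume z: "pt z \<notin> ?F"
  obtain u k where u: "isotropic_family I u" "span ((\<lambda>i. pt (u i)) ` I) = ?F"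
    "k \<in> I" "L (u k) \<noteq> 0" "\<And>i. i \<in> I - {k} \<Longrightarrow> L (u i) = 0"
    by (rule isotropic_family_reduce[OF v, of L]) (use nof[OF v] in auto)
  have Hz: "H (pt z) x = 0" if "x \<in> ?F" for x
  proof (rule H_span_eq_0[OF _ that])
    fix s assume "s \<in> (\<lambda>i. pt (v i)) ` I"
    then show "H (pt z) s = 0" using vz by (auto simp: H_pt bform_commute[OF Q_sym, of z])
  qed
  have Bz: "bform Q z (u i) = 0" if "i \<in> I" for i
  proof -
    have "pt (u i) \<in> ?F" unfolding u(2)[symmetric] using that by (intro span_base) auto
    then show ?thesis using Hz[of "pt (u i)"] by (simp add: H_pt)
  qed
  have ukF: "pt (u k) \<in> ?F" unfolding u(2)[symmetric] using u(3) by (intro span_base) auto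
  \<comment> \<open>The combination of \<open>z\<close> and \<open>u k\<close> killed by
    \<open>L\<close>; with it in place of \<open>u k\<close>, the functional vanishes on the whole
    family.\<close>
  define y where "y = L (u k) *s z - L z *s u k"
  have "isotropic_family I (u(k := y))"
  proof (rule isotropic_family_exchange[OF u(1,3)])
    show "pt y \<notin> span ((\<lambda>i. pt (u i)) ` (I - {k}))"
    proof
      assume "pt y \<in> span ((\<lambda>i. pt (u i)) ` (I - {k}))"
      then have "pt y \<in> ?F" unfolding u(2)[symmetric] using span_mono[of "(\<lambda>i. pt (u i)) ` (I - {k})" "(\<lambda>i. pt (u i)) ` I"] by auto
      then have "pt y + of_int (L z) *\<^sub>R pt (u k) \<in> ?F" using ukF by (intro span_add span_scale)
      then have "of_int (L (u k)) *\<^sub>R pt z \<in> ?F" by (simp add: y_def)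
      then have "inverse (of_int (L (u k))) *\<^sub>R (of_int (L (u k)) :: real) *\<^sub>R pt z \<in> ?F" by (rule span_scale)
      then show False using z u(4) by simp
    qed
    have uu: "bform Q (u k) (u i) = 0" if "i \<in> I" for i
      using u(1,3) that by (auto simp: isotropic_family_def)
    have uz: "bform Q (u k) z = 0" using Bz[OF u(3)] bform_commute[OF Q_sym] by metis
    show "bform Q y y = 0" by (simp add: y_def Qz uz Bz u(3) uu)
    fix i assume "i \<in> I - {k}"
    then show "bform Q y (u i) = 0" by (simp add: y_def Bz uu)
  qed
  then obtain i where "i \<in> I" "L ((u(k := y)) i) \<noteq> 0" using nof by blast
  then show False using u(5)[of i] by (auto simp: y_def split: if_splits)
qed

text \<open>Covolumes of independent lattice families stay away from 0, so
  \<open>1 + \<epsilon>\<close> times the infimum strictly exceeds it and some family lies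
  below.\<close>

lemma near_minimal_family:
  assumes v: "isotropic_family I v" and \<epsilon>: "\<epsilon> > 0"
  obtains u where "isotropic_family I u" "covol I (\<lambda>i. pt (u i)) > 0"
    "\<And>u'. isotropic_family I u' \<Longrightarrow> covol I (\<lambda>i. pt (u i)) \<le> (1 + \<epsilon>) * covol I (\<lambda>i. pt (u' i))"
proof -
  obtain \<delta> where \<delta>: "\<delta> > 0" "\<And>v. indep_family I (\<lambda>i. P *v int_vec (v i)) \<Longrightarrow> \<delta> \<le> covol I (\<lambda>i. P *v int_vec (v i))"
    using covol_lattice_lower_bound[OF det_P] by blast
  define C where "C = (\<lambda>u. covol I (\<lambda>i. pt (u i))) ` {u. isotropic_family I u}"
  have low: "\<delta> \<le> c" if "c \<in> C" for c
    using that \<delta>(2) by (auto simp: C_def isotropic_family_def pt_def)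
  have bdd: "bdd_below C" using low by (rule bdd_belowI)
  have ne: "C \<noteq> {}" using v by (auto simp: C_def)
  have inf: "\<delta> \<le> Inf C" using ne low by (rule cInf_greatest)
  have "Inf C * 1 < Inf C * (1 + \<epsilon>)" using inf \<delta>(1) \<epsilon> by (intro mult_strict_left_mono) auto
  then obtain c where c: "c \<in> C" "c < (1 + \<epsilon>) * Inf C"
    using cInf_lessD[OF ne, of "(1 + \<epsilon>) * Inf C"] by (auto simp: mult.commute)
  obtain u where u: "isotropic_family I u" "c = covol I (\<lambda>i. pt (u i))" using c(1) by (auto simp: C_def)
  show ?thesis
  proof (rule that[OF u(1)])
    show "covol I (\<lambda>i. pt (u i)) > 0" using low[OF c(1)] \<delta>(1) u(2) by simp
    fix u' assume "isotropic_family I u'"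
    then have "Inf C \<le> covol I (\<lambda>i. pt (u' i))" by (intro cInf_lower bdd) (auto simp: C_def)
    then have "(1 + \<epsilon>) * Inf C \<le> (1 + \<epsilon>) * covol I (\<lambda>i. pt (u' i))" using \<epsilon> by (intro mult_left_mono) auto
    then show "covol I (\<lambda>i. pt (u i)) \<le> (1 + \<epsilon>) * covol I (\<lambda>i. pt (u' i))" using c(2) u(2) by simp
  qed
qed

text \<open>A nonzero lattice point in the box would be too close to the isotropic space if it lay
  outside it, shorter than \<open>X\<close> if it lay inside with \<open>L\<close> nonzero, and
  shorter than \<open>\<mu>\<close> if it lay inside with \<open>L\<close> zero. So the box is empty
  of such points and the product of its sides is at most the covolume.\<close>

lemma isotropic_minima_bound_eps:
  assumes v: "isotropic_family I v" and \<epsilon>: "\<epsilon> > 0"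
    and nof: "\<And>u. isotropic_family I u \<Longrightarrow> \<exists>i\<in>I. L (u i) \<noteq> 0"
    and X: "\<And>z. bform Q z z = 0 \<Longrightarrow> L z \<noteq> 0 \<Longrightarrow> X \<le> norm (pt z)"
    and \<mu>: "\<And>z. z \<noteq> 0 \<Longrightarrow> L z = 0 \<Longrightarrow> \<mu> \<le> norm (pt z)" and \<mu>X: "0 < \<mu>" "\<mu> \<le> X"
  shows "\<mu> ^ (card I - 1) * X
    \<le> sqrt (card I) ^ card I * sqrt (2 * \<sigma> * (1 + \<epsilon>) * card (- I)) ^ card (- I) * \<bar>det P\<bar>"
proof -
  define d where "d = card I"
  define b where "b = 2 * \<sigma> * (1 + \<epsilon>) * real (card (- I))"
  obtain u0 where u0: "isotropic_family I u0" "covol I (\<lambda>i. pt (u0 i)) > 0"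
    "\<And>u'. isotropic_family I u' \<Longrightarrow> covol I (\<lambda>i. pt (u0 i)) \<le> (1 + \<epsilon>) * covol I (\<lambda>i. pt (u' i))"
    using near_minimal_family[OF v \<epsilon>] by blast
  obtain u k where u: "isotropic_family I u" "span ((\<lambda>i. pt (u i)) ` I) = span ((\<lambda>i. pt (u0 i)) ` I)"
    "k \<in> I" "L (u k) \<noteq> 0" "\<And>i. i \<in> I - {k} \<Longrightarrow> L (u i) = 0"
    by (rule isotropic_family_reduce[OF u0(1), of L]) (use nof[OF u0(1)] in auto)
  let ?F = "span ((\<lambda>i. pt (u0 i)) ` I)"
  have gap: "1 \<le> 2 * \<sigma> * (1 + \<epsilon>) * (norm h)\<^sup>2"
    if "pt z = a + h" "a \<in> ?F" "\<And>x. x \<in> ?F \<Longrightarrow> x \<bullet> h = 0" "h \<noteq> 0" for z a h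
    using isotropic_family_gap[OF u0(1) \<epsilon> u0(2,3) _ that] isotropic_family_maximal[OF nof u0(1)] by blast
  have ind: "indep_family I (\<lambda>i. pt (u i))" using u(1) by (simp add: isotropic_family_def)
  obtain e :: "'m \<Rightarrow> real ^ 'm" where e: "\<And>i j. e i \<bullet> e j = (if i = j then 1 else 0)"
    and eF: "\<And>i. i \<in> I \<Longrightarrow> e i \<in> ?F"
    and eort: "\<And>i x. i \<notin> I \<Longrightarrow> x \<in> ?F \<Longrightarrow> e i \<bullet> x = 0"
    and ek: "\<And>x. x \<in> span ((\<lambda>i. pt (u i)) ` (I - {k})) \<Longrightarrow> e k \<bullet> x = 0"
    by (rule orthonormal_frame[OF ind u(3), unfolded u(2)]) (rule that)
  have d0: "d > 0" using u(3) by (auto simp: d_def card_gt_0_iff)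
  have b0: "b > 0" if "i \<notin> I" for i
  proof -
    have "card (- I) > 0" using that by (auto simp: card_gt_0_iff)
    then show ?thesis using \<sigma>_pos \<epsilon> by (simp add: b_def)
  qed
  \<comment> \<open>The sum of \<open>d\<close> squares turns \<open>X / sqrt d\<close> back into a
    length below \<open>X\<close>, with \<open>\<mu> \<le> X\<close> covering the other directions
    of the space; outside \<open>I\<close> the sum of squares stays below the gap
    \<open>1 / (2 * \<sigma> * (1 + \<epsilon>))\<close>.\<close>
  define c where "c i = (if i = k then X / sqrt d else if i \<in> I then \<mu> / sqrt d else 1 / sqrt b)" for i
  have cpos: "c i > 0" for i using \<mu>X d0 b0[of i] by (auto simp: c_def)
  have "(\<Prod>i\<in>UNIV. c i) \<le> \<bar>det ((\<chi> i. e i) ** P)\<bar>"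
  proof (rule minkowski_linear_forms)
    show "det ((\<chi> i. e i) ** P) \<noteq> 0"
      using det_P orthonormal_matrix(1)[OF e] by (auto simp: det_mul)
    show "c i > 0" for i by (rule cpos)
    fix z :: "int ^ 'm" assume z: "z \<noteq> 0"
    have comp: "(((\<chi> i. e i) ** P) *v int_vec z) $ i = e i \<bullet> pt z" for i
      by (simp add: pt_def matrix_vector_mul_component flip: matrix_vector_mul_assoc)
    show "\<exists>i. c i \<le> \<bar>(((\<chi> i. e i) ** P) *v int_vec z) $ i\<bar>"
    proof (rule ccontr)
      assume "\<not> ?thesis"
      then have lt: "\<bar>e i \<bullet> pt z\<bar> < c i" for i unfolding comp by (meson not_le)
      have sq: "(e i \<bullet> pt z)\<^sup>2 < (c i)\<^sup>2" for i
        using lt[of i] by (metis abs_ge_zero power2_abs power_strict_mono zero_less_numeral)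
      have sumI: "(\<Sum>i\<in>UNIV. (e i \<bullet> x)\<^sup>2) = (\<Sum>i\<in>I. (e i \<bullet> x)\<^sup>2) + (\<Sum>i\<in>-I. (e i \<bullet> x)\<^sup>2)" for x
        using sum.union_disjoint[of I "- I" "\<lambda>i. (e i \<bullet> x)\<^sup>2"] by (simp add: Compl_partition)
      show False
      proof (cases "pt z \<in> ?F")
        case False
        obtain a h where ah: "a \<in> ?F" "\<And>x. x \<in> ?F \<Longrightarrow> orthogonal h x" "pt z = a + h"
          using orthogonal_subspace_decomp_exists[of "(\<lambda>i. pt (u0 i)) ` I" "pt z"] by blast
        have hF: "x \<bullet> h = 0" if "x \<in> ?F" for x using ah(2)[OF that] by (simp add: orthogonal_def inner_commute)
        have h0: "h \<noteq> 0" using False ah(1,3) by auto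
        have eh: "e i \<bullet> h = e i \<bullet> pt z" if "i \<notin> I" for i
          using eort[OF that ah(1)] by (simp add: ah(3) inner_add_right)
        have norm_h: "(norm h)\<^sup>2 = (\<Sum>i\<in>-I. (e i \<bullet> pt z)\<^sup>2)"
          unfolding orthonormal_matrix(2)[OF e, of h] sumI by (simp add: hF eF eh)
        have ne: "- I \<noteq> {}"
        proof
          assume "- I = {}"
          then have "(norm h)\<^sup>2 = 0" using norm_h by simp
          then show False using h0 by simp
        qed
        have "(norm h)\<^sup>2 < (\<Sum>i\<in>-I. 1 / b)"
          unfolding norm_h
        proof (rule sum_strict_mono)
          fix i assume i: "i \<in> - I"
          then have "i \<noteq> k" using u(3) by auto
          then show "(e i \<bullet> pt z)\<^sup>2 < 1 / b"
            using sq[of i] i b0[of i] by (simp add: c_def power_divide)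
        qed (use ne in auto)
        then have "2 * \<sigma> * (1 + \<epsilon>) * (norm h)\<^sup>2 < 2 * \<sigma> * (1 + \<epsilon>) * (real (card (- I)) / b)"
          using \<sigma>_pos \<epsilon> by (intro mult_strict_left_mono) auto
        also have "\<dots> = 1" using ne b0 by (auto simp: b_def)
        finally show False using gap[OF ah(3,1) hF h0] by simp
      next
        case True
        have norm_z: "(norm (pt z))\<^sup>2 = (\<Sum>i\<in>I. (e i \<bullet> pt z)\<^sup>2)"
          unfolding orthonormal_matrix(2)[OF e, of "pt z"] sumI using eort True by simp
        have I0: "I \<noteq> {}" using u(3) by auto
        show False
        proof (cases "L z = 0")
          case False
          have "real_of_int (bform Q z z) = 0" using H_isotropic_span[OF u0(1) True True] by (simp add: H_pt)
          then have "X \<le> norm (pt z)" using X False by simp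
          then have "X\<^sup>2 \<le> (norm (pt z))\<^sup>2" using \<mu>X by (intro power_mono) auto
          also have "\<dots> < (\<Sum>i\<in>I. X\<^sup>2 / d)"
            unfolding norm_z
          proof (rule sum_strict_mono)
            fix i assume "i \<in> I"
            then have "(c i)\<^sup>2 \<le> (X / sqrt d)\<^sup>2"
              using \<mu>X d0 by (intro power_mono) (auto simp: c_def divide_right_mono)
            then show "(e i \<bullet> pt z)\<^sup>2 < X\<^sup>2 / d" using sq[of i] by (simp add: power_divide)
          qed (use I0 in auto)
          also have "\<dots> = X\<^sup>2" using I0 by (simp add: d_def)
          finally show False by simp
        next
          case Lz: True
          have "(\<lambda>i. pt (u i)) ` I = insert (pt (u k)) ((\<lambda>i. pt (u i)) ` (I - {k}))" using u(3) by auto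
          \<comment> \<open>Since \<open>L\<close> vanishes on every \<open>u i\<close> except
            \<open>u k\<close>, the condition \<open>L z = 0\<close> removes the \<open>u k\<close>
            component and leaves \<open>pt z\<close> in the hyperplane normal to \<open>e k\<close>.
            The long side of the box is then irrelevant for \<open>z\<close>.\<close>
          then obtain t where t: "pt z - t *\<^sub>R pt (u k) \<in> span ((\<lambda>i. pt (u i)) ` (I - {k}))"
            using True unfolding u(2)[symmetric] by (auto simp: span_breakdown_eq)
          have "\<psi> x = 0" if "x \<in> span ((\<lambda>i. pt (u i)) ` (I - {k}))" for x
          proof (rule linear_eq_0_on_span[OF linear_\<psi> _ that])
            fix y assume "y \<in> (\<lambda>i. pt (u i)) ` (I - {k})"
            then obtain i where "i \<in> I - {k}" "y = pt (u i)" by blast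
            then show "\<psi> y = 0" using u(5)[of i] by (simp add: \<psi>_pt)
          qed
          from this[OF t] have "t * \<psi> (pt (u k)) = 0"
            using Lz by (simp add: linear_diff[OF linear_\<psi>] linear_scale[OF linear_\<psi>] \<psi>_pt)
          then have "t = 0" using u(4) by (simp add: \<psi>_pt)
          then have ekz: "e k \<bullet> pt z = 0" using ek t by simp
          have "\<mu>\<^sup>2 \<le> (norm (pt z))\<^sup>2" using \<mu>[OF z Lz] \<mu>X by (intro power_mono) auto
          also have "\<dots> < (\<Sum>i\<in>I. \<mu>\<^sup>2 / d)"
            unfolding norm_z
          proof (rule sum_strict_mono)
            fix i assume i: "i \<in> I"
            show "(e i \<bullet> pt z)\<^sup>2 < \<mu>\<^sup>2 / d"
              using sq[of i] ekz i \<mu>X d0 by (cases "i = k") (auto simp: c_def power_divide)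
          qed (use I0 in auto)
          also have "\<dots> = \<mu>\<^sup>2" using I0 by (simp add: d_def)
          finally show False by simp
        qed
      qed
    qed
  qed
  also have "\<dots> = \<bar>det P\<bar>"
    using orthonormal_matrix(1)[OF e] by (simp add: det_mul abs_mult)
  finally have le: "(\<Prod>i\<in>UNIV. c i) \<le> \<bar>det P\<bar>" .
  have "(\<Prod>i\<in>UNIV. c i) = (\<Prod>i\<in>I. c i) * (\<Prod>i\<in>-I. c i)"
    using prod.union_disjoint[of I "- I" c] by (simp add: Compl_partition)
  also have "(\<Prod>i\<in>I. c i) = c k * (\<Prod>i\<in>I - {k}. c i)" by (rule prod.remove[OF finite u(3)])
  also have "(\<Prod>i\<in>I - {k}. c i) = (\<Prod>i\<in>I - {k}. \<mu> / sqrt d)" by (intro prod.cong) (auto simp: c_def)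
  also have "\<dots> = (\<mu> / sqrt d) ^ (d - 1)" using u(3) by (simp add: d_def)
  also have "(\<Prod>i\<in>-I. c i) = (\<Prod>i\<in>-I. 1 / sqrt b)" using u(3) by (intro prod.cong) (auto simp: c_def)
  also have "\<dots> = (1 / sqrt b) ^ card (- I)" by simp
  also have "c k = X / sqrt d" by (simp add: c_def)
  finally have "(X / sqrt d) * (\<mu> / sqrt d) ^ (d - 1) * (1 / sqrt b) ^ card (- I) \<le> \<bar>det P\<bar>" using le by simp
  moreover have "sqrt d ^ d = sqrt d * sqrt d ^ (d - 1)" using d0 by (simp add: power_eq_if)
  \<comment> \<open>If \<open>I\<close> is the whole index type then \<open>b = 0\<close>, and the
    value is \<open>0 ^ 0 = 1\<close>.\<close>
  moreover have "sqrt b ^ card (- I) > 0"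
  proof (cases "- I = {}")
    case False then show ?thesis using b0 by auto
  qed simp
  ultimately have "\<mu> ^ (d - 1) * X \<le> \<bar>det P\<bar> * (sqrt d ^ d * sqrt b ^ card (- I))"
    using d0 by (simp add: power_divide divide_le_eq mult_ac)
  then show ?thesis by (simp add: d_def b_def mult_ac)
qed

text \<open>The near-minimal family varies with \<open>\<epsilon>\<close>, but the inequality
  obtained from it does not mention it, so \<open>\<epsilon>\<close> may tend to 0.\<close>

theorem isotropic_minima_bound:
  assumes v: "isotropic_family I v"
    and nof: "\<And>u. isotropic_family I u \<Longrightarrow> \<exists>i\<in>I. L (u i) \<noteq> 0"
    and X: "\<And>z. bform Q z z = 0 \<Longrightarrow> L z \<noteq> 0 \<Longrightarrow> X \<le> norm (pt z)"
    and \<mu>: "\<And>z. z \<noteq> 0 \<Longrightarrow> L z = 0 \<Longrightarrow> \<mu> \<le> norm (pt z)" and \<mu>X: "0 < \<mu>" "\<mu> \<le> X"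
  shows "\<mu> ^ (card I - 1) * X
    \<le> sqrt (card I) ^ card I * sqrt (2 * \<sigma> * card (- I)) ^ card (- I) * \<bar>det P\<bar>"
proof -
  let ?g = "\<lambda>\<epsilon>. sqrt (card I) ^ card I * sqrt (2 * \<sigma> * (1 + \<epsilon>) * card (- I)) ^ card (- I) * \<bar>det P\<bar>"
  have "?g \<midarrow>0\<rightarrow> ?g 0"
    by (intro tendsto_intros)
  then have "(?g \<longlongrightarrow> ?g 0) (at_right 0)"
    by (rule filterlim_mono) (auto simp: at_within_le_at)
  moreover have "\<forall>\<^sub>F \<epsilon> in at_right 0. \<mu> ^ (card I - 1) * X \<le> ?g \<epsilon>"
    using eventually_at_right_less[of "0 :: real"]
  proof (rule eventually_mono)
    fix \<epsilon> :: real assume "0 < \<epsilon>"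
    from isotropic_minima_bound_eps[OF v this nof X \<mu> \<mu>X]
    show "\<mu> ^ (card I - 1) * X \<le> ?g \<epsilon>" .
  qed
  ultimately have "\<mu> ^ (card I - 1) * X \<le> ?g 0"
    by (intro tendsto_lowerbound[where F = "at_right 0"]) auto
  then show ?thesis by simp
qed

end

section \<open>Block matrices and positive definite forms\<close>

lemma UNIV_option_sum: "(\<Sum>i\<in>UNIV. f i) = f None + (\<Sum>j\<in>UNIV. f (Some j))"
  for f :: "'n::finite option \<Rightarrow> 'a::comm_monoid_add"
proof -
  have "(\<Sum>i\<in>UNIV. f i) = (\<Sum>i\<in>insert None (range Some). f i)" by (simp add: UNIV_option_conv)
  also have "\<dots> = f None + (\<Sum>i\<in>range Some. f i)" by (rule sum.insert) auto
  also have "(\<Sum>i\<in>range Some. f i) = (\<Sum>j\<in>UNIV. f (Some j))" by (simp add: sum.reindex)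
  finally show ?thesis .
qed

text \<open>The index type \<open>'n option\<close> models the product with one further line;
  \<open>None\<close> carries the coordinate \<phi>.\<close>

definition vcons :: "'a \<Rightarrow> 'a ^ 'n \<Rightarrow> 'a ^ 'n option" where
  "vcons y x = (\<chi> i. case i of None \<Rightarrow> y | Some j \<Rightarrow> x $ j)"

definition vtail :: "'a ^ 'n option \<Rightarrow> 'a ^ 'n" where
  "vtail v = (\<chi> j. v $ Some j)"

lemma vcons_nth [simp]: "vcons y x $ None = y" "vcons y x $ Some j = x $ j"
  by (simp_all add: vcons_def)

lemma vtail_nth [simp]: "vtail v $ j = v $ Some j"
  by (simp add: vtail_def)

lemma vtail_vcons [simp]: "vtail (vcons y x) = x"
  by (simp add: vec_eq_iff)

lemma vcons_vtail [simp]: "vcons (v $ None) (vtail v) = v"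
  by (simp add: vec_eq_iff split_option_all)

lemma vtail_simps [simp]:
  "vtail 0 = 0"
  "vtail (v + w) = vtail v + vtail w"
  "vtail (v - w) = vtail v - vtail w"
  "vtail (c *s u) = c *s vtail u"
  "vtail (k *\<^sub>R r) = k *\<^sub>R vtail r"
  "vtail (int_vec z) = int_vec (vtail z)"
  by (simp_all add: vec_eq_iff)

lemma vec_option_eq_iff: "v = w \<longleftrightarrow> v $ None = w $ None \<and> vtail v = vtail w"
  by (auto simp: vec_eq_iff split_option_all)

text \<open>Block diagonal with the scalar at \<open>None\<close>: \<open>blk (- 1) A\<close> is the
  matrix of q(x) - y^2, and \<open>blk a P0\<close> yields the norm that weights y by
  \<open>a\<close>.\<close>

definition blk :: "'a::comm_ring_1 \<Rightarrow> 'a ^ 'n ^ 'n \<Rightarrow> 'a ^ 'n option ^ 'n option" where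
  "blk c M = vcons (vcons c 0) (\<chi> i. vcons 0 (M $ i))"

lemma blk_mult_vec: "blk c M *v v = vcons (c * v $ None) (M *v vtail v)"
  by (simp add: vec_eq_iff split_option_all blk_def matrix_vector_mult_def UNIV_option_sum)

lemma bform_blk: "bform (blk c M) v w = c * v $ None * w $ None + bform M (vtail v) (vtail w)"
  by (simp add: bform_def UNIV_option_sum blk_mult_vec mult_ac)

lemma int_mat_blk: "int_mat (blk c M) = blk (of_int c) (int_mat M)"
  by (simp add: vec_eq_iff split_option_all blk_def int_mat_def map_matrix_def)

lemma transpose_blk: "transpose M = M \<Longrightarrow> transpose (blk c M) = blk c M"
  by (simp add: vec_eq_iff split_option_all blk_def transpose_def)

lemma blk_mult: "blk c M ** blk c' M' = blk (c * c') (M ** M')"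
  by (simp add: vec_eq_iff split_option_all blk_def matrix_matrix_mult_def UNIV_option_sum)

lemma UNIV_option_prod: "(\<Prod>i\<in>UNIV. f i) = f None * (\<Prod>j\<in>UNIV. f (Some j))"
  for f :: "'n::finite option \<Rightarrow> 'a::comm_monoid_mult"
proof -
  have "(\<Prod>i\<in>UNIV. f i) = (\<Prod>i\<in>insert None (range Some). f i)" by (simp add: UNIV_option_conv)
  also have "\<dots> = f None * (\<Prod>i\<in>range Some. f i)" by (rule prod.insert) auto
  also have "(\<Prod>i\<in>range Some. f i) = (\<Prod>j\<in>UNIV. f (Some j))" by (simp add: prod.reindex)
  finally show ?thesis .
qed

text \<open>Both sides are multiplicative, because \<open>blk 1\<close> respects products, so
  elementary matrices suffice.\<close>

lemma det_blk_one: "det (blk 1 M) = det M"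
  for M :: "real ^ 'n ^ 'n"
proof (rule induct_matrix_elementary[where P = "\<lambda>M. det (blk 1 M) = det M"])
  fix A B :: "real ^ 'n ^ 'n" assume "det (blk 1 A) = det A" "det (blk 1 B) = det B"
  then show "det (blk 1 (A ** B)) = det (A ** B)"
    using blk_mult[of 1 A 1 B] by (metis det_mul mult_1)
next
  fix A :: "real ^ 'n ^ 'n" and i assume i: "row i A = 0"
  then have "row (Some i) (blk 1 A) = 0" by (simp add: row_def vec_eq_iff split_option_all blk_def)
  then show "det (blk 1 A) = det A" using i by (simp add: det_zero_row)
next
  fix A :: "real ^ 'n ^ 'n" assume "\<And>i j. i \<noteq> j \<Longrightarrow> A $ i $ j = 0"
  then have "blk 1 A $ i $ j = 0" if "i \<noteq> j" for i j
    using that by (cases i; cases j) (auto simp: blk_def)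
  then show "det (blk 1 A) = det A"
    using \<open>\<And>i j. i \<noteq> j \<Longrightarrow> A $ i $ j = 0\<close> by (simp add: det_diagonal UNIV_option_prod) (simp add: blk_def)
next
  fix m n :: 'n assume mn: "m \<noteq> n"
  let ?p = "Transposition.transpose m n" and ?q = "Transposition.transpose (Some m) (Some n)"
  have p: "?p permutes UNIV" and q: "?q permutes UNIV" by (simp_all add: permutes_swap_id)
  have "blk 1 (\<chi> i j. (mat 1 :: real ^ 'n ^ 'n) $ i $ ?p j) = (\<chi> i j. (mat 1 :: real ^ 'n option ^ 'n option) $ i $ ?q j)"
    by (auto simp: vec_eq_iff split_option_all blk_def mat_def Transposition.transpose_def)
  then show "det (blk 1 (\<chi> i j. (mat 1 :: real ^ 'n ^ 'n) $ i $ ?p j)) = det (\<chi> i j. (mat 1 :: real ^ 'n ^ 'n) $ i $ ?p j)"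
    using det_permute_columns[OF p, of "mat 1 :: real ^ 'n ^ 'n"]
      det_permute_columns[OF q, of "mat 1 :: real ^ 'n option ^ 'n option"] mn
    by (simp add: sign_swap_id)
next
  fix m n :: 'n and c :: real assume mn: "m \<noteq> n"
  have 1: "(\<chi> i j. if i = m \<and> j = n then c else of_bool (i = j))
      = (\<chi> k. if k = m then row m (mat 1) + c *s row n (mat 1) else row k (mat 1 :: real ^ 'n ^ 'n))"
    using mn by (auto simp: vec_eq_iff row_def mat_def)
  have 2: "blk 1 (\<chi> i j. if i = m \<and> j = n then c else of_bool (i = j))
      = (\<chi> k. if k = Some m then row (Some m) (mat 1) + c *s row (Some n) (mat 1) else row k (mat 1 :: real ^ 'n option ^ 'n option))"
    using mn by (auto simp: vec_eq_iff split_option_all blk_def row_def mat_def)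
  have "det (\<chi> i j. if i = m \<and> j = n then c else of_bool (i = j)) = det (mat 1 :: real ^ 'n ^ 'n)"
    unfolding 1 by (rule det_row_operation[OF mn])
  moreover have "det (blk 1 (\<chi> i j. if i = m \<and> j = n then c else of_bool (i = j))) = det (mat 1 :: real ^ 'n option ^ 'n option)"
    unfolding 2 by (rule det_row_operation) (use mn in simp)
  ultimately show "det (blk 1 (\<chi> i j. if i = m \<and> j = n then c else of_bool (i = j)))
      = det (\<chi> i j. if i = m \<and> j = n then c else of_bool (i = j))" by simp
qed

lemma det_blk: "det (blk c M) = c * det M"
  for M :: "real ^ 'n ^ 'n"
proof -
  have "blk c M = blk c (mat 1) ** blk 1 M" by (simp add: blk_mult)
  moreover have "det (blk c (mat 1 :: real ^ 'n ^ 'n)) = c"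
  proof -
    have "blk c (mat 1 :: real ^ 'n ^ 'n) $ i $ j = 0" if "i \<noteq> j" for i j
      using that by (cases i; cases j) (auto simp: blk_def mat_def)
    then show ?thesis by (simp add: det_diagonal UNIV_option_prod) (simp add: blk_def mat_def)
  qed
  ultimately show ?thesis by (simp add: det_mul det_blk_one)
qed

text \<open>Gram--Schmidt for the scalar product of \<open>A0\<close>.\<close>

lemma positive_definite_factorization:
  fixes A0 :: "real ^ 'n ^ 'n"
  assumes sym: "transpose A0 = A0" and pos: "\<And>x. x \<noteq> 0 \<Longrightarrow> qform A0 x > 0"
  obtains P0 :: "real ^ 'n ^ 'n" where "\<And>x y. (P0 *v x) \<bullet> (P0 *v y) = bform A0 x y"
    "det P0 \<noteq> 0" "\<bar>det P0\<bar> = sqrt (det A0)"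
proof -
  have comm: "bform A0 x y = bform A0 y x" for x y by (rule bform_commute[OF sym])
  have ex: "\<exists>e. \<forall>i\<in>J. \<forall>j\<in>J. bform A0 (e i) (e j) = (if i = j then 1 else 0)" if "finite J" for J :: "'n set"
    using that
  proof (induction J)
    case (insert k J)
      then obtain e where e: "\<forall>i\<in>J. \<forall>j\<in>J. bform A0 (e i) (e j) = (if i = j then 1 else 0)" by blast
    have "card (e ` J) < CARD('n)"
      using insert.hyps card_image_le[of J e] psubset_card_mono[of UNIV J] by fastforce
    then have "dim (span (e ` J)) < CARD('n)"
      using dim_le_card'[of "e ` J"] insert.hyps by simp
    then have "span (e ` J) \<noteq> UNIV" by (metis DIM_cart DIM_real dim_UNIV mult.right_neutral nat_less_le)
    then obtain x where x: "x \<notin> span (e ` J)" by blast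
    define y where "y = x - (\<Sum>i\<in>J. bform A0 x (e i) *\<^sub>R e i)"
    have "(\<Sum>i\<in>J. bform A0 x (e i) *\<^sub>R e i) \<in> span (e ` J)"
      by (intro span_sum span_scale span_base) auto
    then have "y \<noteq> 0" using x by (auto simp: y_def)
    then have qy: "qform A0 y > 0" by (rule pos)
    have sum: "bform A0 (\<Sum>i\<in>J. c i *\<^sub>R e i) z = (\<Sum>i\<in>J. c i * bform A0 (e i) z)" for c z
      using insert.hyps(1)
      by (induction J) (simp_all, simp add: bform_def)
    have orth: "bform A0 y (e j) = 0" if "j \<in> J" for j
    proof -
      have "bform A0 y (e j) = bform A0 x (e j) - (\<Sum>i\<in>J. bform A0 x (e i) * bform A0 (e i) (e j))"
        by (simp add: y_def sum)
      also have "(\<Sum>i\<in>J. bform A0 x (e i) * bform A0 (e i) (e j)) = (\<Sum>i\<in>J. if i = j then bform A0 x (e i) else 0)"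
        using e that by (intro sum.cong) auto
      finally show ?thesis using that insert.hyps(1) by simp
    qed
    define e' where "e' = e(k := (1 / sqrt (qform A0 y)) *\<^sub>R y)"
    have "bform A0 (e' k) (e' k) = 1"
      using qy by (simp add: e'_def qform_def field_simps)
    moreover have "bform A0 (e' k) (e' j) = 0" "bform A0 (e' j) (e' k) = 0" if "j \<in> J" for j
    proof -
      have "bform A0 (e j) y = 0" by (subst comm) (rule orth[OF that])
      moreover have "j \<noteq> k" using that insert.hyps(2) by auto
      ultimately show "bform A0 (e' k) (e' j) = 0" "bform A0 (e' j) (e' k) = 0"
        using orth[OF that] by (simp_all add: e'_def)
    qed
    moreover have "bform A0 (e' i) (e' j) = (if i = j then 1 else 0)" if "i \<in> J" "j \<in> J" for i j
      using e that insert.hyps(2) by (auto simp: e'_def)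
    ultimately have "\<forall>i\<in>insert k J. \<forall>j\<in>insert k J. bform A0 (e' i) (e' j) = (if i = j then 1 else 0)"
      using insert.hyps(2) by auto
    then show ?case by blast
  qed simp
  from ex[OF finite[of UNIV]]
  obtain e :: "'n \<Rightarrow> real ^ 'n" where "\<forall>i\<in>UNIV. \<forall>j\<in>UNIV. bform A0 (e i) (e j) = (if i = j then 1 else 0)" by blast
  then have e: "bform A0 (e i) (e j) = (if i = j then 1 else 0)" for i j by blast
  \<comment> \<open>The columns of \<open>E\<close> are orthonormal for \<open>A0\<close>, so the
    inverse \<open>P0\<close> of \<open>E\<close> satisfies
    \<open>transpose P0 ** P0 = A0\<close>.\<close>
  define E :: "real ^ 'n ^ 'n" where "E = (\<chi> i j. e j $ i)"
  have bE: "(transpose E ** A0 ** E) $ i $ j = bform A0 (e i) (e j)" for i j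
  proof -
    have "(transpose E ** A0 ** E) $ i $ j = (\<Sum>l\<in>UNIV. \<Sum>m\<in>UNIV. e i $ m * (A0 $ m $ l * e j $ l))"
      by (simp add: E_def matrix_matrix_mult_def transpose_def sum_distrib_right mult.assoc)
    also have "\<dots> = (\<Sum>m\<in>UNIV. \<Sum>l\<in>UNIV. e i $ m * (A0 $ m $ l * e j $ l))" by (rule sum.swap)
    also have "\<dots> = bform A0 (e i) (e j)" by (simp add: bform_def matrix_vector_mult_def sum_distrib_left)
    finally show ?thesis .
  qed
  have EAE: "transpose E ** A0 ** E = mat 1"
    by (simp add: vec_eq_iff mat_def bE e)
  then have "det E * det A0 * det E = 1" by (metis det_I det_mul det_transpose)
  then have dE: "det E \<noteq> 0" and dA: "det A0 * (det E)\<^sup>2 = 1" by (auto simp: power2_eq_square mult_ac)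
  obtain P0 where P0: "E ** P0 = mat 1" "P0 ** E = mat 1"
    using dE invertible_det_nz[of E] unfolding invertible_def by auto
  have "transpose P0 ** P0 = transpose P0 ** (transpose E ** A0 ** E) ** P0" by (simp add: EAE)
  also have "\<dots> = transpose (E ** P0) ** A0 ** (E ** P0)"
    by (simp add: matrix_transpose_mul matrix_mul_assoc)
  finally have PP: "transpose P0 ** P0 = A0" by (simp add: P0)
  have detPP: "det A0 = (det P0)\<^sup>2"
    using arg_cong[OF PP, of det] by (simp add: det_mul power2_eq_square)
  show ?thesis
  proof (rule that)
    fix x y
    have "bform A0 x y = x \<bullet> (A0 *v y)" by (simp add: bform_def inner_vec_def)
    also have "\<dots> = x \<bullet> (transpose P0 *v (P0 *v y))" by (simp add: PP matrix_vector_mul_assoc)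
    also have "\<dots> = (P0 *v x) \<bullet> (P0 *v y)" by (metis dot_lmul_matrix inner_commute vector_transpose_matrix)
    finally show "(P0 *v x) \<bullet> (P0 *v y) = bform A0 x y" ..
  next
    show "\<bar>det P0\<bar> = sqrt (det A0)" by (simp add: detPP)
    show "det P0 \<noteq> 0" using dA detPP by auto
  qed
qed

section \<open>Isotropy index and integer families\<close>

context finite_dimensional_vector_space
begin

lemma finite_isotropic_dims: "finite {dim W | W. subspace W \<and> (\<forall>w\<in>W. f w = 0)}"
  by (rule finite_subset[of _ "{..dimension}"]) (auto intro: dim_subset_UNIV)

lemma dim_le_isotropy_index:
  assumes "subspace W" "\<And>w. w \<in> W \<Longrightarrow> f w = 0"
  shows "dim W \<le> isotropy_index scale f"
  unfolding isotropy_index_def using assms by (intro Max_ge finite_isotropic_dims) auto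

lemma isotropy_index_attained:
  assumes "f 0 = 0"
  obtains W where "subspace W" "\<And>w. w \<in> W \<Longrightarrow> f w = 0" "dim W = isotropy_index scale f"
proof -
  have "dim {0} \<in> {dim W | W. subspace W \<and> (\<forall>w\<in>W. f w = 0)}"
    using assms subspace_single_0 by blast
  then have "isotropy_index scale f \<in> {dim W | W. subspace W \<and> (\<forall>w\<in>W. f w = 0)}"
    unfolding isotropy_index_def by (intro Max_in finite_isotropic_dims) blast
  then show ?thesis using that by auto
qed

end

lemma vec_independent_family:
  fixes w :: "'i \<Rightarrow> 'a::field ^ 'n"
  assumes "finite I" and *: "\<And>c. (\<Sum>i\<in>I. c i *s w i) = 0 \<Longrightarrow> \<forall>i\<in>I. c i = 0"
  shows "inj_on w I" "vec.independent (w ` I)"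
proof -
  show inj: "inj_on w I"
  proof (rule inj_onI, rule ccontr)
    fix i j assume ij: "i \<in> I" "j \<in> I" "w i = w j" "i \<noteq> j"
    have "(\<Sum>l\<in>I. (of_bool (l = i) - of_bool (l = j)) *s w l) = (\<Sum>l\<in>I. if l = i then w i else 0) - (\<Sum>l\<in>I. if l = j then w j else 0)"
      unfolding sum_subtractf[symmetric] by (intro sum.cong) (auto simp: ij(4))
    also have "\<dots> = 0" using ij assms(1) by simp
    finally show False using *[of "\<lambda>l. of_bool (l = i) - of_bool (l = j)"] ij(1,4) by auto
  qed
  show "vec.independent (w ` I)"
  proof (rule vec.independent_if_scalars_zero)
    show "finite (w ` I)" using assms by simp
    fix f x assume "(\<Sum>x\<in>w ` I. f x *s x) = 0" "x \<in> w ` I"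
    then show "f x = 0" using *[of "\<lambda>i. f (w i)"] by (auto simp: sum.reindex[OF inj])
  qed
qed

lemma indep_family_of_det_nz:
  fixes r :: "'n \<Rightarrow> real ^ 'n"
  assumes "det (\<chi> i. r i) \<noteq> 0"
  shows "indep_family I r"
proof -
  obtain B where "(\<chi> i. r i) ** B = mat 1"
    using assms invertible_det_nz[of "\<chi> i. r i"] unfolding invertible_def by blast
  then have "\<forall>c. (\<Sum>i\<in>UNIV. c i *s row i (\<chi> i. r i)) = 0 \<longrightarrow> (\<forall>i. c i = 0)"
    using matrix_right_invertible_independent_rows[of "\<chi> i. r i"] by blast
  then have "indep_family UNIV r"
    by (simp add: indep_family_iff row_def scalar_mult_eq_scaleR vec_nth_inverse)
  then show ?thesis
    unfolding indep_family_def by (meson inj_on_subset independent_mono image_mono subset_UNIV)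
qed

text \<open>Rationally independent integer vectors are independent over the reals: complete them to a
  square matrix; its determinant is a nonzero integer.\<close>

lemma indep_family_of_rational:
  fixes v :: "'n \<Rightarrow> int ^ 'n"
  assumes inj: "inj_on (\<lambda>i. int_vec (v i) :: rat ^ 'n) I"
    and ind: "vec.independent ((\<lambda>i. int_vec (v i) :: rat ^ 'n) ` I)"
  shows "indep_family I (\<lambda>i. int_vec (v i) :: real ^ 'n)"
proof -
  obtain f where f: "det (\<chi> i. if i \<in> I then int_vec (v i) else (axis (f i) 1 :: rat ^ 'n)) \<noteq> 0"
    using inj ind by (rule det_completion_by_axes)
  define r where "r i = (if i \<in> I then v i else axis (f i) 1)" for i
  have "(\<chi> i. if i \<in> I then int_vec (v i) else (axis (f i) 1 :: rat ^ 'n)) = int_mat (\<chi> i. r i)"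
    by (auto simp: vec_eq_iff int_mat_def map_matrix_def axis_def r_def)
  then have "(of_int (det (\<chi> i. r i)) :: rat) \<noteq> 0" using f by (simp only: det_int_mat not_False_eq_True)
  then have "(of_int (det (\<chi> i. r i)) :: real) \<noteq> 0" by simp
  then have "det (int_mat (\<chi> i. r i) :: real ^ 'n ^ 'n) \<noteq> 0" by (simp only: det_int_mat not_False_eq_True)
  moreover have "int_mat (\<chi> i. r i) = (\<chi> i. (int_vec (r i) :: real ^ 'n))"
    by (simp add: int_mat_def map_matrix_def vec_eq_iff)
  ultimately have "indep_family I (\<lambda>i. int_vec (r i) :: real ^ 'n)"
    by (intro indep_family_of_det_nz) simp
  then show ?thesis
    unfolding indep_family_iff[OF finite] by (simp add: r_def cong: sum.cong)
qed

lemma rational_of_indep_family: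
  fixes v :: "'i \<Rightarrow> int ^ 'n"
  assumes fin: "finite I" and v: "indep_family I (\<lambda>i. int_vec (v i) :: real ^ 'n)"
    and c: "(\<Sum>i\<in>I. c i *s (int_vec (v i) :: rat ^ 'n)) = 0"
  shows "\<forall>i\<in>I. c i = 0"
proof -
  have "(\<Sum>i\<in>I. of_rat (c i) *\<^sub>R (int_vec (v i) :: real ^ 'n)) = 0"
  proof (simp add: vec_eq_iff, intro allI)
    fix j
    have "(\<Sum>i\<in>I. c i * of_int (v i $ j)) = 0" using arg_cong[OF c, of "\<lambda>x. x $ j"] by simp
    then have "of_rat (\<Sum>i\<in>I. c i * of_int (v i $ j)) = (0 :: real)" by simp
    then show "(\<Sum>i\<in>I. real_of_rat (c i) * of_int (v i $ j)) = 0"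
      by (simp add: of_rat_sum of_rat_mult)
  qed
  then have "\<forall>i\<in>I. real_of_rat (c i) = 0"
    using v unfolding indep_family_iff[OF fin] by (elim allE impE)
  then show ?thesis by simp
qed

section \<open>From rational isotropic subspaces to integer families and back\<close>

lemma clear_denominators:
  fixes x :: "rat ^ 'n"
  obtains k z where "k \<noteq> 0" "of_int k *s x = int_vec z"
proof -
  have "\<forall>i. \<exists>k z. k \<noteq> 0 \<and> of_int k * x $ i = of_int z"
  proof
    fix i
    obtain a b where ab: "quotient_of (x $ i) = (a, b)" by (cases "quotient_of (x $ i)")
    then have "b > 0" "x $ i = of_int a / of_int b"
      using quotient_of_denom_pos quotient_of_div by blast+
    then show "\<exists>k z. k \<noteq> 0 \<and> of_int k * x $ i = of_int z" by (intro exI[of _ b] exI[of _ a]) auto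
  qed
  then obtain k z where kz: "\<And>i. k i \<noteq> 0" "\<And>i. of_int (k i) * x $ i = of_int (z i)" by metis
  show ?thesis
  proof (rule that)
    show "(\<Prod>i\<in>UNIV. k i) \<noteq> (0 :: int)" using kz(1) by simp
    show "of_int (\<Prod>i\<in>UNIV. k i) *s x = int_vec (\<chi> i. (\<Prod>j\<in>UNIV - {i}. k j) * z i)"
    proof (simp add: vec_eq_iff, intro allI)
      fix i
      have "(\<Prod>i\<in>UNIV. of_int (k i) :: rat) = of_int (k i) * (\<Prod>j\<in>UNIV - {i}. of_int (k j))"
        by (rule prod.remove) auto
      then show "(\<Prod>i\<in>UNIV. of_int (k i)) * x $ i = (\<Prod>j\<in>UNIV - {i}. of_int (k j)) * of_int (z i)"
        using kz(2)[of i] by (metis mult.assoc mult.commute)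
    qed
  qed
qed

lemma rat_isotropic_polarization:
  fixes M :: "rat ^ 'n ^ 'n"
  assumes sym: "transpose M = M"
    and "bform M x x = 0" "bform M y y = 0" "bform M (x + y) (x + y) = 0"
  shows "bform M x y = 0"
  using assms(2-) bform_commute[OF sym, of y x] by simp

text \<open>An isotropic subspace of maximal dimension has at least \<open>iso_q A + 1\<close>
  independent vectors; that many are selected and scaled to be integral. They are indexed by a part
  of \<open>'n option\<close>, which has room because independent vectors number at most n +
  1.\<close>

lemma isotropic_integer_family_exists:
  fixes A :: "int ^ 'n ^ 'n"
  assumes sym: "transpose A = A" and iso: "iso_Q A > iso_q A"
  obtains I and v :: "'n option \<Rightarrow> int ^ 'n option" where "card I = Suc (iso_q A)"
    "indep_family I (\<lambda>i. int_vec (v i) :: real ^ 'n option)"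
    "\<And>i j. i \<in> I \<Longrightarrow> j \<in> I \<Longrightarrow> bform (blk (- 1) A) (v i) (v j) = 0"
proof -
  interpret pr: finite_dimensional_vector_space_prod "(*s) :: rat \<Rightarrow> rat ^ 'n \<Rightarrow> rat ^ 'n"
    "(*) :: rat \<Rightarrow> rat \<Rightarrow> rat" cart_basis "{1}"
    by unfold_locales
  define f :: "(rat ^ 'n) \<times> rat \<Rightarrow> rat" where "f = (\<lambda>(x, y). qform (int_mat A) x - y\<^sup>2)"
  define h :: "(rat ^ 'n) \<times> rat \<Rightarrow> rat ^ 'n option" where "h = (\<lambda>(x, y). vcons y x)"
  define M :: "rat ^ 'n option ^ 'n option" where "M = int_mat (blk (- 1) A)"
  have symM: "transpose M = M" unfolding M_def by (intro transpose_int_mat transpose_blk sym)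
  have fh: "f w = bform M (h w) (h w)" for w
    by (cases w) (simp add: f_def h_def M_def int_mat_blk bform_blk qform_def power2_eq_square)
  have h_add: "h (w + w') = h w + h w'" for w w'
    by (cases w; cases w') (simp add: h_def vec_option_eq_iff)
  have h_scale: "h (pr.scale c w) = c *s h w" for c w
    by (cases w) (simp add: h_def pr.scale_def vec_option_eq_iff)
  have "f 0 = 0" by (simp add: f_def zero_prod_def qform_def bform_def)
  then obtain W where W: "pr.p.subspace W" "\<And>w. w \<in> W \<Longrightarrow> f w = 0"
    and dimW: "pr.p.dim W = isotropy_index pr.scale f"
    using pr.p.isotropy_index_attained by blast
  have "isotropy_index pr.scale f = iso_Q A" by (simp add: iso_Q_def f_def)
  then have "Suc (iso_q A) \<le> pr.p.dim W" using dimW iso by simp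
  moreover obtain B where B: "B \<subseteq> W" "pr.p.independent B" "card B = pr.p.dim W"
    using pr.p.basis_exists by metis
  ultimately obtain S where S: "S \<subseteq> B" "card S = Suc (iso_q A)" "finite S"
    using obtain_subset_with_card_n[of "Suc (iso_q A)" B] by metis
  have indS: "pr.p.independent S" using B(2) S(1) by (rule pr.p.independent_mono)
  interpret h: module_hom pr.scale "(*s)" h
    by unfold_locales (simp_all add: h_add h_scale)
  have inj_h: "inj h" by (auto simp: inj_def h_def vec_option_eq_iff)
  have indT: "vec.independent (h ` S)"
    using indS inj_h by (intro h.independent_injective_image) (auto intro: inj_on_subset)
  have cT: "card (h ` S) = Suc (iso_q A)"
    using S inj_h by (simp add: card_image inj_on_subset)
  have "card (h ` S) \<le> vec.dim (UNIV :: (rat ^ 'n option) set)"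
    by (rule vec.independent_card_le_dim[OF subset_UNIV indT])
  then have "Suc (iso_q A) \<le> card (UNIV :: 'n option set)"
    by (simp only: cT vec_dim_card)
  then obtain I :: "'n option set" where I: "card I = Suc (iso_q A)"
    using obtain_subset_with_card_n by metis
  have "\<exists>b. bij_betw b I (h ` S)"
    by (rule finite_same_card_bij) (use S(3) I cT in auto)
  then obtain b where b: "bij_betw b I (h ` S)" by blast
  have "\<forall>i. \<exists>k z. k \<noteq> 0 \<and> of_int k *s b i = int_vec z"
    using clear_denominators by metis
  then obtain k v where kv: "\<And>i. k i \<noteq> 0" "\<And>i. of_int (k i) *s b i = int_vec (v i)" by metis
  have injb: "inj_on b I" and imb: "b ` I = h ` S" using b by (auto simp: bij_betw_def)
  have rel: "\<forall>i\<in>I. c i = 0" if c: "(\<Sum>i\<in>I. c i *s (int_vec (v i) :: rat ^ 'n option)) = 0" for c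
  proof
    fix i assume i: "i \<in> I"
    have "c i *s (int_vec (v i) :: rat ^ 'n option) = (c i * of_int (k i)) *s b i" for i
      by (simp flip: kv(2))
    then have "(\<Sum>i\<in>I. (c i * of_int (k i)) *s b i) = 0" using c by simp
    then have "(\<Sum>x\<in>b ` I. (c (the_inv_into I b x) * of_int (k (the_inv_into I b x))) *s x) = 0"
      by (simp add: sum.reindex[OF injb] the_inv_into_f_f[OF injb])
    then have "c (the_inv_into I b (b i)) * of_int (k (the_inv_into I b (b i))) = 0"
      using vec.independentD[of "b ` I" "b ` I" "\<lambda>x. c (the_inv_into I b x) * of_int (k (the_inv_into I b x))" "b i"]
        indT i unfolding imb[symmetric] by simp
    then show "c i = 0" using kv(1) by (simp add: the_inv_into_f_f[OF injb i])
  qed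
  show ?thesis
  proof (rule that[OF I])
    show "indep_family I (\<lambda>i. int_vec (v i) :: real ^ 'n option)"
      by (rule indep_family_of_rational; rule vec_independent_family[OF finite]; erule rel)
    fix i j assume ij: "i \<in> I" "j \<in> I"
    have "\<exists>w\<in>W. b i = h w" if "i \<in> I" for i using that imb S(1) B(1) by blast
    then obtain w w' where w: "w \<in> W" "b i = h w" "w' \<in> W" "b j = h w'" using ij by metis
    have "w + w' \<in> W" using W(1) w by (simp add: pr.p.subspace_add)
    have "bform M (h w) (h w') = 0"
    proof (rule rat_isotropic_polarization[OF symM])
      show "bform M (h w) (h w) = 0" "bform M (h w') (h w') = 0" using W(2) w by (simp_all flip: fh)
      show "bform M (h w + h w') (h w + h w') = 0"
        using W(2)[OF \<open>w + w' \<in> W\<close>] by (simp only: fh h_add)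
    qed
    then have "bform M (b i) (b j) = 0" using w by simp
    then have "bform M (int_vec (v i)) (int_vec (v j)) = 0" by (simp flip: kv(2))
    then show "bform (blk (- 1) A) (v i) (v j) = 0" by (simp add: M_def bform_int_vec)
  qed
qed

text \<open>With last coordinate 0 the family is isotropic for q alone. Real independence gives
  rational independence, so its span would be a totally isotropic rational space of dimension above
  \<open>iso_q A\<close>.\<close>

lemma no_isotropic_integer_family:
  fixes A :: "int ^ 'n ^ 'n" and v :: "'i \<Rightarrow> int ^ 'n option"
  assumes I: "card I = Suc (iso_q A)"
    and v: "indep_family I (\<lambda>i. int_vec (v i) :: real ^ 'n option)"
    and iso: "\<And>i j. i \<in> I \<Longrightarrow> j \<in> I \<Longrightarrow> bform (blk (- 1) A) (v i) (v j) = 0"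
    and zero: "\<And>i. i \<in> I \<Longrightarrow> v i $ None = 0"
  shows False
proof -
  have fin: "finite I" using I by (metis card.infinite nat.simps(3))
  let ?w = "\<lambda>i. int_vec (vtail (v i)) :: rat ^ 'n"
  have rel: "\<forall>i\<in>I. c i = 0" if c: "(\<Sum>i\<in>I. c i *s ?w i) = 0" for c
  proof -
    have "(\<Sum>i\<in>I. c i *s (int_vec (v i) :: rat ^ 'n option)) $ l = 0" for l
    proof (cases l)
      case (Some j)
      then show ?thesis using arg_cong[OF c, of "\<lambda>x. x $ j"] by simp
    qed (use zero in simp)
    then have "(\<Sum>i\<in>I. c i *s (int_vec (v i) :: rat ^ 'n option)) = 0" by (simp add: vec_eq_iff)
    then show ?thesis by (rule rational_of_indep_family[OF fin v])
  qed
  have ind: "inj_on ?w I" "vec.independent (?w ` I)"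
    by (rule vec_independent_family[OF fin], erule rel)+
  let ?W = "vec.span (?w ` I)"
  have ww: "bform (int_mat A) (?w i) (?w j) = 0" if "i \<in> I" "j \<in> I" for i j
    using iso[OF that] zero that by (simp add: bform_int_vec bform_blk)
  have 1: "bform (int_mat A) x (?w j) = 0" if "x \<in> ?W" "j \<in> I" for x j
    using that(1)
  proof (induction rule: vec.span_induct_alt)
    case base then show ?case by (simp add: bform_def)
  next
    case (step c x y) then show ?case using ww that(2) by auto
  qed
  have 2: "bform (int_mat A) x y = 0" if "x \<in> ?W" "y \<in> ?W" for x y
    using that(2)
  proof (induction rule: vec.span_induct_alt)
    case base then show ?case by (simp add: bform_def)
  next
    case (step c z y) then show ?case using 1 that(1) by auto
  qed
  have "vec.dim ?W \<le> isotropy_index (*s) (qform (int_mat A :: rat ^ 'n ^ 'n))"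
    by (rule vec.dim_le_isotropy_index) (use 2 in \<open>auto simp: qform_def\<close>)
  moreover have "vec.dim ?W = card I"
    using ind by (simp add: vec.dim_eq_card_independent card_image)
  ultimately show False using I by (simp add: iso_q_def)
qed

section \<open>Hyperbolic rotations\<close>

text \<open>Both \<open>d\<close> and \<open>e\<close> lie between 1 and n = d + e - 1 and are
  opposite convex combinations of these endpoints. Since x ln x is convex and vanishes at 1, its
  values at \<open>d\<close> and \<open>e\<close> add up to at most its value at n.\<close>

lemma self_power_mult_le:
  fixes d e :: nat
  assumes "d \<ge> 1" "e \<ge> 1"
  shows "real d ^ d * real e ^ e \<le> real (d + e - 1) ^ (d + e - 1)"
proof -
  let ?h = "\<lambda>x :: real. x * ln x"
  define n where "n = d + e - 1"
  have n1: "n \<ge> 1" using assms by (simp add: n_def)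
  have conv: "convex_on {0<..} ?h"
  proof (rule f''_ge0_imp_convex[where f' = "\<lambda>x. ln x + 1" and f'' = "\<lambda>x. 1 / x"])
    show "DERIV ?h x :> ln x + 1" if "x \<in> {0<..}" for x :: real
      using that by (auto intro!: derivative_eq_intros)
    show "DERIV (\<lambda>x. ln x + 1) x :> 1 / x" if "x \<in> {0<..}" for x :: real
      using that by (auto intro!: derivative_eq_intros)
  qed auto
  have "?h d + ?h e \<le> ?h n"
  proof (cases "n = 1")
    case True
    then have "d = 1" "e = 1" using assms by (auto simp: n_def)
    then show ?thesis by (simp add: n_def)
  next
    case False
    then have n2: "real n - 1 > 0" using n1 by linarith
    define t where "t = (real d - 1) / (real n - 1)"
    have t: "0 \<le> t" "t \<le> 1" using n2 assms by (auto simp: t_def n_def divide_le_eq)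
    have tn: "t * (real n - 1) = real d - 1" using n2 by (simp add: t_def)
    have ed: "real e = real n + 1 - real d" using assms by (simp add: n_def)
    have d: "real d = (1 - t) *\<^sub>R 1 + t *\<^sub>R real n" using tn by (simp add: algebra_simps)
    have e: "real e = (1 - t) *\<^sub>R real n + t *\<^sub>R 1" using tn ed by (simp add: algebra_simps)
    have "?h d \<le> (1 - t) * ?h 1 + t * ?h n"
      unfolding d by (rule convex_onD[OF conv t]) (use n1 in auto)
    moreover have "?h e \<le> (1 - t) * ?h n + t * ?h 1"
      unfolding e by (rule convex_onD[OF conv t]) (use n1 in auto)
    ultimately show ?thesis by (simp add: algebra_simps)
  qed
  then have "ln (real d ^ d * real e ^ e) \<le> ln (real n ^ n)"
    using assms n1 by (simp add: ln_mult ln_realpow)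
  then have "real d ^ d * real e ^ e \<le> real n ^ n" using assms n1 by simp
  then show ?thesis by (simp only: n_def)
qed

text \<open>Here \<open>u\<close> is the unit vector along \<alpha>, \<open>b\<close> represents the
  linear form b(x, \<alpha>) normalized by its value 1 at \<open>u\<close>, and \<open>Y\<close> is
  ||\<alpha>|| y. For \<open>b = u\<close> the map is a plane hyperbolic rotation of norm exactly
  \<open>c + s\<close>; the factor \<open>norm b\<close> pays for \<open>b\<close> and
  \<open>u\<close> not being parallel.\<close>

lemma boost_norm_le:
  fixes b u x :: "'a::real_inner" and c s Y :: real
  assumes u: "norm u = 1" and bu: "b \<bullet> u = 1"
    and cs: "c\<^sup>2 = 1 + s\<^sup>2" and c: "c \<ge> 1" and s: "s \<ge> 0"
  shows "(norm (x + ((c - 1) * (b \<bullet> x) + s * Y) *\<^sub>R u))\<^sup>2 + (s * (b \<bullet> x) + c * Y)\<^sup>2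
    \<le> ((c + s) * norm b)\<^sup>2 * ((norm x)\<^sup>2 + Y\<^sup>2)"
proof -
  define \<beta> where "\<beta> = b \<bullet> x"
  define D where "D = (c - 1) * \<beta> + s * Y"
  define A where "A = c * \<beta> + s * Y"
  define B where "B = s * \<beta> + c * Y"
  define K where "K = (norm b)\<^sup>2"
  have bb: "b \<bullet> b = K" and uu: "u \<bullet> u = 1" using u by (simp_all add: K_def power2_norm_eq_inner norm_eq_1)
  have "1 \<le> norm b" using Cauchy_Schwarz_ineq2[of b u] u bu by simp
  then have K1: "K \<ge> 1" by (simp add: K_def)
  \<comment> \<open>\<open>y\<close> and \<open>u'\<close> are the parts of \<open>x\<close> and
    \<open>u\<close> normal to \<open>b\<close>; the hyperbolic rotation proper acts on the pair
    \<open>\<beta>\<close>, \<open>Y\<close>.\<close>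
  define y where "y = x - (\<beta> / K) *\<^sub>R b"
  define u' where "u' = u - (1 / K) *\<^sub>R b"
  have by0: "b \<bullet> y = 0" and bu'0: "b \<bullet> u' = 0"
    using K1 by (simp_all add: y_def u'_def inner_diff_right bb bu flip: \<beta>_def)
  have x: "x = (\<beta> / K) *\<^sub>R b + y" by (simp add: y_def)
  have u_eq: "u = (1 / K) *\<^sub>R b + u'" by (simp add: u'_def)
  define \<nu> where "\<nu> = 1 - 1 / K"
  have u'u': "u' \<bullet> u' = \<nu>"
    using K1 by (simp add: u'_def \<nu>_def inner_diff_left inner_diff_right inner_commute[of u b] bb bu uu)
  have nx: "(norm x)\<^sup>2 = \<beta>\<^sup>2 / K + (norm y)\<^sup>2"
    unfolding x power2_norm_eq_inner
    using by0 K1 by (simp add: inner_add_left inner_add_right inner_commute[of y b] bb power2_eq_square)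
  have AD: "A = \<beta> + D" by (simp add: A_def D_def algebra_simps)
  have "x + D *\<^sub>R u = (A / K) *\<^sub>R b + (y + D *\<^sub>R u')"
    unfolding AD by (subst x, subst u_eq) (simp add: algebra_simps add_divide_distrib)
  then have nxD: "(norm (x + D *\<^sub>R u))\<^sup>2 = A\<^sup>2 / K + (norm (y + D *\<^sub>R u'))\<^sup>2"
    unfolding power2_norm_eq_inner using by0 bu'0 K1
    by (simp add: inner_add_left inner_add_right inner_commute[of y b] inner_commute[of u' b] bb power2_eq_square)
  have sq: "(s - (c - 1)) * (s + (c - 1)) \<ge> 0"
    using cs c by (simp add: algebra_simps power2_eq_square)
  have sc: "c - 1 \<le> s"
  proof (rule ccontr)
    assume "\<not> c - 1 \<le> s"
    then have "s * s < (c - 1) * (c - 1)" using s by (intro mult_strict_mono') auto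
    then show False using sq by (simp add: algebra_simps)
  qed
  let ?t = "c + s"
  \<comment> \<open>The deficit \<open>2 * c * s * (\<beta> - Y)\<^sup>2\<close> is kept because it
    later absorbs the contribution of \<open>D\<close> normal to \<open>b\<close>.\<close>
  have AB: "A\<^sup>2 + B\<^sup>2 = ?t\<^sup>2 * (\<beta>\<^sup>2 + Y\<^sup>2) - 2 * c * s * (\<beta> - Y)\<^sup>2"
    by (simp add: A_def B_def power2_eq_square algebra_simps)
  have main: "A\<^sup>2 / K + (norm (y + D *\<^sub>R u'))\<^sup>2 + B\<^sup>2 \<le> ?t\<^sup>2 * (\<beta>\<^sup>2 + K * (norm y)\<^sup>2 + K * Y\<^sup>2)"
  proof (cases "?t = 1")
    case True
    then have "c = 1" "s = 0" using c s by auto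
    then have "A = \<beta>" "B = Y" "D = 0" by (simp_all add: A_def B_def D_def)
    moreover have "\<beta>\<^sup>2 / K \<le> \<beta>\<^sup>2" using K1 by (simp add: divide_le_eq mult_le_cancel_left1)
    moreover have "1 * (norm y)\<^sup>2 \<le> K * (norm y)\<^sup>2" "1 * Y\<^sup>2 \<le> K * Y\<^sup>2"
      using K1 by (intro mult_right_mono; simp)+
    ultimately show ?thesis using True by simp
  next
    case False
    then have t1: "?t > 1" using c s by linarith
    then have "?t\<^sup>2 > 1" by (simp add: one_less_power)
    define Z where "Z = ?t\<^sup>2 * K"
    have "?t\<^sup>2 * 1 \<le> Z" unfolding Z_def using K1 by (intro mult_left_mono) auto
    then have Z1: "Z - 1 > 0" using \<open>?t\<^sup>2 > 1\<close> by linarith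
    \<comment> \<open>Young's inequality, weighted so that \<open>y\<close> gets exactly the factor
      \<open>Z\<close> that the claim allows. The weight requires \<open>Z > 1\<close>, which is why
      \<open>?t = 1\<close> is treated apart.\<close>
    have yu: "(Z - 1) * (norm (y + D *\<^sub>R u'))\<^sup>2 \<le> (Z - 1) * (Z * (norm y)\<^sup>2) + Z * (\<nu> * D\<^sup>2)"
    proof -
      have "0 \<le> (norm ((Z - 1) *\<^sub>R y - D *\<^sub>R u'))\<^sup>2" by simp
      also have "\<dots> = (Z - 1) * (Z - 1) * (y \<bullet> y) - 2 * (Z - 1) * D * (y \<bullet> u') + D * D * \<nu>"
        unfolding power2_norm_eq_inner
        by (simp add: inner_diff_left inner_diff_right inner_commute[of u' y] u'u' algebra_simps)
      finally show ?thesis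
        unfolding power2_norm_eq_inner
        by (simp add: inner_add_left inner_add_right inner_commute[of u' y] u'u' power2_eq_square algebra_simps)
    qed
    define q where "q = ?t\<^sup>2 * (K - 1)"
    have q0: "q \<ge> 0" using K1 by (simp add: q_def)
    have Z\<nu>: "Z * \<nu> = q" using K1 by (simp add: Z_def \<nu>_def q_def field_simps)
    have Zq: "Z - 1 = q + (?t\<^sup>2 - 1)" by (simp add: Z_def q_def algebra_simps)
    define M where "M = \<beta> - Y"
    have DM: "D = (c - 1) * M + (?t - 1) * Y" by (simp add: D_def M_def algebra_simps)
    \<comment> \<open>Lagrange's identity, that is, Cauchy-Schwarz for the vectors
      \<open>(sqrt q, ?t - 1)\<close> and \<open>((c - 1) * M, sqrt q * Y)\<close>.\<close>
    have "q * D\<^sup>2 + (q * Y - (?t - 1) * (c - 1) * M)\<^sup>2 = (q + (?t - 1)\<^sup>2) * ((c - 1)\<^sup>2 * M\<^sup>2 + q * Y\<^sup>2)"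
      unfolding DM by (simp add: power2_eq_square algebra_simps)
    then have "q * D\<^sup>2 \<le> (q + (?t - 1)\<^sup>2) * ((c - 1)\<^sup>2 * M\<^sup>2 + q * Y\<^sup>2)"
      by (smt (verit) zero_le_power2)
    also have "\<dots> \<le> (Z - 1) * (2 * c * s * M\<^sup>2 + q * Y\<^sup>2)"
    proof (rule mult_mono)
      have "(?t - 1)\<^sup>2 \<le> ?t\<^sup>2 - 1" using t1 by (simp add: power2_eq_square algebra_simps)
      then show "q + (?t - 1)\<^sup>2 \<le> Z - 1" by (simp add: Zq)
      have "(c - 1) * (c - 1) \<le> c * s" using c s sc by (intro mult_mono) auto
      moreover have "0 \<le> c * s" using c s by simp
      ultimately have "(c - 1)\<^sup>2 \<le> 2 * c * s" by (simp add: power2_eq_square)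
      then have "(c - 1)\<^sup>2 * M\<^sup>2 \<le> 2 * c * s * M\<^sup>2" by (rule mult_right_mono) simp
      then show "(c - 1)\<^sup>2 * M\<^sup>2 + q * Y\<^sup>2 \<le> 2 * c * s * M\<^sup>2 + q * Y\<^sup>2" by simp
    qed (use Z1 q0 in auto)
    finally have qD: "q * D\<^sup>2 \<le> (Z - 1) * (2 * c * s * M\<^sup>2 + q * Y\<^sup>2)" .
    have "(Z - 1) * (norm (y + D *\<^sub>R u'))\<^sup>2 \<le> (Z - 1) * (Z * (norm y)\<^sup>2 + (2 * c * s * M\<^sup>2 + q * Y\<^sup>2))"
      using yu qD Z\<nu> by (simp add: distrib_left) (simp flip: mult.assoc)
    then have "(norm (y + D *\<^sub>R u'))\<^sup>2 \<le> Z * (norm y)\<^sup>2 + (2 * c * s * M\<^sup>2 + q * Y\<^sup>2)"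
      using Z1 by simp
    moreover have "A\<^sup>2 / K \<le> A\<^sup>2" using K1 by (simp add: divide_le_eq mult_le_cancel_left1)
    ultimately have "A\<^sup>2 / K + (norm (y + D *\<^sub>R u'))\<^sup>2 + B\<^sup>2
        \<le> (A\<^sup>2 + B\<^sup>2) + Z * (norm y)\<^sup>2 + (2 * c * s * M\<^sup>2 + q * Y\<^sup>2)" by simp
    also have "\<dots> = ?t\<^sup>2 * (\<beta>\<^sup>2 + K * (norm y)\<^sup>2 + K * Y\<^sup>2)"
      unfolding AB Z_def q_def M_def by (simp add: algebra_simps)
    finally show ?thesis .
  qed
  have "(?t * norm b)\<^sup>2 * ((norm x)\<^sup>2 + Y\<^sup>2) = ?t\<^sup>2 * (\<beta>\<^sup>2 + K * (norm y)\<^sup>2 + K * Y\<^sup>2)"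
  proof -
    have "K * (\<beta>\<^sup>2 / K + (norm y)\<^sup>2 + Y\<^sup>2) = \<beta>\<^sup>2 + K * (norm y)\<^sup>2 + K * Y\<^sup>2"
      using K1 by (simp add: distrib_left)
    then show ?thesis by (simp only: nx power_mult_distrib mult.assoc flip: K_def)
  qed
  then show ?thesis using main nxD unfolding B_def D_def \<beta>_def by simp
qed

text \<open>At \<open>Y = 0\<close> the displacement along \<open>u\<close> is at most
  \<open>\<bar>s * \<beta>\<bar>\<close>, which is the new last coordinate, so what the displacement
  takes from \<open>x\<close> reappears there. Hence the loss is at most sqrt 2, for either sign of
  \<open>s\<close>.\<close>

lemma boost_norm_ge:
  fixes x u :: "'a::real_inner" and c s \<beta> :: real
  assumes u: "norm u = 1" and cs: "c\<^sup>2 = 1 + s\<^sup>2" and c: "c \<ge> 1"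
  shows "(norm x)\<^sup>2 \<le> 2 * ((norm (x + ((c - 1) * \<beta>) *\<^sub>R u))\<^sup>2 + (s * \<beta>)\<^sup>2)"
proof -
  have "(c - 1)\<^sup>2 \<le> s\<^sup>2" using cs c by (simp add: power2_eq_square algebra_simps)
  then have le: "((c - 1) * \<beta>)\<^sup>2 \<le> (s * \<beta>)\<^sup>2" by (simp add: power_mult_distrib mult_right_mono)
  let ?z = "x + ((c - 1) * \<beta>) *\<^sub>R u"
  have "norm x \<le> norm ?z + \<bar>(c - 1) * \<beta>\<bar>"
    using norm_triangle_ineq4[of ?z "((c - 1) * \<beta>) *\<^sub>R u"] u by simp
  then have "(norm x)\<^sup>2 \<le> (norm ?z + \<bar>(c - 1) * \<beta>\<bar>)\<^sup>2" by (intro power_mono) auto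
  also have "\<dots> \<le> 2 * ((norm ?z)\<^sup>2 + ((c - 1) * \<beta>)\<^sup>2)"
    using sum_squares_bound[of "norm ?z" "\<bar>(c - 1) * \<beta>\<bar>"] by (simp add: power2_sum)
  finally show ?thesis using le by simp
qed

lemma power2_norm_vcons: "(norm (vcons y x :: real ^ ('n::finite) option))\<^sup>2 = y\<^sup>2 + (norm x)\<^sup>2"
  unfolding power2_norm_eq_inner by (simp add: inner_vec_def UNIV_option_sum power2_eq_square)

section \<open>The quadric and its boosts in Euclidean coordinates\<close>

locale quadric =
  fixes A0 P0 :: "real ^ 'n ^ 'n" and A :: "int ^ 'n ^ 'n" and \<alpha> :: "real ^ 'n"
  assumes P0: "\<And>x y. (P0 *v x) \<bullet> (P0 *v y) = bform A0 x y"
    and det_P0: "det P0 \<noteq> 0"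
    and A_sym: "transpose A = A"
    and alpha: "qform (int_mat A) \<alpha> = 1"
begin

abbreviation b :: "real ^ 'n \<Rightarrow> real ^ 'n \<Rightarrow> real" where
  "b \<equiv> bform (int_mat A)"

definition a :: real where "a = qnorm A0 \<alpha>"

definition \<kappa> :: real where "\<kappa> = opnorm A0 (\<lambda>x. b x \<alpha>)"

text \<open>The norm of the first estimate. The weight \<open>a\<close> on the last coordinate makes
  (\<alpha>, 1) and (\<alpha>, -1) orthogonal, so boosts stretch along perpendicular axes.\<close>

definition N :: "real ^ 'n option \<Rightarrow> real" where "N v = norm (blk a P0 *v v)"

text \<open>For \<open>c = cosh \<tau>\<close> and \<open>s = sinh \<tau>\<close> this is the isometry of \<open>q(x) - y\<^sup>2\<close> that multiplies the
  isotropic vectors \<open>(\<alpha>, 1)\<close> and \<open>(\<alpha>, -1)\<close> by \<open>exp \<tau>\<close> and \<open>exp (- \<tau>)\<close> and fixes their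
  orthogonal complement.\<close>

definition boost :: "real \<Rightarrow> real \<Rightarrow> real ^ 'n option \<Rightarrow> real ^ 'n option" where
  "boost c s v = vcons (s * b (vtail v) \<alpha> + c * v $ None)
     (vtail v + ((c - 1) * b (vtail v) \<alpha> + s * v $ None) *\<^sub>R \<alpha>)"

lemma qnorm_eq: "qnorm A0 x = norm (P0 *v x)"
  by (simp add: qnorm_def qform_def norm_eq_sqrt_inner P0)

lemma b_commute: "b x y = b y x"
  by (rule bform_commute) (rule transpose_int_mat[OF A_sym])

lemma b_alpha [simp]: "b \<alpha> \<alpha> = 1"
  using alpha by (simp add: qform_def)

lemma P0_inverse: obtains R where "\<And>x. R *v (P0 *v x) = x" "\<And>x. P0 *v (R *v x) = x"
  using det_P0 invertible_det_nz[of P0] unfolding invertible_def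
  by (metis matrix_vector_mul_assoc matrix_vector_mul_lid)

lemma P0_eq_0_iff: "P0 *v x = 0 \<longleftrightarrow> x = 0"
proof
  obtain R where R: "\<And>x. R *v (P0 *v x) = x" using P0_inverse by metis
  assume "P0 *v x = 0"
  then show "x = 0" using R[of x] by simp
qed simp

lemma a_pos: "a > 0"
proof -
  have "\<alpha> \<noteq> 0" using b_alpha by (auto simp: bform_def)
  then show ?thesis by (simp add: a_def qnorm_eq P0_eq_0_iff)
qed

lemma norm_P0_alpha: "norm (P0 *v \<alpha>) = a"
  by (simp add: a_def qnorm_eq)

lemma N_sq: "(N v)\<^sup>2 = (a * v $ None)\<^sup>2 + (norm (P0 *v vtail v))\<^sup>2"
  by (simp add: N_def blk_mult_vec power2_norm_vcons)

lemma N_nonneg [simp]: "0 \<le> N v"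
  by (simp add: N_def)

text \<open>Any finite constant serves: it shows that the sets in \<open>opnorm\<close> and
  \<open>qsup\<close> are bounded, so that their suprema are genuine upper bounds.\<close>

lemma b_bounded: obtains C where "\<And>x y. \<bar>b x y\<bar> \<le> C * norm (P0 *v x) * norm (P0 *v y)"
proof -
  obtain R where R: "\<And>x. R *v (P0 *v x) = x" using P0_inverse by metis
  have "bilinear (\<lambda>x y. b (R *v x) (R *v y))"
    by (auto simp: bilinear_def intro!: linearI simp: matrix_vector_right_distrib matrix_vector_mult_scaleR)
  then obtain C where "\<And>x y. norm (b (R *v x) (R *v y)) \<le> C * norm x * norm y"
    using bilinear_bounded by blast
  from this[of "P0 *v x" "P0 *v y" for x y] show ?thesis by (intro that) (simp add: R)
qed

lemma b_alpha_le: "\<bar>b x \<alpha>\<bar> \<le> \<kappa> * norm (P0 *v x)"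
proof (cases "x = 0")
  case False
  obtain C where C: "\<And>x y. \<bar>b x y\<bar> \<le> C * norm (P0 *v x) * norm (P0 *v y)" using b_bounded by blast
  let ?r = "norm (P0 *v x)"
  have r: "?r > 0" using False by (simp add: P0_eq_0_iff)
  let ?S = "{\<bar>b x \<alpha>\<bar> | x. qnorm A0 x = 1}"
  have "bdd_above ?S"
  proof (rule bdd_aboveI)
    fix t assume "t \<in> ?S"
    then obtain x where "t = \<bar>b x \<alpha>\<bar>" "qnorm A0 x = 1" by blast
    then show "t \<le> C * a" using C[of x \<alpha>] by (simp add: qnorm_eq norm_P0_alpha)
  qed
  moreover have "\<bar>b ((1 / ?r) *\<^sub>R x) \<alpha>\<bar> \<in> ?S"
    using r by (intro CollectI exI[of _ "(1 / ?r) *\<^sub>R x"]) (simp add: qnorm_eq matrix_vector_mult_scaleR)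
  ultimately have "\<bar>b ((1 / ?r) *\<^sub>R x) \<alpha>\<bar> \<le> \<kappa>" unfolding \<kappa>_def opnorm_def by (intro cSup_upper)
  then show ?thesis using r by (simp add: abs_mult divide_le_eq)
qed (simp add: bform_def)

lemma kappa_a: "1 \<le> \<kappa> * a"
  using b_alpha_le[of \<alpha>] by (simp add: norm_P0_alpha)

lemma kappa_pos: "\<kappa> > 0"
  using kappa_a a_pos by (metis less_le_trans zero_less_mult_pos2 zero_less_one)

text \<open>The Riesz vector of b(x, \<alpha>) in the coordinates of \<open>P0\<close>. The factor
  \<open>a\<close> gives it the value 1 on the unit vector along \<alpha>, as
  \<open>boost_norm_le\<close> expects.\<close>

lemma dual_vector:
  obtains d where "\<And>x. d \<bullet> (P0 *v x) = a * b x \<alpha>" "norm d \<le> a * \<kappa>"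
proof -
  obtain R where R: "\<And>x. R *v (P0 *v x) = x" "\<And>x. P0 *v (R *v x) = x" using P0_inverse by metis
  define d where "d = a *\<^sub>R (transpose R *v (int_mat A *v \<alpha>))"
  have d: "d \<bullet> (P0 *v x) = a * b x \<alpha>" for x
  proof -
    have "(transpose R *v (int_mat A *v \<alpha>)) \<bullet> (P0 *v x) = (int_mat A *v \<alpha>) \<bullet> (R *v (P0 *v x))"
      by (simp add: dot_lmul_matrix)
    also have "\<dots> = b x \<alpha>" by (simp add: R bform_def inner_vec_def mult.commute)
    finally show ?thesis by (simp add: d_def)
  qed
  have "norm d * norm d \<le> (a * \<kappa>) * norm d"
  proof -
    have "norm d * norm d = a * b (R *v d) \<alpha>" using d[of "R *v d"] by (simp add: R flip: power2_eq_square power2_norm_eq_inner)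
    also have "\<dots> \<le> a * (\<kappa> * norm d)"
      using b_alpha_le[of "R *v d"] a_pos by (intro mult_left_mono) (auto simp: R)
    finally show ?thesis by (simp add: mult.assoc)
  qed
  then have "norm d \<le> a * \<kappa>"
    using a_pos kappa_pos by (cases "d = 0") (auto simp: mult_le_cancel_right)
  then show ?thesis using d that by blast
qed

lemma b_le_qsup: "\<bar>b x y\<bar> \<le> qsup A0 (int_mat A) * norm (P0 *v x) * norm (P0 *v y)"
proof (cases "x = 0 \<or> y = 0")
  case False
  obtain C where C: "\<And>x y. \<bar>b x y\<bar> \<le> C * norm (P0 *v x) * norm (P0 *v y)" using b_bounded by blast
  let ?S = "{b x y | x y. qnorm A0 x = 1 \<and> qnorm A0 y = 1}"
  have bdd: "bdd_above ?S"
  proof (rule bdd_aboveI)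
    fix t assume "t \<in> ?S"
    then obtain x y where "t = b x y" "qnorm A0 x = 1" "qnorm A0 y = 1" by blast
    then show "t \<le> C" using C[of x y] by (simp add: qnorm_eq)
  qed
  have le: "b x y \<le> qsup A0 (int_mat A) * norm (P0 *v x) * norm (P0 *v y)" if "x \<noteq> 0" "y \<noteq> 0" for x y
  proof -
    let ?r = "norm (P0 *v x)" and ?t = "norm (P0 *v y)"
    have pos: "?r > 0" "?t > 0" using that by (simp_all add: P0_eq_0_iff)
    have "b ((1 / ?r) *\<^sub>R x) ((1 / ?t) *\<^sub>R y) \<in> ?S"
      using pos by (intro CollectI exI[of _ "(1 / ?r) *\<^sub>R x"] exI[of _ "(1 / ?t) *\<^sub>R y"])
        (simp add: qnorm_eq matrix_vector_mult_scaleR)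
    then have "b ((1 / ?r) *\<^sub>R x) ((1 / ?t) *\<^sub>R y) \<le> qsup A0 (int_mat A)"
      unfolding qsup_def by (rule cSup_upper[OF _ bdd])
    then show ?thesis using pos by (simp add: divide_le_eq mult_ac)
  qed
  \<comment> \<open>The supremum in \<open>qsup\<close> is taken without modulus; \<open>- x\<close>
    supplies the other sign.\<close>
  have "b (- x) y = - b x y" using bform_scaleR(1)[of "int_mat A" "-1" x y] by simp
  moreover have "norm (P0 *v (- x)) = norm (P0 *v x)"
    using matrix_vector_mult_scaleR[of P0 "-1" x] by simp
  ultimately show ?thesis using False le[of x y] le[of "- x" y] by (simp add: abs_le_iff)
qed (auto simp: bform_def)

text \<open>As q(\<alpha>) = 1, the norm of q is at least \<open>1 / (a * a)\<close>, so the product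
  of the last coordinates is also bounded by that norm times the product of the weighted
  coordinates. Cauchy-Schwarz joins the two parts.\<close>

lemma form_bound:
  "\<bar>bform (blk (- 1) (int_mat A)) v w\<bar> \<le> max 1 (qsup A0 (int_mat A)) * N v * N w"
proof -
  let ?q = "qsup A0 (int_mat A)" and ?X = "norm (P0 *v vtail v)" and ?X' = "norm (P0 *v vtail w)"
  let ?Y = "a * \<bar>v $ None\<bar>" and ?Y' = "a * \<bar>w $ None\<bar>"
  have q1: "1 \<le> ?q * (a * a)" using b_le_qsup[of \<alpha> \<alpha>] by (simp add: norm_P0_alpha mult.assoc)
  then have q0: "?q > 0" using a_pos by (metis less_le_trans mult_pos_pos zero_less_mult_pos2 zero_less_one)
  have "\<bar>bform (blk (- 1) (int_mat A)) v w\<bar> \<le> \<bar>b (vtail v) (vtail w)\<bar> + \<bar>v $ None\<bar> * \<bar>w $ None\<bar>"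
    by (simp add: bform_blk abs_mult[symmetric])
  also have "\<bar>v $ None\<bar> * \<bar>w $ None\<bar> \<le> (\<bar>v $ None\<bar> * \<bar>w $ None\<bar>) * (?q * (a * a))"
    using mult_left_mono[OF q1, of "\<bar>v $ None\<bar> * \<bar>w $ None\<bar>"] by simp
  also have "\<bar>b (vtail v) (vtail w)\<bar> + (\<bar>v $ None\<bar> * \<bar>w $ None\<bar>) * (?q * (a * a)) \<le> ?q * (?X * ?X' + ?Y * ?Y')"
    using b_le_qsup[of "vtail v" "vtail w"] by (simp add: algebra_simps)
  also have "\<dots> \<le> ?q * (N v * N w)"
  proof (rule mult_left_mono)
    have "(p * p' + y * y')\<^sup>2 \<le> (y\<^sup>2 + p\<^sup>2) * (y'\<^sup>2 + p'\<^sup>2)" for p p' y y' :: real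
      using zero_le_power2[of "p * y' - y * p'"] by (simp add: power2_eq_square algebra_simps)
    then have "(?X * ?X' + ?Y * ?Y')\<^sup>2 \<le> (?Y\<^sup>2 + ?X\<^sup>2) * (?Y'\<^sup>2 + ?X'\<^sup>2)" .
    also have "\<dots> = (N v * N w)\<^sup>2" by (simp add: N_sq power_mult_distrib)
    finally show "?X * ?X' + ?Y * ?Y' \<le> N v * N w" by (rule power2_le_imp_le) simp
  qed (use q0 in simp)
  also have "\<dots> \<le> max 1 ?q * (N v * N w)" by (intro mult_right_mono) auto
  finally show ?thesis by (simp add: mult.assoc)
qed

lemma boost_nth [simp]: "boost c s v $ None = s * b (vtail v) \<alpha> + c * v $ None"
  "vtail (boost c s v) = vtail v + ((c - 1) * b (vtail v) \<alpha> + s * v $ None) *\<^sub>R \<alpha>"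
  by (simp_all add: boost_def)

lemma linear_boost: "linear (boost c s)"
  by (rule linearI) (simp_all add: vec_option_eq_iff algebra_simps)

lemma boost_inverse:
  assumes "c\<^sup>2 = 1 + s\<^sup>2"
  shows "boost c s (boost c (- s) v) = v"
proof -
  have cc: "c * c = 1 + s * s" using assms by (simp add: power2_eq_square)
  define \<beta> y where "\<beta> = b (vtail v) \<alpha>" and "y = v $ None"
  have \<beta>': "b (vtail (boost c (- s) v)) \<alpha> = c * \<beta> - s * y"
    by (simp add: \<beta>_def y_def algebra_simps)
  have y': "boost c (- s) v $ None = c * y - s * \<beta>" by (simp add: \<beta>_def y_def)
  have "s * (c * \<beta> - s * y) + c * (c * y - s * \<beta>) = (c * c - s * s) * y" by (simp add: algebra_simps)
  then have 1: "boost c s (boost c (- s) v) $ None = v $ None"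
    unfolding boost_nth(1)[of c s] \<beta>' y' using cc by (simp add: y_def)
  have "((c - 1) * \<beta> - s * y) + ((c - 1) * (c * \<beta> - s * y) + s * (c * y - s * \<beta>)) = (c * c - 1 - s * s) * \<beta>"
    by (simp add: algebra_simps)
  then have z: "((c - 1) * \<beta> - s * y) + ((c - 1) * (c * \<beta> - s * y) + s * (c * y - s * \<beta>)) = 0"
    using cc by simp
  have "vtail (boost c s (boost c (- s) v))
      = vtail (boost c (- s) v) + ((c - 1) * (c * \<beta> - s * y) + s * (c * y - s * \<beta>)) *\<^sub>R \<alpha>"
    unfolding boost_nth(2)[of c s] \<beta>' y' ..
  also have "vtail (boost c (- s) v) = vtail v + ((c - 1) * \<beta> - s * y) *\<^sub>R \<alpha>"
    by (simp add: \<beta>_def y_def)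
  finally have "vtail (boost c s (boost c (- s) v)) = vtail v"
    using z by (simp add: add.assoc flip: scaleR_add_left)
  then show ?thesis using 1 by (simp add: vec_option_eq_iff)
qed

lemma boost_form:
  assumes "c\<^sup>2 = 1 + s\<^sup>2"
  shows "bform (blk (- 1) (int_mat A)) (boost c s v) (boost c s w) = bform (blk (- 1) (int_mat A)) v w"
proof -
  have cc: "c * c = 1 + s * s" using assms by (simp add: power2_eq_square)
  define \<beta> y \<beta>' y' where "\<beta> = b (vtail v) \<alpha>" and "y = v $ None" and "\<beta>' = b (vtail w) \<alpha>" and "y' = w $ None"
  define D D' where "D = (c - 1) * \<beta> + s * y" and "D' = (c - 1) * \<beta>' + s * y'"
  have v: "vtail (boost c s v) = vtail v + D *\<^sub>R \<alpha>" "boost c s v $ None = s * \<beta> + c * y"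
    by (simp_all add: D_def \<beta>_def y_def)
  have w: "vtail (boost c s w) = vtail w + D' *\<^sub>R \<alpha>" "boost c s w $ None = s * \<beta>' + c * y'"
    by (simp_all add: D'_def \<beta>'_def y'_def)
  have "b \<alpha> (vtail w) = \<beta>'" by (simp add: \<beta>'_def b_commute)
  then have e1: "b (vtail v + D *\<^sub>R \<alpha>) (vtail w + D' *\<^sub>R \<alpha>) = b (vtail v) (vtail w) + (D' * \<beta> + D * \<beta>' + D * D')"
    by (simp add: algebra_simps flip: \<beta>_def)
  have "bform (blk (- 1) (int_mat A)) (boost c s v) (boost c s w)
      = b (vtail v) (vtail w) + (D' * \<beta> + D * \<beta>' + D * D' - (s * \<beta> + c * y) * (s * \<beta>' + c * y'))"
    unfolding bform_blk v w e1 by (simp add: algebra_simps)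
  also have "D' * \<beta> + D * \<beta>' + D * D' - (s * \<beta> + c * y) * (s * \<beta>' + c * y')
      = (c * c - 1 - s * s) * \<beta> * \<beta>' - (c * c - s * s) * (y * y')"
    unfolding D_def D'_def by (simp add: algebra_simps)
  also have "b (vtail v) (vtail w) + ((c * c - 1 - s * s) * \<beta> * \<beta>' - (c * c - s * s) * (y * y'))
      = b (vtail v) (vtail w) - y * y'" using cc by simp
  also have "\<dots> = bform (blk (- 1) (int_mat A)) v w" by (simp add: bform_blk y_def y'_def)
  finally show ?thesis .
qed

lemma N_boost_sq:
  "(N (boost c s v))\<^sup>2 = (norm (P0 *v vtail v + ((c - 1) * (a * b (vtail v) \<alpha>) + s * (a * v $ None)) *\<^sub>R ((1 / a) *\<^sub>R (P0 *v \<alpha>))))\<^sup>2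
     + (s * (a * b (vtail v) \<alpha>) + c * (a * v $ None))\<^sup>2"
proof -
  have "((c - 1) * (a * b (vtail v) \<alpha>) + s * (a * v $ None)) * (1 / a) = (c - 1) * b (vtail v) \<alpha> + s * v $ None"
    using a_pos by (simp add: field_simps)
  then have "P0 *v vtail v + ((c - 1) * (a * b (vtail v) \<alpha>) + s * (a * v $ None)) *\<^sub>R ((1 / a) *\<^sub>R (P0 *v \<alpha>))
      = P0 *v vtail (boost c s v)"
    by (simp only: scaleR_scaleR boost_nth matrix_vector_right_distrib matrix_vector_mult_scaleR)
  moreover have "s * (a * b (vtail v) \<alpha>) + c * (a * v $ None) = a * boost c s v $ None"
    by (simp add: algebra_simps)
  ultimately show ?thesis by (simp only: N_sq add.commute)
qed

lemma norm_unit_alpha: "norm ((1 / a) *\<^sub>R (P0 *v \<alpha>)) = 1"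
  using a_pos by (simp add: norm_P0_alpha)

lemma N_boost_le:
  assumes "c\<^sup>2 = 1 + s\<^sup>2" "c \<ge> 1" "s \<ge> 0"
  shows "N (boost c s v) \<le> (c + s) * (a * \<kappa>) * N v"
proof -
  obtain d where d: "\<And>x. d \<bullet> (P0 *v x) = a * b x \<alpha>" "norm d \<le> a * \<kappa>" using dual_vector by blast
  have du: "d \<bullet> ((1 / a) *\<^sub>R (P0 *v \<alpha>)) = 1" using a_pos by (simp add: d)
  have "(N (boost c s v))\<^sup>2 \<le> ((c + s) * norm d)\<^sup>2 * ((norm (P0 *v vtail v))\<^sup>2 + (a * v $ None)\<^sup>2)"
    unfolding N_boost_sq d(1)[symmetric] by (rule boost_norm_le[OF norm_unit_alpha du assms])
  also have "\<dots> = ((c + s) * norm d)\<^sup>2 * (N v)\<^sup>2" by (simp add: N_sq)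
  also have "\<dots> \<le> ((c + s) * (a * \<kappa>))\<^sup>2 * (N v)\<^sup>2"
    using d(2) assms by (intro mult_right_mono power_mono mult_left_mono) auto
  finally have "(N (boost c s v))\<^sup>2 \<le> ((c + s) * (a * \<kappa>) * N v)\<^sup>2" by (simp add: power_mult_distrib)
  then show ?thesis
    by (rule power2_le_imp_le) (use assms a_pos kappa_pos in simp)
qed

lemma N_boost_ge:
  assumes "c\<^sup>2 = 1 + s\<^sup>2" "c \<ge> 1" and v: "v $ None = 0"
  shows "norm (P0 *v vtail v) / sqrt 2 \<le> N (boost c s v)"
proof -
  have "(norm (P0 *v vtail v))\<^sup>2 \<le> 2 * (N (boost c s v))\<^sup>2"
    using boost_norm_ge[OF norm_unit_alpha assms(1,2), of "P0 *v vtail v" "a * b (vtail v) \<alpha>"]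
    by (simp add: N_boost_sq v)
  then have "(norm (P0 *v vtail v))\<^sup>2 \<le> (sqrt 2 * N (boost c s v))\<^sup>2" by (simp add: power_mult_distrib)
  then have "norm (P0 *v vtail v) \<le> sqrt 2 * N (boost c s v)" by (rule power2_le_imp_le) simp
  then show ?thesis by (simp add: divide_le_eq mult.commute)
qed

text \<open>The reflection \<open>(x, y) \<mapsto> (x, -y)\<close> conjugates a boost to its inverse.\<close>

lemma abs_det_boost:
  assumes "c\<^sup>2 = 1 + s\<^sup>2"
  shows "\<bar>det (matrix (boost c s))\<bar> = 1"
proof -
  define J where "J v = vcons (- (v $ None)) (vtail v)" for v :: "real ^ 'n option"
  have linJ: "linear J" by (rule linearI) (simp_all add: J_def vec_option_eq_iff)
  have JJ: "J \<circ> J = id" by (auto simp: J_def fun_eq_iff vec_option_eq_iff)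
  have conj: "boost c (- s) = J \<circ> (boost c s \<circ> J)"
    by (auto simp: J_def fun_eq_iff vec_option_eq_iff)
  have "boost c s \<circ> boost c (- s) = id" using boost_inverse[OF assms] by (auto simp: fun_eq_iff)
  then have "det (matrix (boost c s)) * det (matrix (boost c (- s))) = 1"
    using matrix_compose[OF linear_boost linear_boost, of c s c "- s"] by (metis det_mul matrix_id)
  moreover have "det (matrix J) * det (matrix J) = 1"
    using matrix_compose[OF linJ linJ] JJ by (metis det_mul matrix_id)
  moreover have "det (matrix (boost c (- s))) = det (matrix J) * (det (matrix (boost c s)) * det (matrix J))"
    unfolding conj using matrix_compose[OF linear_compose[OF linJ linear_boost] linJ, of c s]
      matrix_compose[OF linJ linear_boost, of c s] by (simp add: det_mul)
  ultimately have 1: "det (matrix (boost c s)) * (det (matrix J) * (det (matrix (boost c s)) * det (matrix J))) = 1"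
    and 2: "det (matrix J) * det (matrix J) = 1" by simp_all
  have "(det (matrix (boost c s)))\<^sup>2 = (det (matrix J) * det (matrix J)) * (det (matrix (boost c s)))\<^sup>2"
    by (simp add: 2)
  also have "\<dots> = 1" using 1 by (simp only: power2_eq_square mult_ac)
  finally have "(det (matrix (boost c s)))\<^sup>2 = 1" .
  then show ?thesis by (simp add: power2_eq_1_iff) auto
qed

end

section \<open>Short isotropic vectors\<close>

lemma sqrt_power_powr: "x > 0 \<Longrightarrow> sqrt x ^ k = x powr (real k / 2)"
  by (simp add: powr_half_sqrt[symmetric] powr_powr flip: powr_realpow)

lemma finite_bounded_int_vec: "finite {z :: int ^ 'n. \<forall>i. \<bar>z $ i\<bar> \<le> B}"
proof (rule finite_subset)
  show "{z :: int ^ 'n. \<forall>i. \<bar>z $ i\<bar> \<le> B} \<subseteq> vec_lambda ` (UNIV \<rightarrow>\<^sub>E {- B..B})"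
  proof
    fix z :: "int ^ 'n" assume z: "z \<in> {z. \<forall>i. \<bar>z $ i\<bar> \<le> B}"
    show "z \<in> vec_lambda ` (UNIV \<rightarrow>\<^sub>E {- B..B})"
    proof (rule image_eqI[of _ _ "vec_nth z"])
      show "vec_nth z \<in> UNIV \<rightarrow>\<^sub>E {- B..B}" using z by (auto simp: abs_le_iff minus_le_iff)
    qed simp
  qed
  show "finite (vec_lambda ` (UNIV \<rightarrow>\<^sub>E {- B..B}) :: (int ^ 'n) set)"
    by (intro finite_imageI finite_PiE) auto
qed

lemma (in lattice_form) finite_bounded_points: "finite {z. norm (pt z) \<le> C}"
proof -
  obtain K where K: "K > 0" "\<And>x. norm (matrix_inv P *v x) \<le> K * norm x"
    using linear_bounded_pos[OF matrix_vector_mul_linear[of "matrix_inv P"]] by blast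
  show ?thesis
  proof (rule finite_subset[OF _ finite_bounded_int_vec[of "\<lceil>K * C\<rceil>"]], safe)
    fix z i assume "norm (pt z) \<le> C"
    then have "norm (int_vec z :: real ^ 'm) \<le> K * C"
      using order_trans[OF K(2)[of "pt z"] mult_left_mono[of "norm (pt z)" C K]] K(1)
      by (simp add: pt_def)
    then have "\<bar>real_of_int (z $ i)\<bar> \<le> K * C"
      using component_le_norm_cart[of "int_vec z" i] by simp
    then show "\<bar>z $ i\<bar> \<le> \<lceil>K * C\<rceil>" by linarith
  qed
qed

context quadric
begin

lemma lambda1_le:
  assumes "l \<noteq> 0"
  shows "lambda1 A0 \<le> norm (P0 *v int_vec l)"
  unfolding lambda1_def
proof (rule cInf_lower)
  show "norm (P0 *v int_vec l) \<in> {qnorm A0 (int_vec l) | l :: int ^ 'n. l \<noteq> 0}"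
    using assms by (auto simp: qnorm_eq)
  show "bdd_below {qnorm A0 (int_vec l) | l :: int ^ 'n. l \<noteq> 0}"
    by (rule bdd_belowI[of _ 0]) (auto simp: qnorm_eq)
qed

lemma lambda1_pos: "lambda1 A0 > 0"
proof -
  obtain R where R: "\<And>x. R *v (P0 *v x) = x" using P0_inverse by metis
  obtain C where C: "C > 0" "\<And>x. norm (R *v x) \<le> C * norm x"
    using linear_bounded_pos[OF matrix_vector_mul_linear[of R]] by blast
  have "1 / C \<le> lambda1 A0"
    unfolding lambda1_def
  proof (rule cInf_greatest)
    have "qnorm A0 (int_vec 1) \<in> {qnorm A0 (int_vec l) | l :: int ^ 'n. l \<noteq> 0}"
      by (intro CollectI exI[of _ 1]) (simp add: vec_eq_iff)
    then show "{qnorm A0 (int_vec l) | l :: int ^ 'n. l \<noteq> 0} \<noteq> {}" by blast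
    fix t assume "t \<in> {qnorm A0 (int_vec l) | l :: int ^ 'n. l \<noteq> 0}"
    then obtain l :: "int ^ 'n" where l: "l \<noteq> 0" "t = norm (P0 *v int_vec l)" by (auto simp: qnorm_eq)
    then obtain i where "l $ i \<noteq> 0" by (auto simp: vec_eq_iff)
    then have "1 \<le> \<bar>l $ i\<bar>" by linarith
    then have "1 \<le> \<bar>real_of_int (l $ i)\<bar>" by linarith
    also have "\<dots> \<le> norm (int_vec l :: real ^ 'n)"
      using component_le_norm_cart[of "int_vec l :: real ^ 'n" i] by simp
    also have "\<dots> \<le> C * t" using C(2)[of "P0 *v int_vec l"] l(2) by (simp add: R)
    finally show "1 / C \<le> t" using C(1) by (simp add: divide_le_eq mult.commute)
  qed
  then show ?thesis using C(1) by (meson less_le_trans zero_less_divide_1_iff)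
qed

text \<open>A vector that is short after the boost is close to the line spanned by \<open>(\<alpha>, 1)\<close>.\<close>

lemma boost_defect_le:
  assumes "c\<^sup>2 = 1 + s\<^sup>2"
  shows "(c + s) * \<bar>b (vtail v) \<alpha> - v $ None\<bar> \<le> \<kappa> * (sqrt 2 * N (boost c (- s) v))"
proof (cases "c + s \<ge> 0")
  case True
  let ?g = "boost c (- s) v"
  let ?X = "norm (P0 *v vtail ?g)" and ?Y = "a * \<bar>?g $ None\<bar>"
  \<comment> \<open>The form b(x, \<alpha>) - y is an eigenform of \<open>boost c (- s)\<close> with
    eigenvalue \<open>c + s\<close>.\<close>
  have "(c + s) * (b (vtail v) \<alpha> - v $ None) = b (vtail ?g) \<alpha> - ?g $ None"
    by (simp add: algebra_simps)
  then have "(c + s) * \<bar>b (vtail v) \<alpha> - v $ None\<bar> = \<bar>b (vtail ?g) \<alpha> - ?g $ None\<bar>"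
    using True by (metis abs_mult abs_of_nonneg)
  also have "\<dots> \<le> \<bar>b (vtail ?g) \<alpha>\<bar> + \<bar>?g $ None\<bar>" by (rule abs_triangle_ineq4)
  also have "\<bar>b (vtail ?g) \<alpha>\<bar> \<le> \<kappa> * ?X" by (rule b_alpha_le)
  also have "\<bar>?g $ None\<bar> \<le> \<kappa> * ?Y"
    using mult_right_mono[OF kappa_a, of "\<bar>?g $ None\<bar>"] by (simp add: mult.assoc)
  also have "\<kappa> * ?X + \<kappa> * ?Y = \<kappa> * (?X + ?Y)" by (simp add: distrib_left)
  also have "\<dots> \<le> \<kappa> * (sqrt 2 * N ?g)"
  proof (rule mult_left_mono)
    \<comment> \<open>The sqrt 2 in the final estimate of q(\<alpha>\<phi> - \<upsilon>) comes from
      adding the two orthogonal parts of \<open>N\<close> here.\<close>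
    have "(p + q)\<^sup>2 \<le> 2 * (q\<^sup>2 + p\<^sup>2)" for p q :: real
      using zero_le_power2[of "p - q"] by (simp add: power2_eq_square algebra_simps)
    then have "(?X + ?Y)\<^sup>2 \<le> 2 * (?Y\<^sup>2 + ?X\<^sup>2)" .
    also have "\<dots> = (sqrt 2 * N ?g)\<^sup>2" by (simp add: power_mult_distrib N_sq)
    finally show "?X + ?Y \<le> sqrt 2 * N ?g" by (rule power2_le_imp_le) simp
  qed (use kappa_pos in simp)
  finally show ?thesis by simp
next
  case False
  then have "(c + s) * \<bar>b (vtail v) \<alpha> - v $ None\<bar> \<le> 0" by (intro mult_nonpos_nonneg) auto
  also have "\<dots> \<le> \<kappa> * (sqrt 2 * N (boost c (- s) v))" using kappa_pos by simp
  finally show ?thesis .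
qed

text \<open>The hypothesis \<open>iso\<close> makes the coordinate \<open>y\<close> nonzero on every maximal isotropic lattice.\<close>

lemma short_isotropic_vector:
  assumes iso: "iso_Q A > iso_q A" and detA0: "\<bar>det P0\<bar> = sqrt (det A0)"
    and cs: "c\<^sup>2 = 1 + s\<^sup>2" and c: "c \<ge> 1"
  obtains z where "bform (blk (- 1) A) z z = 0" "z $ None > 0"
    "N (boost c (- s) (int_vec z)) \<le> T_bound A0 A \<alpha>"
proof -
  define \<sigma> where "\<sigma> = max 1 (qsup A0 (int_mat A))"
  define P where "P = blk a P0 ** matrix (boost c (- s))"
  have cs': "c\<^sup>2 = 1 + (- s)\<^sup>2" using cs by simp
  have Pv: "P *v v = blk a P0 *v boost c (- s) v" for v
    by (simp add: P_def linear_boost flip: matrix_vector_mul_assoc)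
  have normP: "norm (P *v v) = N (boost c (- s) v)" for v by (simp add: Pv N_def)
  have detP: "\<bar>det P\<bar> = a * sqrt (det A0)"
    using abs_det_boost[OF cs'] a_pos by (simp add: P_def det_mul det_blk abs_mult detA0)
  \<comment> \<open>A boost is an isometry of the form, so the bound by \<open>\<sigma>\<close>
    passes to the boosted lattice with the same integer matrix. The functional is the coordinate at
    \<open>None\<close>.\<close>
  interpret lf: lattice_form P "blk (- 1) A" \<sigma> "axis None 1"
  proof
    show "det P \<noteq> 0" using detP a_pos detA0 det_P0 by auto
    show "transpose (blk (- 1) A) = blk (- 1) A" by (rule transpose_blk[OF A_sym])
    show "\<sigma> > 0" by (simp add: \<sigma>_def)
    fix x y
    show "\<bar>bform (int_mat (blk (- 1) A)) x y\<bar> \<le> \<sigma> * norm (P *v x) * norm (P *v y)"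
      using form_bound[of "boost c (- s) x" "boost c (- s) y"]
      by (simp add: int_mat_blk boost_form[OF cs'] normP \<sigma>_def)
  qed
  have L: "lf.L z = z $ None" for z
    unfolding lf.L_def by (simp add: UNIV_option_sum axis_def)
  have norm_pt: "norm (lf.pt z) = N (boost c (- s) (int_vec z))" for z
    by (simp add: lf.pt_def normP)
  have injP: "inj ((*v) P)" using lf.det_P by (metis inj_matrix_vector_mult invertible_det_nz)
  have indep: "indep_family I (\<lambda>i. lf.pt (v i)) \<longleftrightarrow> indep_family I (\<lambda>i. int_vec (v i) :: real ^ 'n option)"
    for I :: "'n option set" and v
    unfolding lf.pt_def by (rule indep_family_linear_image_iff[OF matrix_vector_mul_linear injP finite])
  obtain I and v :: "'n option \<Rightarrow> int ^ 'n option" where cI: "card I = Suc (iso_q A)"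
    and v: "indep_family I (\<lambda>i. int_vec (v i) :: real ^ 'n option)"
      "\<And>i j. i \<in> I \<Longrightarrow> j \<in> I \<Longrightarrow> bform (blk (- 1) A) (v i) (v j) = 0"
    using isotropic_integer_family_exists[OF A_sym iso] by blast
  have fam: "lf.isotropic_family I v" using v by (simp add: lf.isotropic_family_def indep)
  have nof: "\<exists>i\<in>I. lf.L (u i) \<noteq> 0" if "lf.isotropic_family I u" for u
    using no_isotropic_integer_family[OF cI, of u] that unfolding lf.isotropic_family_def indep L by blast
  define S where "S = {z. bform (blk (- 1) A) z z = 0 \<and> z $ None \<noteq> 0}"
  obtain z1 where z1: "z1 \<in> S" using nof[OF fam] v(2) by (auto simp: S_def L)
  define S1 where "S1 = {z \<in> S. norm (lf.pt z) \<le> norm (lf.pt z1)}"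
  have "finite S1" by (rule finite_subset[OF _ lf.finite_bounded_points[of "norm (lf.pt z1)"]]) (auto simp: S1_def)
  moreover have "z1 \<in> S1" using z1 by (simp add: S1_def)
  ultimately obtain z where z: "z \<in> S1" "\<And>z'. z' \<in> S1 \<Longrightarrow> norm (lf.pt z) \<le> norm (lf.pt z')"
    using ex_min_if_finite[of "(\<lambda>z. norm (lf.pt z)) ` S1"] by (metis (no_types, lifting) empty_iff finite_imageI imageE image_eqI not_le)
  define X where "X = norm (lf.pt z)"
  have zS: "z \<in> S" using z(1) by (simp add: S1_def)
  have X_le: "X \<le> norm (lf.pt z')" if "bform (blk (- 1) A) z' z' = 0" "lf.L z' \<noteq> 0" for z'
    using z that unfolding X_def S1_def S_def L by force
  have "z \<noteq> 0" using zS by (auto simp: S_def)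
  then have Xpos: "X > 0" by (simp add: X_def)
  define \<mu> where "\<mu> = lambda1 A0 / sqrt 2"
  have \<mu>pos: "\<mu> > 0" using lambda1_pos by (simp add: \<mu>_def)
  have \<mu>_le: "\<mu> \<le> norm (lf.pt z')" if "z' \<noteq> 0" "lf.L z' = 0" for z'
  proof -
    have n: "z' $ None = 0" using that(2) by (simp add: L)
    then have "vtail z' \<noteq> 0" using that(1) by (auto simp: vec_option_eq_iff)
    then have "\<mu> \<le> norm (P0 *v vtail (int_vec z' :: real ^ 'n option)) / sqrt 2"
      unfolding \<mu>_def using lambda1_le[of "vtail z'"] by (simp add: divide_right_mono)
    also have "\<dots> \<le> norm (lf.pt z')" unfolding norm_pt by (rule N_boost_ge[OF cs' c]) (simp add: n)
    finally show ?thesis .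
  qed
  define n where "n = CARD('n)"
  define d where "d = card I"
  define e where "e = card (- I)"
  have "d + e = card (UNIV :: 'n option set)"
    using card_Un_disjoint[of I "- I"] by (simp add: d_def e_def Compl_partition)
  then have de: "d + e = Suc n" by (simp add: n_def)
  \<comment> \<open>Isotropic vectors cannot span everything, since the form takes the value -1 at
    the unit vector of the last coordinate.\<close>
  have "e \<noteq> 0"
  proof
    assume "e = 0"
    then have I: "I = UNIV" by (auto simp: e_def)
    have w: "inj_on (\<lambda>i. lf.pt (v i)) I" "independent ((\<lambda>i. lf.pt (v i)) ` I)"
      using fam by (auto simp: lf.isotropic_family_def indep_family_def)
    have "UNIV \<subseteq> span ((\<lambda>i. lf.pt (v i)) ` I)"
      by (rule card_ge_dim_independent[OF subset_UNIV w(2)]) (use w(1) in \<open>simp add: card_image I\<close>)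
    then have "lf.H (lf.pt (vcons 1 0)) (lf.pt (vcons 1 0)) = 0"
      by (intro lf.H_isotropic_span[OF fam]) auto
    then show False by (simp add: lf.H_pt bform_blk) (simp add: bform_def)
  qed
  then have e1: "e \<ge> 1" and d1: "d \<ge> 1" by (auto simp: d_def cI)
  have \<sigma>1: "\<sigma> > 0" by (simp add: \<sigma>_def)
  \<comment> \<open>The shift cancels: d = i(q) + 1 inside dimension n + 1 leaves codimension n -
    i(q), the exponent in \<open>T_zero\<close>.\<close>
  have ne: "real n - real (iso_q A) = real e" using de cI by (simp add: d_def)
  define T0 where "T0 = T_zero A0 A \<alpha>"
  have T0_eq: "T0 = real n powr (real n / 2) * (2 * \<sigma>) powr (real e / 2) * a * sqrt (det A0)"
    unfolding T0_def T_zero_def n_def[symmetric] ne by (simp add: \<sigma>_def a_def)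
  have n1: "n \<ge> 1" by (simp add: n_def Suc_leI)
  have T0pos: "T0 > 0"
    unfolding T0_eq using n1 \<sigma>1 a_pos detA0 det_P0 by (intro mult_pos_pos) (auto simp flip: detA0)
  have bound: "sqrt d ^ d * sqrt (2 * \<sigma> * e) ^ e * \<bar>det P\<bar> \<le> T0"
  proof -
    have "sqrt d ^ d * sqrt e ^ e = sqrt (real d ^ d * real e ^ e)" by (simp add: real_sqrt_mult real_sqrt_power)
    also have "\<dots> \<le> sqrt (real n ^ n)"
      using self_power_mult_le[OF d1 e1] de by (intro real_sqrt_le_mono) simp
    also have "\<dots> = real n powr (real n / 2)" using n1 by (simp add: real_sqrt_power sqrt_power_powr)
    finally have 1: "sqrt d ^ d * sqrt e ^ e \<le> real n powr (real n / 2)" .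
    have "sqrt d ^ d * sqrt (2 * \<sigma> * e) ^ e = (sqrt d ^ d * sqrt e ^ e) * (2 * \<sigma>) powr (real e / 2)"
      using \<sigma>1 by (simp add: real_sqrt_mult[of "2 * \<sigma>"] power_mult_distrib flip: sqrt_power_powr)
    also have "\<dots> \<le> real n powr (real n / 2) * (2 * \<sigma>) powr (real e / 2)"
      using 1 by (rule mult_right_mono) simp
    finally have "sqrt d ^ d * sqrt (2 * \<sigma> * e) ^ e * \<bar>det P\<bar>
        \<le> real n powr (real n / 2) * (2 * \<sigma>) powr (real e / 2) * \<bar>det P\<bar>"
      by (rule mult_right_mono) simp
    then show ?thesis by (simp add: T0_eq detP mult.assoc)
  qed
  have d_minus: "d - 1 = iso_q A" by (simp add: d_def cI)
  have minima: "m ^ iso_q A * X \<le> T0" if "0 < m" "m \<le> X" "m \<le> \<mu>" for m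
  proof -
    have "m ^ (d - 1) * X \<le> sqrt d ^ d * sqrt (2 * \<sigma> * e) ^ e * \<bar>det P\<bar>"
      unfolding d_def e_def
      by (rule lf.isotropic_minima_bound[OF fam nof X_le _ that(1,2)])
         (use \<mu>_le that(3) in \<open>auto intro: order_trans\<close>)
    then show ?thesis unfolding d_minus using bound by (rule order_trans)
  qed
  \<comment> \<open>The lower bound for vectors with \<phi> = 0 may not exceed \<open>X\<close>. If
    \<open>\<mu> \<le> X\<close> it is used as it stands and gives the second term of the maximum;
    otherwise \<open>X\<close> takes its place, and a root of order i(q) + 1 gives the
    first.\<close>
  have "X \<le> T_bound A0 A \<alpha>"
  proof (cases "\<mu> \<le> X")
    case True
    then have "\<mu> ^ iso_q A * X \<le> T0" using minima[of \<mu>] \<mu>pos by simp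
    then have "(1 / \<mu>) ^ iso_q A * (\<mu> ^ iso_q A * X) \<le> (1 / \<mu>) ^ iso_q A * T0"
      using \<mu>pos by (intro mult_left_mono) auto
    then have "X \<le> (1 / \<mu>) ^ iso_q A * T0" using \<mu>pos by (simp add: power_divide)
    then show ?thesis unfolding T_bound_def by (simp add: \<mu>_def T0_def le_max_iff_disj)
  next
    case False
    then have "X ^ Suc (iso_q A) \<le> T0" using minima[of X] Xpos by (simp add: mult.commute)
    then have "X powr real (Suc (iso_q A)) \<le> T0" using Xpos by (simp only: powr_realpow)
    then have "(X powr real (Suc (iso_q A))) powr (1 / real (Suc (iso_q A))) \<le> T0 powr (1 / real (Suc (iso_q A)))"
      by (intro powr_mono2) auto
    then have "X \<le> T0 powr (1 / (real (iso_q A) + 1))" using Xpos by (simp add: powr_powr add.commute)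
    then show ?thesis unfolding T_bound_def by (simp add: T0_def le_max_iff_disj)
  qed
  then have N_le: "N (boost c (- s) (int_vec z)) \<le> T_bound A0 A \<alpha>" by (simp add: X_def norm_pt)
  show ?thesis
  proof (cases "z $ None > 0")
    case True
    then show ?thesis using that[of z] zS N_le by (simp add: S_def)
  next
    case False
    have "lf.pt (- 1 *s z) = - lf.pt z" by (simp only: lf.pt_simps) simp
    then have "norm (lf.pt (- 1 *s z)) = norm (lf.pt z)" by simp
    then have "N (boost c (- s) (int_vec (- 1 *s z))) \<le> T_bound A0 A \<alpha>" using N_le by (simp only: norm_pt)
    moreover have "bform (blk (- 1) A) (- 1 *s z) (- 1 *s z) = 0"
      using zS by (simp only: bform_simps) (simp add: S_def)
    ultimately show ?thesis using that[of "- 1 *s z"] zS False by (simp add: S_def)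
  qed
qed

end

section \<open>Choice of the boost and the final estimates\<close>

theorem theorem2:
  fixes A0 :: "real ^ 'n ^ 'n"
    and A :: "int ^ 'n ^ 'n"
    and \<alpha> :: "real ^ 'n"
    and T :: real
  assumes A0_sym: "transpose A0 = A0"
    and A0_pos: "\<And>x. x \<noteq> 0 \<Longrightarrow> qform A0 x > 0"
    and A_sym: "transpose A = A"
    and alpha: "qform (int_mat A) \<alpha> = 1"
    and iso: "iso_Q A > iso_q A"
    and T: "T \<ge> T_bound A0 A \<alpha>"
  shows "\<exists>(\<upsilon> :: int ^ 'n) (\<phi> :: int).
    qform A \<upsilon> = \<phi>\<^sup>2 \<and> \<phi>\<^sup>2 \<noteq> 0 \<and>
    (qnorm A0 (int_vec \<upsilon>))\<^sup>2 + (of_int \<phi> * qnorm A0 \<alpha>)\<^sup>2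
      \<le> (qnorm A0 \<alpha> * opnorm A0 (\<lambda>x. bform (int_mat A) x \<alpha>) * T)\<^sup>2 \<and>
    \<bar>qform (int_mat A) (of_int \<phi> *\<^sub>R \<alpha> - int_vec \<upsilon>)\<bar>
      \<le> 2 * sqrt 2 * (T_bound A0 A \<alpha>)\<^sup>2 * of_int \<phi> / T * opnorm A0 (\<lambda>x. bform (int_mat A) x \<alpha>)"
proof -
  obtain P0 :: "real ^ 'n ^ 'n" where fac: "\<And>x y. (P0 *v x) \<bullet> (P0 *v y) = bform A0 x y"
    "det P0 \<noteq> 0" "\<bar>det P0\<bar> = sqrt (det A0)"
    using positive_definite_factorization[OF A0_sym A0_pos] by blast
  interpret quadric A0 P0 A \<alpha> by unfold_locales (use fac A_sym alpha in auto)
  define B where "B = T_bound A0 A \<alpha>"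
  have "T_zero A0 A \<alpha> > 0"
    using a_pos fac(2,3) unfolding T_zero_def a_def[symmetric]
    by (intro mult_pos_pos) (auto simp flip: fac(3))
  then have "0 < T_zero A0 A \<alpha> powr (1 / (real (iso_q A) + 1))" by simp
  then have Bpos: "B > 0" unfolding B_def T_bound_def by (simp add: less_max_iff_disj)
  have BT: "B \<le> T" using T by (simp add: B_def)
  \<comment> \<open>With \<open>t\<close> = exp \<tau>, the numbers \<open>c\<close> and
    \<open>s\<close> below are cosh \<tau> and sinh \<tau>; \<open>boost c (- s)\<close> then
    multiplies (\<alpha>, 1) by \<open>1 / t = B / T\<close>.\<close>
  define t where "t = T / B"
  have t1: "t \<ge> 1" using BT Bpos by (simp add: t_def)
  define c where "c = (t + 1 / t) / 2"
  define s where "s = (t - 1 / t) / 2"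
  have cs: "c\<^sup>2 = 1 + s\<^sup>2" using t1 by (simp add: c_def s_def power2_eq_square field_simps)
  have cst: "c + s = t" by (simp add: c_def s_def field_simps)
  have "1 / t \<le> 1" using t1 by simp
  then have "1 / t \<le> t" using t1 by (rule order_trans)
  then have s0: "s \<ge> 0" by (simp add: s_def)
  have "1\<^sup>2 \<le> c\<^sup>2" unfolding cs by simp
  moreover have "0 \<le> c" using t1 by (simp add: c_def)
  ultimately have c1: "c \<ge> 1" by (rule power2_le_imp_le)
  obtain z where z: "bform (blk (- 1) A) z z = 0" "z $ None > 0"
    and Nz: "N (boost c (- s) (int_vec z)) \<le> B"
    using short_isotropic_vector[OF iso fac(3) cs c1] unfolding B_def by blast
  define \<upsilon> \<phi> where "\<upsilon> = vtail z" and "\<phi> = z $ None"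
  have q\<upsilon>: "qform A \<upsilon> = \<phi>\<^sup>2"
    using z(1) by (simp add: bform_blk qform_def \<upsilon>_def \<phi>_def power2_eq_square)
  have \<phi>0: "\<phi> > 0" using z(2) by (simp add: \<phi>_def)
  \<comment> \<open>Undoing the boost costs the factor \<open>t * (a * \<kappa>)\<close>, and
    \<open>t * B = T\<close> turns the bound \<open>B\<close> into the one claimed.\<close>
  have "N (int_vec z) \<le> t * (a * \<kappa>) * N (boost c (- s) (int_vec z))"
    using N_boost_le[OF cs c1 s0, of "boost c (- s) (int_vec z)"] by (simp add: boost_inverse[OF cs] cst)
  also have "\<dots> \<le> t * (a * \<kappa>) * B" using Nz t1 a_pos kappa_pos by (intro mult_left_mono) auto
  also have "\<dots> = a * \<kappa> * T" using Bpos by (simp add: t_def)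
  finally have "(N (int_vec z))\<^sup>2 \<le> (a * \<kappa> * T)\<^sup>2" by (intro power_mono) auto
  then have 1: "(qnorm A0 (int_vec \<upsilon>))\<^sup>2 + (of_int \<phi> * qnorm A0 \<alpha>)\<^sup>2 \<le> (a * \<kappa> * T)\<^sup>2"
    by (simp add: N_sq \<upsilon>_def \<phi>_def qnorm_eq norm_P0_alpha mult.commute)
  define \<beta> where "\<beta> = b (int_vec \<upsilon>) \<alpha>"
  have "t * \<bar>\<beta> - \<phi>\<bar> \<le> \<kappa> * (sqrt 2 * B)"
  proof -
    have "t * \<bar>\<beta> - \<phi>\<bar> \<le> \<kappa> * (sqrt 2 * N (boost c (- s) (int_vec z)))"
      using boost_defect_le[OF cs, of "int_vec z"] by (simp add: cst \<beta>_def \<upsilon>_def \<phi>_def)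
    also have "\<dots> \<le> \<kappa> * (sqrt 2 * B)" using Nz kappa_pos by (intro mult_left_mono) auto
    finally show ?thesis .
  qed
  then have \<beta>: "\<bar>\<beta> - \<phi>\<bar> \<le> \<kappa> * sqrt 2 * B\<^sup>2 / T"
    using Bpos BT by (simp add: t_def field_simps power2_eq_square)
  have "b (int_vec \<upsilon>) (int_vec \<upsilon>) = real_of_int (\<phi>\<^sup>2)"
    unfolding q\<upsilon>[symmetric] by (simp add: bform_int_vec qform_def)
  then have "qform (int_mat A) (of_int \<phi> *\<^sub>R \<alpha> - int_vec \<upsilon>) = 2 * \<phi> * (\<phi> - \<beta>)"
    by (simp add: qform_def b_commute[of \<alpha> "int_vec \<upsilon>"] power2_eq_square algebra_simps flip: \<beta>_def)
  then have "\<bar>qform (int_mat A) (of_int \<phi> *\<^sub>R \<alpha> - int_vec \<upsilon>)\<bar> = 2 * \<phi> * \<bar>\<beta> - \<phi>\<bar>"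
    using \<phi>0 by (simp add: abs_mult abs_minus_commute)
  also have "\<dots> \<le> 2 * \<phi> * (\<kappa> * sqrt 2 * B\<^sup>2 / T)"
    using \<beta> \<phi>0 by (intro mult_left_mono) auto
  also have "\<dots> = 2 * sqrt 2 * B\<^sup>2 * of_int \<phi> / T * \<kappa>" by simp
  finally have 2: "\<bar>qform (int_mat A) (of_int \<phi> *\<^sub>R \<alpha> - int_vec \<upsilon>)\<bar>
      \<le> 2 * sqrt 2 * B\<^sup>2 * of_int \<phi> / T * \<kappa>" .
  show ?thesis
    using q\<upsilon> \<phi>0 1 2 unfolding a_def \<kappa>_def B_def by (intro exI[of _ \<upsilon>] exI[of _ \<phi>]) auto
qed

end
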